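(* For every integer $n\geq 2$, the Brin--Thompson group $nV$ does not embed into any braided diagram group; that is, there do not exist a semigroup presentation $\mathcal{P}=\langle\Sigma\mid\mathcal{R}\rangle$, a word $w\in\Sigma^+$ and an injective group homomorphism $nV\to D_b(\mathcal{P},w)$.
   Context: Brin--Thompson group. Let $\mathfrak{C}=\{0,1\}^{\mathbb{N}}$. A dyadic brick in $\mathfrak{C}^n$ is a product $u_1\mathfrak{C}\times\cdots\times u_n\mathfrak{C}$ with $u_1,\dots,u_n$ finite binary words. $nV$ is the group of homeomorphisms $f$ of $\mathfrak{C}^n$ for which there are two finite partitions of $\mathfrak{C}^n$ into the same number of dyadic bricks such that $f$ maps each brick $u_1\mathfrak{C}\times\cdots\times u_n\mathfrak{C}$ of the first onto a brick $v_1\mathfrak{C}\times\cdots\times v_n\mathfrak{C}$ of the second via $(u_1x_1,\dots,u_nx_n)\mapsto(v_1x_1,\dots,v_nx_n)$. Semigroup presentations. $\mathcal{P}=\langle\Sigma\mid\mathcal{R}\rangle$ consists of an alphabet $\Sigma$ and a set $\mathcal{R}$ of relations $u=v$ with $u,v\in\Sigma^+$ (non-empty words), with the convention that if $u=v$ belongs to $\mathcal{R}$ then $v=u$ does not (so no relation $u=u$). Braided diagrams. A wire is a copy of $[0,1]$ with bottom $0$ and top $1$. A transistor is a copy of $[0,1]^2$ and a frame is a copy of $\partial[0,1]^2$; both have top, bottom, left and right sides, the top and bottom sides being ordered left-to-right. A braided diagram $\Delta$ over $\mathcal{P}$ is a labelled oriented quotient space obtained from a finite non-empty collection of wires labelled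 by letters of $\Sigma$, a finite (possibly empty) collection of transistors, and a frame, such that: each endpoint of each wire is attached to a transistor or to the frame; the bottom of a wire is attached to the top side of a transistor or to the bottom side of the frame; the top of a wire is attached to the bottom side of a transistor or to the top side of the frame; images of distinct wires are disjoint; for each transistor $T$, if $\mathrm{top}(T)$ (resp. $\mathrm{bot}(T)$) is the word read left-to-right from the labels of wires attached to its top (resp. bottom) side, then $\mathrm{top}(T)=\mathrm{bot}(T)$ or $\mathrm{bot}(T)=\mathrm{top}(T)$ belongs to $\mathcal{R}$; writing $T_1\prec T_2$ when some wire has its bottom on the top side of $T_1$ and its top on the bottom side of $T_2$, the transitive closure of $\prec$ is a strict partial order. Diagrams are considered up to homeomorphisms preserving labels and all left-right and top-bottom orientations of transistors and frame. $\mathrm{top}(\Delta)$ and $\mathrm{bot}(\Delta)$ are the words read along the top and bottom sides of the frame; a $(u,v)$-diagram has $\mathrm{top}(\Delta)=u$, $\mathrm{bot}(\Delta)=v$. If $\mathrm{bot}(\Delta_1)=\mathrm{top}(\Delta_2)$, the concatenation $\Delta_1\circ\Delta_2$ is obtained by gluing $\Delta_2$ below $\Delta_1$ (matching wires in left-to-right order). A dipole is a pair of transistors $T_1\prec T_2$ such that all wires $w_1,\dots,w_n$ attached to the top side of $T_1$ are attached to the bottom side of $T_2$ in the same left-to-right order, no other wire is attached to the bottom side of $T_2$, and $\mathrm{top}(T_2)=\mathrm{bot}(T_1)$. Reducing it means deleting $T_1,T_2,w_1,\dots,w_n$ and joining, in order, the wires on the top side of $T_2$ with those on the bottom side of $T_1$.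 Two diagrams are equal modulo dipoles if they have the same (unique) dipole-free reduction. $D_b(\mathcal{P},w)$ is the group of braided $(w,w)$-diagrams modulo dipoles, under concatenation. *)

theory Defs
  imports
    "HOL-Analysis.Analysis"
    "HOL-Algebra.Bij"
begin

section \<open>The Brin--Thompson groups\<close>

text \<open>
  The Cantor set is the type \<^typ>\<open>nat \<Rightarrow> bool\<close>; its \<open>n\<close>-th power consists of the functions on
  \<open>{..<n}\<close> that are \<^const>\<open>undefined\<close> outside \<open>{..<n}\<close>.
\<close>

definition cantor_topology :: "(nat \<Rightarrow> bool) topology" where
  "cantor_topology = product_topology (\<lambda>_. discrete_topology UNIV) UNIV"

definition cantor_power :: "nat \<Rightarrow> (nat \<Rightarrow> nat \<Rightarrow> bool) topology" where
  "cantor_power n = product_topology (\<lambda>_. cantor_topology) {..<n}"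

definition prepend :: "bool list \<Rightarrow> (nat \<Rightarrow> bool) \<Rightarrow> nat \<Rightarrow> bool" where
  "prepend u x = (\<lambda>k. if k < length u then u ! k else x (k - length u))"

definition brick_map :: "nat \<Rightarrow> (nat \<Rightarrow> bool list) \<Rightarrow> (nat \<Rightarrow> nat \<Rightarrow> bool) \<Rightarrow> nat \<Rightarrow> nat \<Rightarrow> bool" where
  "brick_map n u x = (\<lambda>i\<in>{..<n}. prepend (u i) (x i))"

definition dyadic_brick :: "nat \<Rightarrow> (nat \<Rightarrow> bool list) \<Rightarrow> (nat \<Rightarrow> nat \<Rightarrow> bool) set" where
  "dyadic_brick n u = (\<Pi>\<^sub>E i\<in>{..<n}. range (prepend (u i)))"

definition brick_partition :: "nat \<Rightarrow> (nat \<Rightarrow> nat \<Rightarrow> bool) set set \<Rightarrow> bool" where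
  "brick_partition n P \<longleftrightarrow>
     finite P \<and> P \<subseteq> range (dyadic_brick n) \<and> partition_on (topspace (cantor_power n)) P"

text \<open>
  \<^const>\<open>BijGroup\<close> is the group of bijections of a set, represented by functions that are
  \<^const>\<open>undefined\<close> outside the set, under composition.
\<close>

definition brin_thompson :: "nat \<Rightarrow> ((nat \<Rightarrow> nat \<Rightarrow> bool) \<Rightarrow> (nat \<Rightarrow> nat \<Rightarrow> bool)) monoid" where
  "brin_thompson n = (BijGroup (topspace (cantor_power n)))
     \<lparr>carrier := {f \<in> Bij (topspace (cantor_power n)).
        homeomorphic_map (cantor_power n) (cantor_power n) f \<and>
        (\<exists>P Q. brick_partition n P \<and> brick_partition n Q \<and> card P = card Q \<and>
           (\<forall>B\<in>P. \<exists>u v. B = dyadic_brick n u \<and> dyadic_brick n v \<in> Q \<and>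
              (\<forall>x\<in>topspace (cantor_power n). f (brick_map n u x) = brick_map n v x)))}\<rparr>"


section \<open>Semigroup presentations\<close>

definition semigroup_presentation :: "'a set \<Rightarrow> ('a list \<times> 'a list) set \<Rightarrow> bool" where
  "semigroup_presentation S R \<longleftrightarrow>
     (\<forall>(u, v)\<in>R. u \<in> lists S \<and> u \<noteq> [] \<and> v \<in> lists S \<and> v \<noteq> [] \<and> (v, u) \<notin> R)"


section \<open>Braided diagrams\<close>

text \<open>
  The quotient space is recorded by its incidence data: for each side of each transistor and of
  the frame, the list of the wires attached to it, read from left to right. As there are only
  finitely many wires and transistors, both are named by natural numbers. Values of the functions
  \<open>label\<close>, \<open>upper\<close> and \<open>lower\<close> outside the sets \<open>wires\<close> and \<open>transistors\<close> are irrelevant.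
\<close>

record 'a diagram =
  wires :: "nat set"
  label :: "nat \<Rightarrow> 'a"
  transistors :: "nat set"
  upper :: "nat \<Rightarrow> nat list"  \<comment> \<open>top side of a transistor\<close>
  lower :: "nat \<Rightarrow> nat list"  \<comment> \<open>bottom side of a transistor\<close>
  frame_top :: "nat list"
  frame_bot :: "nat list"

text \<open>
  Bottoms of wires are attached to the top sides of transistors and to the bottom side of the
  frame, tops of wires to the bottom sides of transistors and to the top side of the frame. Here
  \<^term>\<open>None\<close> stands for the frame, and a slot is a pair of a side and a position on it.
\<close>

fun bottom_end_side :: "'a diagram \<Rightarrow> nat option \<Rightarrow> nat list" where
  "bottom_end_side D None = frame_bot D"
| "bottom_end_side D (Some t) = upper D t"

fun top_end_side :: "'a diagram \<Rightarrow> nat option \<Rightarrow> nat list" where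
  "top_end_side D None = frame_top D"
| "top_end_side D (Some t) = lower D t"

definition slots :: "'a diagram \<Rightarrow> (nat option \<Rightarrow> nat list) \<Rightarrow> (nat option \<times> nat) set" where
  "slots D side = (SIGMA s : insert None (Some ` transistors D). {..<length (side s)})"

definition precedes :: "'a diagram \<Rightarrow> (nat \<times> nat) set" where
  "precedes D = {(t1, t2). t1 \<in> transistors D \<and> t2 \<in> transistors D \<and>
     (\<exists>w\<in>wires D. w \<in> set (upper D t1) \<and> w \<in> set (lower D t2))}"

text \<open>
  The two bijections say that each end of each wire is attached at exactly one slot and that
  distinct wires use distinct slots. Acyclicity says that the transitive closure of
  \<^const>\<open>precedes\<close>, which is transitive anyway, is irreflexive, i.e. a strict partial order.
\<close>

definition braided_diagram :: "'a set \<Rightarrow> ('a list \<times> 'a list) set \<Rightarrow> 'a diagram \<Rightarrow> bool" where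
  "braided_diagram S R D \<longleftrightarrow>
     finite (wires D) \<and> wires D \<noteq> {} \<and> label D ` wires D \<subseteq> S \<and>
     finite (transistors D) \<and>
     bij_betw (\<lambda>(s, i). bottom_end_side D s ! i) (slots D (bottom_end_side D)) (wires D) \<and>
     bij_betw (\<lambda>(s, i). top_end_side D s ! i) (slots D (top_end_side D)) (wires D) \<and>
     (\<forall>t\<in>transistors D.
        (map (label D) (upper D t), map (label D) (lower D t)) \<in> R \<or>
        (map (label D) (lower D t), map (label D) (upper D t)) \<in> R) \<and>
     acyclic (precedes D)"

definition top_word :: "'a diagram \<Rightarrow> 'a list" where
  "top_word D = map (label D) (frame_top D)"

definition bot_word :: "'a diagram \<Rightarrow> 'a list" where
  "bot_word D = map (label D) (frame_bot D)"

definition diagrams_from_to ::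
  "'a set \<Rightarrow> ('a list \<times> 'a list) set \<Rightarrow> 'a list \<Rightarrow> 'a list \<Rightarrow> 'a diagram set" where
  "diagrams_from_to S R u v = {D. braided_diagram S R D \<and> top_word D = u \<and> bot_word D = v}"

text \<open>
  On the incidence data, a homeomorphism preserving labels and orientations amounts to a pair of
  bijections between wires and between transistors that is compatible with all sides.
\<close>

definition diagram_iso :: "'a diagram \<Rightarrow> 'a diagram \<Rightarrow> bool" where
  "diagram_iso D E \<longleftrightarrow>
     (\<exists>f g. bij_betw f (wires D) (wires E) \<and> bij_betw g (transistors D) (transistors E) \<and>
        (\<forall>w\<in>wires D. label E (f w) = label D w) \<and>
        (\<forall>t\<in>transistors D. upper E (g t) = map f (upper D t) \<and> lower E (g t) = map f (lower D t)) \<and>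
        frame_top E = map f (frame_top D) \<and> frame_bot E = map f (frame_bot D))"

definition trivial_diagram :: "'a list \<Rightarrow> 'a diagram" where
  "trivial_diagram w = \<lparr>wires = {..<length w}, label = (!) w, transistors = {},
     upper = (\<lambda>_. []), lower = (\<lambda>_. []), frame_top = [0..<length w], frame_bot = [0..<length w]\<rparr>"

definition rename_wire :: "(nat \<times> nat) list \<Rightarrow> (nat \<Rightarrow> nat) \<Rightarrow> nat \<Rightarrow> nat" where
  "rename_wire ps d w = (case map_of ps w of Some w' \<Rightarrow> w' | None \<Rightarrow> d w)"

text \<open>
  In the concatenation, the wires and transistors of the upper diagram \<open>D\<close> get even names and
  those of the lower diagram \<open>E\<close> odd names, except that a wire on the top side of the frame of \<open>E\<close>
  gets the name of the wire of \<open>D\<close> to which it is glued.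
\<close>

definition concatenation :: "'a diagram \<Rightarrow> 'a diagram \<Rightarrow> 'a diagram" where
  "concatenation D E =
     (let l = (\<lambda>w. 2 * w);
          r = rename_wire (zip (frame_top E) (map l (frame_bot D))) (\<lambda>w. 2 * w + 1)
      in \<lparr>wires = l ` wires D \<union> r ` wires E,
          label = (\<lambda>w. if even w then label D (w div 2) else label E (w div 2)),
          transistors = (\<lambda>t. 2 * t) ` transistors D \<union> (\<lambda>t. 2 * t + 1) ` transistors E,
          upper = (\<lambda>t. if even t then map l (upper D (t div 2)) else map r (upper E (t div 2))),
          lower = (\<lambda>t. if even t then map l (lower D (t div 2)) else map r (lower E (t div 2))),
          frame_top = map l (frame_top D),
          frame_bot = map r (frame_bot E)\<rparr>)"

definition dipole :: "'a diagram \<Rightarrow> nat \<Rightarrow> nat \<Rightarrow> bool" where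
  "dipole D t1 t2 \<longleftrightarrow> (t1, t2) \<in> precedes D \<and> upper D t1 = lower D t2 \<and>
     map (label D) (upper D t2) = map (label D) (lower D t1)"

text \<open>
  The wire obtained by joining a wire \<open>a\<close> on the top side of \<open>t2\<close> with a wire \<open>b\<close> on the bottom side
  of \<open>t1\<close> keeps the name \<open>a\<close> and the upper end of \<open>a\<close>; its bottom is where the bottom of \<open>b\<close> was.
\<close>

definition reduce_dipole :: "'a diagram \<Rightarrow> nat \<Rightarrow> nat \<Rightarrow> 'a diagram" where
  "reduce_dipole D t1 t2 =
     (let r = rename_wire (zip (lower D t1) (upper D t2)) (\<lambda>w. w)
      in D\<lparr>wires := wires D - set (upper D t1) - set (lower D t1),
           transistors := transistors D - {t1, t2},
           upper := (\<lambda>t. map r (upper D t)),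
           frame_bot := map r (frame_bot D)\<rparr>)"

definition dipole_reduction :: "'a diagram \<Rightarrow> 'a diagram \<Rightarrow> bool" where
  "dipole_reduction D E \<longleftrightarrow> (\<exists>t1 t2. dipole D t1 t2 \<and> E = reduce_dipole D t1 t2)"

definition dipole_free :: "'a diagram \<Rightarrow> bool" where
  "dipole_free D \<longleftrightarrow> (\<nexists>t1 t2. dipole D t1 t2)"

definition equal_mod_dipoles :: "'a diagram \<Rightarrow> 'a diagram \<Rightarrow> bool" where
  "equal_mod_dipoles D E \<longleftrightarrow>
     (\<exists>D' E'. dipole_reduction\<^sup>*\<^sup>* D D' \<and> dipole_free D' \<and>
              dipole_reduction\<^sup>*\<^sup>* E E' \<and> dipole_free E' \<and> diagram_iso D' E')"

definition dipole_class ::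
  "'a set \<Rightarrow> ('a list \<times> 'a list) set \<Rightarrow> 'a list \<Rightarrow> 'a diagram \<Rightarrow> 'a diagram set" where
  "dipole_class S R w D = {E \<in> diagrams_from_to S R w w. equal_mod_dipoles D E}"

text \<open>
  The product of two classes is the class of the concatenation of any two representatives; the
  union below is over equal sets.
\<close>

definition braided_diagram_group ::
  "'a set \<Rightarrow> ('a list \<times> 'a list) set \<Rightarrow> 'a list \<Rightarrow> 'a diagram set monoid" where
  "braided_diagram_group S R w =
     \<lparr>carrier = dipole_class S R w ` diagrams_from_to S R w w,
      mult = (\<lambda>X Y. \<Union>D\<in>X. \<Union>E\<in>Y. dipole_class S R w (concatenation D E)),
      one = dipole_class S R w (trivial_diagram w)\<rparr>"

end

theory Submission
  imports Defs
begin

text \<open>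
  Braided diagrams act on the free algebra whose operations are mutually inverse gates, one pair
  for each relation: the wires of a diagram carry terms, and a transistor applies a gate.
  Dipole reduction is exactly cancellation of gates, so \<open>D\<^sub>b(P, w)\<close> embeds into the automorphism
  group of this algebra. An instance of a gate (a cell) is either outward or inward with respect to
  the variables, and every automorphism changes the direction of only finitely many cells. If
  some orbit of an automorphism runs from inward to outward cells, then so does some orbit of each
  of its roots, and a root of order \<open>N\<close> forces at least \<open>N\<close> cells to change direction. Hence an
  automorphism with roots of arbitrarily large order has no such orbit; it then preserves, up to
  passing to a power, a finite generating set and has finite order.

  On the other hand, let \<open>z\<close> be an element of infinite order of Thompson's group \<open>V\<close> acting
  on the second coordinate. Then \<open>(0x, y) \<mapsto> (1x, y)\<close>, \<open>(1x, y) \<mapsto> (0x, z y)\<close> is a square root of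
  \<open>z\<close> in \<open>nV\<close>, and iterating this construction yields roots of order \<open>2\<^sup>k\<close> for all \<open>k\<close>.
\<close>

section \<open>Commensurated sets\<close>

text \<open>An automorphism need not send variables to variables, so its order cannot be read off
  from them. What it almost preserves is the choice of the outward member in each pair of mutually
  inverse cells. If every free orbit has the same direction at both ends, this choice can be
  replaced by an invariant one: a power makes the direction constant along periodic orbits, and
  limits along that power give \<open>M'\<close>. As \<open>M'\<close> differs from the outward
  cells in finitely many places, only finitely many terms are outputs of no cell of
  \<open>M'\<close>. They generate everything because the passage from inputs to outputs along
  \<open>M'\<close> is well-founded: a high power carries any finite chain of cells of
  \<open>M'\<close> into the outward cells, where outputs are larger than inputs. A power of the
  automorphism fixes these generators, hence all terms.

  The roots can be iterated for a reason hidden in the first step. The square of the root built from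
  \<open>f\<close> is not \<open>f\<close> itself but \<open>f\<close> acting behind the first
  letter of coordinate 0. This operation is a homomorphism in \<open>f\<close>, and it fixes
  \<open>z\<close> because \<open>z\<close> does not touch coordinate 0. Hence two
  coordinates.\<close>

locale int_action =
  fixes X :: "'x set" and act :: "int \<Rightarrow> 'x \<Rightarrow> 'x"
  assumes act_closed: "x \<in> X \<Longrightarrow> act k x \<in> X"
    and act_zero: "x \<in> X \<Longrightarrow> act 0 x = x"
    and act_add: "x \<in> X \<Longrightarrow> act (j + k) x = act j (act k x)"
begin

text \<open>Up to restriction to \<open>X\<close>, the symmetric difference of \<open>M\<close> and
  its preimage under the generator: it is finite exactly when the cyclic group commensurates
  \<open>M\<close>.\<close>

definition switch :: "'x set \<Rightarrow> 'x set" where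
  "switch M = {x \<in> X. (x \<in> M) \<noteq> (act 1 x \<in> M)}"

definition aperiodic :: "'x \<Rightarrow> bool" where
  "aperiodic x \<longleftrightarrow> (\<forall>k. act k x = x \<longrightarrow> k = 0)"

lemma act_inverse: "x \<in> X \<Longrightarrow> act (- k) (act k x) = x"
  using act_add[of x "- k" k] act_zero by simp

lemma act_commute: "x \<in> X \<Longrightarrow> act j (act k x) = act k (act j x)"
  using act_add[of x j k] act_add[of x k j] by (simp add: add.commute)

lemma act_multiple:
  assumes "x \<in> X" "act j x = x"
  shows "act (j * k) x = x"
proof (induction k rule: int_induct[where k = 0])
  case base
  then show ?case using assms act_zero by simp
next
  case (step1 i)
  have "act (j * (i + 1)) x = act j (act (j * i) x)"
    using act_add[OF assms(1), of j "j * i"] by (simp add: algebra_simps)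
  then show ?case using step1 assms by simp
next
  case (step2 i)
  have "act j (act (j * (i - 1)) x) = act (j * i) x"
    using act_add[OF assms(1), of j "j * (i - 1)"] by (simp add: algebra_simps)
  then have "act j (act (j * (i - 1)) x) = act j x" using step2 assms by simp
  then show ?case
    by (metis act_inverse act_closed assms(1))
qed

lemma aperiodic_inj:
  assumes "x \<in> X" "aperiodic x"
  shows "inj (\<lambda>k. act k x)"
proof (rule injI)
  fix j k assume "act j x = act k x"
  then have "act (- k) (act j x) = x" using act_inverse assms by simp
  then have "act (- k + j) x = x" using act_add[OF assms(1), of "- k" j] by simp
  then show "j = k" using assms unfolding aperiodic_def by force
qed

lemma constant_between:
  assumes "x \<in> X" "i \<le> j" and no: "\<And>k. i \<le> k \<Longrightarrow> k < j \<Longrightarrow> act k x \<notin> switch M"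
  shows "act i x \<in> M \<longleftrightarrow> act j x \<in> M"
  using assms(2) no
proof (induction j rule: int_ge_induct)
  case (step j)
  have "act 1 (act j x) = act (j + 1) x"
    using act_add[OF assms(1), of 1 j] by (simp add: add.commute)
  moreover have "act j x \<notin> switch M" using step by simp
  ultimately show ?case
    using step assms(1) act_closed unfolding switch_def by auto
qed simp

text \<open>Times along a free orbit correspond to distinct points, so the orbit visits the finite
  set \<open>switch M\<close> at finitely many times; beyond them membership in \<open>M\<close>
  cannot change.\<close>

lemma ends_exist:
  assumes "x \<in> X" "aperiodic x" "finite (switch M)"
  obtains K where "K \<ge> 0"
    "\<And>k. k \<ge> K \<Longrightarrow> act k x \<in> M \<longleftrightarrow> act K x \<in> M"
    "\<And>k. k \<ge> K \<Longrightarrow> act (- k) x \<in> M \<longleftrightarrow> act (- K) x \<in> M"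
    "\<And>k. k \<ge> K \<Longrightarrow> act k x \<notin> switch M"
proof -
  have fin: "finite {k. act k x \<in> switch M}"
    using finite_vimageI[OF assms(3) aperiodic_inj[OF assms(1,2)]] by (simp add: vimage_def)
  \<comment> \<open>The \<open>0\<close> covers an orbit that avoids \<open>switch M\<close>; the
    \<open>+ 1\<close> puts every visit strictly between \<open>- K\<close> and
    \<open>K\<close>.\<close>
  define K where "K = Max (insert 0 (abs ` {k. act k x \<in> switch M})) + 1"
  have K0: "K \<ge> 0" using Max_ge[of "insert 0 (abs ` {k. act k x \<in> switch M})" 0] fin unfolding K_def by auto
  have bound: "\<bar>k\<bar> < K" if "act k x \<in> switch M" for k
  proof -
    have "\<bar>k\<bar> \<le> Max (insert 0 (abs ` {k. act k x \<in> switch M}))"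
      by (rule Max_ge) (use fin that in auto)
    then show ?thesis unfolding K_def by simp
  qed
  show thesis
  proof
    show "K \<ge> 0" by fact
    fix k assume "k \<ge> K"
    show "act k x \<in> M \<longleftrightarrow> act K x \<in> M"
      using constant_between[OF assms(1) \<open>k \<ge> K\<close>, of M] bound by force
    show "act (- k) x \<in> M \<longleftrightarrow> act (- K) x \<in> M"
      using constant_between[OF assms(1), of "- k" "- K" M] bound \<open>k \<ge> K\<close> by force
    show "act k x \<notin> switch M"
      using bound \<open>k \<ge> K\<close> by force
  qed
qed

text \<open>
  An orbit of an \<open>N\<close>-th root that enters \<open>M\<close> splits into \<open>N\<close> orbits of the action, each of which
  contributes to \<^term>\<open>switch M\<close>.
\<close>

lemma balanced_if_root:
  assumes fin: "finite (switch M)"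
    and root: "int_action X act'" "finite (int_action.switch X act' M)"
      "\<And>x k. x \<in> X \<Longrightarrow> act' (int N * k) x = act k x"
    and large: "N > card (switch M)"
    and x: "x \<in> X" "aperiodic x"
  shows "\<exists>K. \<forall>k\<ge>K. act k x \<in> M \<longleftrightarrow> act (- k) x \<in> M"
proof -
  interpret root: int_action X act' by fact
  have N: "int N \<ge> 1" using large by simp
  have "root.aperiodic x"
    unfolding root.aperiodic_def
  proof (intro allI impI)
    fix k assume "act' k x = x"
    then have "act' (k * int N) x = x" using root.act_multiple x by blast
    then have "act k x = x" using root(3)[OF x(1), of k] by (simp add: mult.commute)
    then show "k = 0" using x unfolding aperiodic_def by blast
  qed
  then have inj: "inj (\<lambda>k. act' k x)" using root.aperiodic_inj x by blast
  obtain K where K: "K \<ge> 0" "\<And>k. k \<ge> K \<Longrightarrow> act' k x \<in> M \<longleftrightarrow> act' K x \<in> M"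
    "\<And>k. k \<ge> K \<Longrightarrow> act' (- k) x \<in> M \<longleftrightarrow> act' (- K) x \<in> M"
    using root.ends_exist[OF x(1) \<open>root.aperiodic x\<close> root(2)] by metis
  have "act' K x \<in> M \<longleftrightarrow> act' (- K) x \<in> M"
  proof (rule ccontr)
    assume ne: "\<not> ?thesis"
    have "\<exists>k. act' (int N * k + int i) x \<in> switch M" if "i < N" for i
    proof (rule ccontr)
      assume no: "\<not> ?thesis"
      have eq: "act k (act' (int i) x) = act' (int N * k + int i) x" for k
        using root(3)[of "act' (int i) x" k] root.act_add[OF x(1), of "int N * k" "int i"]
          root.act_closed x by simp
      \<comment> \<open>Large enough that both \<open>N * k + i\<close> and \<open>N * k - i\<close>
        are at least \<open>K\<close> for every \<open>i < N\<close>.\<close>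
      define k where "k = K + int N"
      have k: "int N * k \<ge> k" using N K(1) unfolding k_def by (simp add: mult_le_cancel_right1)
      have "act (- k) (act' (int i) x) \<in> M \<longleftrightarrow> act k (act' (int i) x) \<in> M"
        by (rule constant_between) (use no eq root.act_closed x K(1) k_def in auto)
      moreover have "act k (act' (int i) x) \<in> M \<longleftrightarrow> act' K x \<in> M"
        using K(2)[of "int N * k + int i"] eq k unfolding k_def by simp
      moreover have "act (- k) (act' (int i) x) \<in> M \<longleftrightarrow> act' (- K) x \<in> M"
        using K(3)[of "int N * k - int i"] eq[of "- k"] k that unfolding k_def by (simp add: algebra_simps)
      ultimately show False using ne by blast
    qed
    then obtain \<kappa> where \<kappa>: "\<And>i. i < N \<Longrightarrow> act' (int N * \<kappa> i + int i) x \<in> switch M" by metis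
    have "inj_on (\<lambda>i. act' (int N * \<kappa> i + int i) x) {..<N}"
    proof (rule inj_onI)
      fix i j assume ij: "i \<in> {..<N}" "j \<in> {..<N}"
        and "act' (int N * \<kappa> i + int i) x = act' (int N * \<kappa> j + int j) x"
      then have "int N * \<kappa> i + int i = int N * \<kappa> j + int j" using inj by (metis injD)
      then have "(int N * \<kappa> i + int i) mod int N = (int N * \<kappa> j + int j) mod int N" by simp
      then show "i = j" using ij by simp
    qed
    moreover have "(\<lambda>i. act' (int N * \<kappa> i + int i) x) ` {..<N} \<subseteq> switch M" using \<kappa> by auto
    ultimately have "N \<le> card (switch M)" using card_inj_on_le[OF _ _ fin] by fastforce
    then show False using large by simp
  qed
  moreover have "int N * k \<ge> K" if "k \<ge> K" for k
    using that K(1) N by (meson mult_le_cancel_right1 order_trans linorder_not_le)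
  ultimately have "act k x \<in> M \<longleftrightarrow> act (- k) x \<in> M" if "k \<ge> K" for k
    using that K(2)[of "int N * k"] K(3)[of "int N * k"] root(3)[OF x(1), of k] root(3)[OF x(1), of "- k"]
    by simp
  then show ?thesis by blast
qed

text \<open>Only finitely many periodic points lie in \<open>switch M\<close>, so a common multiple
  of their periods fixes them and their orbits pointwise. A periodic orbit that misses
  \<open>switch M\<close> lies entirely inside or entirely outside \<open>M\<close>.\<close>

lemma periodic_constant:
  assumes "finite (switch M)"
  obtains m where "m > 0"
    "\<And>x k. x \<in> X \<Longrightarrow> \<not> aperiodic x \<Longrightarrow> act (m * k) x \<in> M \<longleftrightarrow> x \<in> M"
proof -
  let ?P = "{x \<in> switch M. \<not> aperiodic x}"
  have "\<exists>k>0. act k x = x" if x: "x \<in> X" "\<not> aperiodic x" for x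
  proof -
    obtain k where k: "act k x = x" "k \<noteq> 0" using x unfolding aperiodic_def by blast
    then have "act (- k) x = x" using act_inverse[OF x(1), of k] by simp
    then show ?thesis using k by (metis neg_0_less_iff_less linorder_neqE)
  qed
  then obtain per where per: "\<And>x. x \<in> X \<Longrightarrow> \<not> aperiodic x \<Longrightarrow> per x > 0 \<and> act (per x) x = x" by metis
  have finP: "finite ?P" using assms by simp
  define m where "m = (\<Prod>x\<in>?P. per x)"
  have "?P \<subseteq> X" unfolding switch_def by auto
  have m: "act m x = x" if "x \<in> ?P" for x
  proof -
    have "per x dvd m" unfolding m_def using finP that by (rule dvd_prodI)
    then obtain j where "m = per x * j" by (elim dvdE)
    then show ?thesis using act_multiple per that \<open>?P \<subseteq> X\<close> by blast
  qed
  show thesis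
  proof
    show "m > 0" unfolding m_def by (rule prod_pos) (use per \<open>?P \<subseteq> X\<close> in blast)
    fix x k assume x: "x \<in> X" "\<not> aperiodic x"
    show "act (m * k) x \<in> M \<longleftrightarrow> x \<in> M"
    proof (cases "\<exists>j. act j x \<in> switch M")
      case True
      then obtain j where j: "act j x \<in> switch M" by blast
      obtain i where i: "i \<noteq> 0" "act i x = x" using x unfolding aperiodic_def by blast
      then have "act i (act j x) = act j x" using act_commute x by metis
      then have "act j x \<in> ?P" using j i unfolding aperiodic_def by blast
      then have "act m (act j x) = act j x" using m by blast
      then have "act j (act m x) = act j x" using act_commute x by metis
      then have "act m x = x" using act_inverse act_closed x by metis
      then show ?thesis using act_multiple x by simp
    next
      case False
      then show ?thesis
        using constant_between[OF x(1), of 0 "m * k" M] constant_between[OF x(1), of "m * k" 0 M]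
          act_zero x by (cases "m * k \<ge> 0") auto
    qed
  qed
qed

text \<open>\<open>M'\<close> is the limit of the preimages of \<open>M\<close> under the powers of
  \<open>act m\<close>. A point at which \<open>M\<close> and \<open>M'\<close> differ is aperiodic
  and, by \<open>bal\<close>, differs from both ends of its orbit. It therefore lies between two
  switches, and free orbits contain only finitely many such points.\<close>

lemma invariant_limit:
  assumes fin: "finite (switch M)"
    and bal: "\<And>x. x \<in> X \<Longrightarrow> aperiodic x \<Longrightarrow> \<exists>K. \<forall>k\<ge>K. act k x \<in> M \<longleftrightarrow> act (- k) x \<in> M"
  obtains m M' where "m > 0"
    "\<And>x. x \<in> X \<Longrightarrow> \<exists>K. \<forall>k\<ge>K. act (m * k) x \<in> M \<longleftrightarrow> x \<in> M'"
    "finite {x \<in> X. (x \<in> M) \<noteq> (x \<in> M')}"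
proof -
  obtain m where m: "m > 0"
    and per: "\<And>x k. x \<in> X \<Longrightarrow> \<not> aperiodic x \<Longrightarrow> act (m * k) x \<in> M \<longleftrightarrow> x \<in> M"
    using periodic_constant[OF fin] by blast
  define M' where "M' = {x. \<exists>K. \<forall>k\<ge>K. act (m * k) x \<in> M}"
  have lim: "\<exists>K. \<forall>k\<ge>K. act (m * k) x \<in> M \<longleftrightarrow> x \<in> M'" if x: "x \<in> X" for x
  proof (cases "aperiodic x")
    case False
    then have "x \<in> M' \<longleftrightarrow> x \<in> M" unfolding M'_def using per[OF x False] by auto
    then show ?thesis using per[OF x False] by blast
  next
    case True
    obtain K where K: "K \<ge> 0" "\<And>k. k \<ge> K \<Longrightarrow> act k x \<in> M \<longleftrightarrow> act K x \<in> M"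
      using ends_exist[OF x True fin] by metis
    have "m * k \<ge> K" if "k \<ge> K" for k
      using that K(1) m by (metis mult_le_cancel_right1 order_trans linorder_not_le zless_imp_add1_zle add_0)
    then have *: "\<forall>k\<ge>K. act (m * k) x \<in> M \<longleftrightarrow> act K x \<in> M" using K by blast
    then have "x \<in> M' \<longleftrightarrow> act K x \<in> M" 
      unfolding M'_def mem_Collect_eq by (metis max.cobounded1 max.cobounded2)
    then show ?thesis using * by blast
  qed
  let ?A = "{x \<in> switch M. aperiodic x}"
  \<comment> \<open>From time \<open>\<kappa> d\<close> on, the orbit of the switch \<open>d\<close>
    meets no further switch; this bounds the gap between two switches on a free orbit.\<close>
  obtain \<kappa> where \<kappa>: "\<And>x k. x \<in> ?A \<Longrightarrow> k \<ge> \<kappa> x \<Longrightarrow> act k x \<notin> switch M"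
  proof -
    have "\<exists>K. \<forall>k\<ge>K. act k x \<notin> switch M" if "x \<in> ?A" for x
    proof -
      have "x \<in> X" "aperiodic x" using that unfolding switch_def by auto
      then show ?thesis using ends_exist[OF _ _ fin] by metis
    qed
    then have "\<forall>x. \<exists>K. x \<in> ?A \<longrightarrow> (\<forall>k\<ge>K. act k x \<notin> switch M)" by blast
    then obtain f where "\<forall>x. x \<in> ?A \<longrightarrow> (\<forall>k\<ge>f x. act k x \<notin> switch M)"
      by (rule choice[THEN exE])
    then show thesis using that by blast
  qed
  have "{x \<in> X. (x \<in> M) \<noteq> (x \<in> M')} \<subseteq> (\<Union>d\<in>?A. (\<lambda>k. act k d) ` {0..\<kappa> d})"
  proof
    fix x assume "x \<in> {x \<in> X. (x \<in> M) \<noteq> (x \<in> M')}"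
    then have x: "x \<in> X" "(x \<in> M) \<noteq> (x \<in> M')" by auto
    obtain K where K: "\<And>k. k \<ge> K \<Longrightarrow> act (m * k) x \<in> M \<longleftrightarrow> x \<in> M'" using lim[OF x(1)] by blast
    have ap: "aperiodic x"
    proof (rule ccontr)
      assume "\<not> aperiodic x"
      then show False using per[OF x(1), of K] K[of K] x by simp
    qed
    obtain K' where K': "\<And>k. k \<ge> K' \<Longrightarrow> act k x \<in> M \<longleftrightarrow> act (- k) x \<in> M" using bal[OF x(1) ap] by blast
    define k where "k = max 0 (max K K')"
    have k: "m * k \<ge> k" "k \<ge> 0" "k \<ge> K" "k \<ge> K'" using m unfolding k_def by (auto simp: mult_le_cancel_right1)
    have out: "(act (m * k) x \<in> M) \<noteq> (x \<in> M)" using K x k by blast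
    then have out': "(act (- (m * k)) x \<in> M) \<noteq> (x \<in> M)" using K'[of "m * k"] k by simp
    obtain i where i: "0 \<le> i" "act i x \<in> switch M"
      using constant_between[OF x(1), of 0 "m * k" M] out k act_zero x by fastforce
    obtain j where j: "j < 0" "act j x \<in> switch M"
      using constant_between[OF x(1), of "- (m * k)" 0 M] out' k act_zero x by fastforce
    \<comment> \<open>\<open>d\<close> is a switch before \<open>x\<close>, and
      \<open>act i x\<close> is one at or after \<open>x\<close>; so \<open>x\<close> is reached
      from \<open>d\<close> in at most \<open>\<kappa> d\<close> steps.\<close>
    define d where "d = act j x"
    have xd: "act (- j) d = x" unfolding d_def using act_inverse x by simp
    have "aperiodic d"
      unfolding aperiodic_def
    proof (intro allI impI)
      fix l assume "act l d = d"
      then have "act l x = x" using xd act_commute[of d l "- j"] x(1) act_closed d_def by metis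
      then show "l = 0" using ap unfolding aperiodic_def by blast
    qed
    then have d: "d \<in> ?A" using j unfolding d_def by simp
    have "act (i - j) d \<in> switch M"
      using i(2) xd act_add[of d i "- j"] act_closed[OF x(1)] d_def by simp
    then have "i - j < \<kappa> d" using \<kappa>[OF d] by (meson linorder_not_le)
    then have "- j \<in> {0..\<kappa> d}" using i j by simp
    then show "x \<in> (\<Union>d\<in>?A. (\<lambda>k. act k d) ` {0..\<kappa> d})"
      using d xd by (intro UN_I[of d]) (auto intro!: image_eqI[of _ _ "- j"])
  qed
  moreover have "finite (\<Union>d\<in>?A. (\<lambda>k. act k d) ` {0..\<kappa> d})" using fin by auto
  ultimately have "finite {x \<in> X. (x \<in> M) \<noteq> (x \<in> M')}" by (rule finite_subset)
  then show thesis using that m lim by blast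
qed

end

section \<open>The free algebra of reversible gates\<close>

text \<open>\<open>Out q j us\<close> stands for output number \<open>j\<close> of the gate
  \<open>q\<close> applied to the tuple \<open>us\<close>; the outputs of one gate are separate
  terms that share \<open>us\<close>.\<close>

datatype 'q tm = Var nat | Out 'q nat "'q tm list"

text \<open>\<open>conv q\<close> is the inverse gate, so \<open>q\<close> has \<open>ar q\<close>
  inputs and \<open>ar (conv q)\<close> outputs; \<open>m\<close> is the number of free generators.
  Positive arity means that every gate has an output, from which its inputs can be
  recovered.\<close>

locale gates =
  fixes Q :: "'q set" and conv :: "'q \<Rightarrow> 'q" and ar :: "'q \<Rightarrow> nat" and m :: nat
  assumes conv_closed: "q \<in> Q \<Longrightarrow> conv q \<in> Q"
    and conv_conv: "q \<in> Q \<Longrightarrow> conv (conv q) = q"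
    and ar_pos: "q \<in> Q \<Longrightarrow> 0 < ar q"
begin

definition outs :: "'q \<Rightarrow> 'q tm list \<Rightarrow> 'q tm list" where
  "outs q us = map (\<lambda>j. Out q j us) [0..<ar (conv q)]"

text \<open>Normal forms for the equations that make \<open>q\<close> and \<open>conv q\<close>
  mutually inverse. Excluded are exactly the complete output tuples of \<open>conv q\<close> in
  their proper order, since \<open>q\<close> cancels on them; a permuted or mixed tuple does not
  cancel.\<close>

inductive_set reduced :: "'q tm set" where
  Var: "i < m \<Longrightarrow> Var i \<in> reduced"
| Out: "q \<in> Q \<Longrightarrow> j < ar (conv q) \<Longrightarrow> length us = ar q \<Longrightarrow> \<forall>u\<in>set us. u \<in> reduced \<Longrightarrow>
    \<forall>vs. us \<noteq> outs (conv q) vs \<Longrightarrow> Out q j us \<in> reduced"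

definition tuples :: "'q \<Rightarrow> 'q tm list set" where
  "tuples q = {us. length us = ar q \<and> set us \<subseteq> reduced}"

definition gate :: "'q \<Rightarrow> 'q tm list \<Rightarrow> 'q tm list" where
  "gate q us = (if \<exists>vs. us = outs (conv q) vs then SOME vs. us = outs (conv q) vs else outs q us)"

definition cells :: "('q \<times> 'q tm list) set" where
  "cells = Sigma Q tuples"

text \<open>The cells on which the gate acts freely and produces terms larger than its inputs. On
  the remaining cells it cancels.\<close>

definition outward :: "('q \<times> 'q tm list) set" where
  "outward = {(q, us) \<in> cells. \<forall>vs. us \<noteq> outs (conv q) vs}"

text \<open>The same instance of a gate read backwards, with inputs and outputs exchanged.\<close>

definition flip :: "'q \<times> 'q tm list \<Rightarrow> 'q \<times> 'q tm list" where
  "flip = (\<lambda>(q, us). (conv q, gate q us))"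

lemma length_outs [simp]: "length (outs q us) = ar (conv q)"
  unfolding outs_def by simp

lemma nth_outs [simp]: "j < ar (conv q) \<Longrightarrow> outs q us ! j = Out q j us"
  unfolding outs_def by simp

lemma in_set_outs: "u \<in> set (outs q us) \<longleftrightarrow> (\<exists>j<ar (conv q). u = Out q j us)"
  unfolding outs_def by auto

lemma outs_inj: "q \<in> Q \<Longrightarrow> outs q us = outs q vs \<longleftrightarrow> us = vs"
  by (metis ar_pos conv_closed nth_outs tm.inject(2))

lemma Out_reduced_iff:
  "Out q j us \<in> reduced \<longleftrightarrow> (q, us) \<in> outward \<and> j < ar (conv q)"
  unfolding outward_def cells_def tuples_def
  by (subst reduced.simps) auto

lemma Var_reduced_iff: "Var i \<in> reduced \<longleftrightarrow> i < m"
  by (subst reduced.simps) auto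

lemma gate_outs [simp]: "q \<in> Q \<Longrightarrow> gate q (outs (conv q) vs) = vs"
  unfolding gate_def using outs_inj[OF conv_closed] by auto

lemma gate_outward: "(q, us) \<in> outward \<Longrightarrow> gate q us = outs q us"
  unfolding gate_def outward_def by auto

lemma outward_cells: "outward \<subseteq> cells"
  unfolding outward_def by auto

lemma inwardE:
  assumes "(q, us) \<in> cells" "(q, us) \<notin> outward"
  obtains "us = outs (conv q) (gate q us)" "(conv q, gate q us) \<in> outward"
proof -
  have q: "q \<in> Q" and us: "us \<in> tuples q" using assms unfolding cells_def by auto
  obtain vs where vs: "us = outs (conv q) vs" using assms unfolding outward_def by auto
  then have g: "gate q us = vs" using q by simp
  \<comment> \<open>Positive arity supplies an entry of \<open>us\<close>; that this entry is
    reduced says precisely that the inner cell is outward.\<close>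
  have "0 < ar (conv (conv q))" using ar_pos q conv_conv by simp
  then have "Out (conv q) 0 vs \<in> set us" unfolding vs in_set_outs by blast
  then have "Out (conv q) 0 vs \<in> reduced" using us unfolding tuples_def by auto
  then show thesis using that vs g Out_reduced_iff by auto
qed

lemma gate_tuples:
  assumes "(q, us) \<in> cells"
  shows "(conv q, gate q us) \<in> cells"
proof (cases "(q, us) \<in> outward")
  case True
  then show ?thesis
    using assms conv_closed Out_reduced_iff
    by (auto simp: gate_outward cells_def tuples_def in_set_outs)
next
  case False
  then show ?thesis using inwardE assms outward_cells by blast
qed

lemma outward_flip_iff:
  assumes "(q, us) \<in> cells"
  shows "(conv q, gate q us) \<in> outward \<longleftrightarrow> (q, us) \<notin> outward"
proof
  assume *: "(conv q, gate q us) \<in> outward"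
  show "(q, us) \<notin> outward"
  proof
    assume "(q, us) \<in> outward"
    then have "gate q us = outs (conv (conv q)) us"
      using assms conv_conv by (auto simp: gate_outward cells_def)
    then show False using * unfolding outward_def by auto
  qed
qed (use assms inwardE in blast)

lemma gate_gate:
  assumes "(q, us) \<in> cells"
  shows "gate (conv q) (gate q us) = us"
proof (cases "(q, us) \<in> outward")
  case True
  then have "gate q us = outs (conv (conv q)) us"
    using assms conv_conv by (auto simp: gate_outward cells_def)
  then show ?thesis using assms conv_closed by (auto simp: cells_def)
next
  case False
  then show ?thesis using inwardE[OF assms False] gate_outward by metis
qed

lemma gate_inj:
  "(q, us) \<in> cells \<Longrightarrow> (q, vs) \<in> cells \<Longrightarrow> gate q us = gate q vs \<Longrightarrow> us = vs"
  using gate_gate by metis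

lemma length_gate: "(q, us) \<in> cells \<Longrightarrow> length (gate q us) = ar (conv q)"
  using gate_tuples unfolding cells_def tuples_def by fastforce

lemma gate_reduced: "(q, us) \<in> cells \<Longrightarrow> set (gate q us) \<subseteq> reduced"
  using gate_tuples unfolding cells_def tuples_def by fastforce

lemma flip_inj: "inj_on flip cells"
proof (rule inj_onI, clarify)
  fix q us p vs
  assume c: "(q, us) \<in> cells" "(p, vs) \<in> cells" "flip (q, us) = flip (p, vs)"
  then have "q = p" unfolding flip_def cells_def by (metis (no_types, lifting) SigmaD1 case_prod_conv conv_conv prod.inject)
  then show "q = p \<and> us = vs" using c gate_inj unfolding flip_def by auto
qed


subsection \<open>Endomorphisms and automorphisms\<close>

definition endo :: "('q tm \<Rightarrow> 'q tm) \<Rightarrow> bool" where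
  "endo \<sigma> \<longleftrightarrow> \<sigma> ` reduced \<subseteq> reduced \<and>
     (\<forall>q us. (q, us) \<in> cells \<longrightarrow> map \<sigma> (gate q us) = gate q (map \<sigma> us))"

definition move :: "('q tm \<Rightarrow> 'q tm) \<Rightarrow> 'q \<times> 'q tm list \<Rightarrow> 'q \<times> 'q tm list" where
  "move \<sigma> = (\<lambda>(q, us). (q, map \<sigma> us))"

lemma endo_cells: "endo \<sigma> \<Longrightarrow> (q, us) \<in> cells \<Longrightarrow> (q, map \<sigma> us) \<in> cells"
  unfolding endo_def cells_def tuples_def by (auto simp: image_subset_iff subset_iff)

lemma endo_gate: "endo \<sigma> \<Longrightarrow> (q, us) \<in> cells \<Longrightarrow> map \<sigma> (gate q us) = gate q (map \<sigma> us)"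
  unfolding endo_def by blast

fun nodes :: "'q tm \<Rightarrow> ('q \<times> 'q tm list) set" where
  "nodes (Var i) = {}"
| "nodes (Out q j us) = insert (q, us) (\<Union>u\<in>set us. nodes u)"

lemma finite_nodes: "finite (nodes t)"
  by (induction t) auto

lemma nodes_trans: "(q, us) \<in> nodes t \<Longrightarrow> u \<in> set us \<Longrightarrow> nodes u \<subseteq> nodes t"
  by (induction t) auto

text \<open>
  A cell can only turn inward under \<open>\<sigma>\<close> if the inverse cell occurs inside the image of a variable:
  otherwise all entries of the cell already have the form that makes the gate cancel.
\<close>

lemma turning_cells:
  assumes \<sigma>: "endo \<sigma>" and inj: "inj_on \<sigma> reduced"
  shows "(q, us) \<in> outward \<Longrightarrow> (q, map \<sigma> us) \<notin> outward \<Longrightarrow>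
    flip (q, map \<sigma> us) \<in> (\<Union>i<m. nodes (\<sigma> (Var i)))"
proof (induction "size_list size us" arbitrary: q us rule: less_induct)
  case less
  let ?N = "\<Union>i<m. nodes (\<sigma> (Var i))"
  define vs where "vs = gate q (map \<sigma> us)"
  have c: "(q, us) \<in> cells" "(q, map \<sigma> us) \<in> cells"
    using less.prems outward_cells endo_cells[OF \<sigma>] by auto
  then have q: "q \<in> Q" and us: "us \<in> tuples q" unfolding cells_def by auto
  have vs: "map \<sigma> us = outs (conv q) vs"
    using inwardE[OF c(2)] less.prems vs_def by metis
  have len: "length us = ar q" using us unfolding tuples_def by simp
  show ?case
  proof (rule ccontr)
    assume "flip (q, map \<sigma> us) \<notin> ?N"
    then have notN: "(conv q, vs) \<notin> ?N" unfolding flip_def vs_def by simp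
    \<comment> \<open>If an entry were a variable, the inverse cell would occur in the image of that
      variable. If the cell inside an entry turned as well, then by induction its inverse would
      occur in such an image, and with it all nodes of its output terms, again including the inverse
      cell.\<close>
    have key: "\<exists>ts. us ! j = Out (conv q) j ts \<and> map \<sigma> ts = vs \<and> set ts \<subseteq> reduced"
      if j: "j < ar q" for j
    proof -
      have uj: "us ! j \<in> set us" using j len by simp
      then have red: "us ! j \<in> reduced" using us unfolding tuples_def by auto
      have im: "\<sigma> (us ! j) = Out (conv q) j vs"
        using vs j len conv_conv[OF q] by (metis nth_map nth_outs)
      show ?thesis
      proof (cases "us ! j")
        case (Var i)
        then have "i < m" using red Var_reduced_iff by simp
        then have "(conv q, vs) \<in> ?N" using im Var by force
        then show ?thesis using notN by blast
      next
        case (Out p k ts)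
        then have o: "(p, ts) \<in> outward" "k < ar (conv p)" using red Out_reduced_iff by auto
        then have c': "(p, ts) \<in> cells" using outward_cells by auto
        have sub: "set ts \<subseteq> reduced" using c' unfolding cells_def tuples_def by auto
        have "\<sigma> (us ! j) = map \<sigma> (gate p ts) ! k"
          using o Out gate_outward by simp
        then have nth: "gate p (map \<sigma> ts) ! k = Out (conv q) j vs"
          using endo_gate[OF \<sigma> c'] im by simp
        show ?thesis
        proof (cases "(p, map \<sigma> ts) \<in> outward")
          case True
          then have "Out p k (map \<sigma> ts) = Out (conv q) j vs" using nth o gate_outward by simp
          then show ?thesis using Out sub by simp
        next
          case False
          have "size_list size ts < size (us ! j)" using Out by simp
          also have "\<dots> \<le> size_list size us" by (rule size_list_estimation'[OF uj]) simp
          finally have "flip (p, map \<sigma> ts) \<in> ?N" using less.hyps[OF _ o(1) False] by blast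
          then obtain i where i: "i < m" "(conv p, gate p (map \<sigma> ts)) \<in> nodes (\<sigma> (Var i))"
            unfolding flip_def by auto
          have "k < length (gate p (map \<sigma> ts))"
            using length_gate endo_cells[OF \<sigma> c'] o by simp
          then have "Out (conv q) j vs \<in> set (gate p (map \<sigma> ts))" using nth by (metis nth_mem)
          then have "nodes (Out (conv q) j vs) \<subseteq> nodes (\<sigma> (Var i))"
            using nodes_trans i by blast
          then show ?thesis using notN i(1) by auto
        qed
      qed
    qed
    obtain ts where ts: "map \<sigma> ts = vs" "set ts \<subseteq> reduced"
      using key[OF ar_pos[OF q]] by blast
    have "us = outs (conv q) ts"
    proof (rule nth_equalityI)
      show "length us = length (outs (conv q) ts)" using len conv_conv[OF q] by simp
      fix j assume "j < length us"
      then have j: "j < ar q" using len by simp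
      obtain ts' where ts': "us ! j = Out (conv q) j ts'" "map \<sigma> ts' = vs" "set ts' \<subseteq> reduced"
        using key[OF j] by blast
      \<comment> \<open>Here injectivity enters: the entries have inner tuples with equal images,
        but only a common inner tuple makes \<open>us\<close> a complete output tuple.\<close>
      have "ts' = ts"
        using inj ts ts' by (metis inj_on_map_eq_map inj_on_subset Un_least)
      then show "us ! j = outs (conv q) ts ! j" using ts' j conv_conv[OF q] by simp
    qed
    then show False using less.prems(1) unfolding outward_def by auto
  qed
qed

text \<open>The inverses of the images of the cells turning inward are distinct nodes in the
  finitely many images of variables. A cell and its flip have opposite directions, so flipping
  injects the cells turning outward into those turning inward.\<close>

lemma finite_turning:
  assumes "endo \<sigma>" "inj_on \<sigma> reduced"
  shows "finite {c \<in> cells. (c \<in> outward) \<noteq> (move \<sigma> c \<in> outward)}"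
proof -
  let ?A = "{c \<in> cells. c \<in> outward \<and> move \<sigma> c \<notin> outward}"
  let ?B = "{c \<in> cells. c \<notin> outward \<and> move \<sigma> c \<in> outward}"
  have move_cells: "move \<sigma> c \<in> cells" if "c \<in> cells" for c
    using that endo_cells[OF assms(1)] unfolding move_def by (cases c) auto
  have inj: "inj_on (move \<sigma>) cells"
  proof (rule inj_onI, clarify)
    fix q us p vs assume c: "(q, us) \<in> cells" "(p, vs) \<in> cells" "move \<sigma> (q, us) = move \<sigma> (p, vs)"
    then have "set us \<union> set vs \<subseteq> reduced" unfolding cells_def tuples_def by auto
    then have "inj_on \<sigma> (set us \<union> set vs)" using assms(2) inj_on_subset by blast
    then show "q = p \<and> us = vs" using c unfolding move_def by (auto simp: inj_on_map_eq_map)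
  qed
  have "(\<lambda>c. flip (move \<sigma> c)) ` ?A \<subseteq> (\<Union>i<m. nodes (\<sigma> (Var i)))"
    using turning_cells[OF assms] unfolding move_def by auto
  moreover have "finite (\<Union>i<m. nodes (\<sigma> (Var i)))" using finite_nodes by simp
  ultimately have im: "finite ((\<lambda>c. flip (move \<sigma> c)) ` ?A)" by (rule finite_subset)
  have "inj_on (\<lambda>c. flip (move \<sigma> c)) ?A"
  proof (rule inj_onI)
    fix c d assume "c \<in> ?A" "d \<in> ?A" "flip (move \<sigma> c) = flip (move \<sigma> d)"
    then show "c = d" using inj_onD[OF flip_inj] inj_onD[OF inj] move_cells by blast
  qed
  then have A: "finite ?A" using im by (rule finite_imageD[rotated])
  have "flip (q, us) \<in> ?A" if "(q, us) \<in> ?B" for q us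
  proof -
    have c: "(q, us) \<in> cells" "(q, us) \<notin> outward" "move \<sigma> (q, us) \<in> outward"
      using that by auto
    have "move \<sigma> (flip (q, us)) = flip (move \<sigma> (q, us))"
      using endo_gate[OF assms(1) c(1)] unfolding move_def flip_def by simp
    then show ?thesis
      using c outward_flip_iff gate_tuples endo_cells[OF assms(1)]
      unfolding flip_def move_def by auto
  qed
  then have "flip ` ?B \<subseteq> ?A" by auto
  then have "finite (flip ` ?B)" by (rule finite_subset) (rule A)
  moreover have "inj_on flip ?B" by (rule inj_on_subset[OF flip_inj]) blast
  ultimately have B: "finite ?B" by (rule finite_imageD)
  have "{c \<in> cells. (c \<in> outward) \<noteq> (move \<sigma> c \<in> outward)} \<subseteq> ?A \<union> ?B" by blast
  then show ?thesis using A B by (meson finite_UnI finite_subset)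
qed

primrec subst :: "(nat \<Rightarrow> 'q tm) \<Rightarrow> 'q tm \<Rightarrow> 'q tm" where
  "subst s (Var i) = s i"
| "subst s (Out q j us) = gate q (map (subst s) us) ! j"

lemma subst_reduced:
  assumes "\<And>i. i < m \<Longrightarrow> s i \<in> reduced"
  shows "t \<in> reduced \<Longrightarrow> subst s t \<in> reduced"
proof (induction t rule: reduced.induct)
  case (Out q j us)
  then have "(q, map (subst s) us) \<in> cells" unfolding cells_def tuples_def by auto
  then have "length (gate q (map (subst s) us)) = ar (conv q)"
    "set (gate q (map (subst s) us)) \<subseteq> reduced"
    using length_gate gate_reduced by blast+
  then show ?case using Out by (metis nth_mem subset_iff subst.simps(2))
qed (use assms in simp)

text \<open>Together with \<open>endo_eqI\<close> this is freeness. On outward cells the gate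
  equation is the recursion of \<open>subst\<close>; an inward cell is the flip of an outward one,
  and \<open>gate_gate\<close> inverts the equation.\<close>

lemma endo_subst:
  assumes "\<And>i. i < m \<Longrightarrow> s i \<in> reduced"
  shows "endo (subst s)"
proof -
  have red: "subst s ` reduced \<subseteq> reduced" using subst_reduced[of s, OF assms] by blast
  have cell: "(q, map (subst s) us) \<in> cells" if "(q, us) \<in> cells" for q us
    using that subst_reduced[of s, OF assms] unfolding cells_def tuples_def by auto
  have out: "map (subst s) (gate q us) = gate q (map (subst s) us)" if "(q, us) \<in> outward" for q us
  proof (rule nth_equalityI)
    have c: "(q, us) \<in> cells" using that outward_cells by blast
    then show len: "length (map (subst s) (gate q us)) = length (gate q (map (subst s) us))"
      using length_gate cell by simp
    fix j assume "j < length (map (subst s) (gate q us))"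
    then have "j < ar (conv q)" using length_gate c by simp
    then show "map (subst s) (gate q us) ! j = gate q (map (subst s) us) ! j"
      using gate_outward[OF that] by simp
  qed
  have "map (subst s) (gate q us) = gate q (map (subst s) us)" if c: "(q, us) \<in> cells" for q us
  proof (cases "(q, us) \<in> outward")
    case False
    let ?vs = "gate q us"
    have o: "us = outs (conv q) ?vs" "(conv q, ?vs) \<in> outward" using inwardE c False by metis+
    then have "map (subst s) us = gate (conv q) (map (subst s) ?vs)"
      using out gate_outward by metis
    moreover have "(conv q, map (subst s) ?vs) \<in> cells" using cell gate_tuples[OF c] by blast
    ultimately show ?thesis using gate_gate[of "conv q"] conv_conv c unfolding cells_def by auto
  qed (use out in blast)
  then show ?thesis using red unfolding endo_def by blast
qed

lemma endo_eqI:
  assumes "endo \<sigma>" "endo \<tau>" "\<And>i. i < m \<Longrightarrow> \<sigma> (Var i) = \<tau> (Var i)"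
  shows "t \<in> reduced \<Longrightarrow> \<sigma> t = \<tau> t"
proof (induction t rule: reduced.induct)
  case (Out q j us)
  then have o: "(q, us) \<in> outward" unfolding outward_def cells_def tuples_def by auto
  then have c: "(q, us) \<in> cells" using outward_cells by blast
  have e: "\<rho> (Out q j us) = gate q (map \<rho> us) ! j" if "endo \<rho>" for \<rho>
    using endo_gate[OF that c] gate_outward[OF o] Out(2)
    by (metis length_outs nth_map nth_outs)
  have "map \<sigma> us = map \<tau> us" using Out by simp
  then show ?case using e[OF assms(1)] e[OF assms(2)] by metis
qed (use assms in simp)

lemma endo_id: "endo id"
  unfolding endo_def by simp

lemma endo_comp:
  assumes "endo \<sigma>" "endo \<tau>"
  shows "endo (\<sigma> \<circ> \<tau>)"
  unfolding endo_def
proof (intro conjI allI impI)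
  show "(\<sigma> \<circ> \<tau>) ` reduced \<subseteq> reduced"
    using assms unfolding endo_def by (auto simp: image_subset_iff)
  fix q us assume "(q, us) \<in> cells"
  then show "map (\<sigma> \<circ> \<tau>) (gate q us) = gate q (map (\<sigma> \<circ> \<tau>) us)"
    using endo_gate[OF assms(1)] endo_gate[OF assms(2)] endo_cells[OF assms(2)]
    by (metis map_map)
qed


subsection \<open>Divisible automorphisms\<close>

definition aut_action :: "(int \<Rightarrow> 'q tm \<Rightarrow> 'q tm) \<Rightarrow> bool" where
  "aut_action a \<longleftrightarrow> int_action reduced a \<and> (\<forall>k. endo (a k))"

lemma cells_action:
  assumes "aut_action a"
  shows "int_action cells (\<lambda>k. move (a k))"
proof -
  interpret int_action reduced a using assms unfolding aut_action_def by blast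
  show ?thesis
  proof
    fix c j k assume c: "c \<in> cells"
    obtain q us where qus: "c = (q, us)" by (cases c)
    have red: "u \<in> reduced" if "u \<in> set us" for u
      using c that qus unfolding cells_def tuples_def by auto
    show "move (a k) c \<in> cells"
      using assms c endo_cells unfolding aut_action_def move_def qus by auto
    show "move (a 0) c = c" using red act_zero unfolding move_def qus by (auto intro: map_idI)
    show "move (a (j + k)) c = move (a j) (move (a k) c)"
      using red act_add unfolding move_def qus by auto
  qed
qed

lemma finite_switch:
  assumes "aut_action a"
  shows "finite (int_action.switch cells (\<lambda>k. move (a k)) outward)"
proof -
  interpret int_action reduced a using assms unfolding aut_action_def by blast
  interpret C: int_action cells "\<lambda>k. move (a k)" using cells_action assms .
  have "inj_on (a 1) reduced" by (rule inj_on_inverseI[of _ "a (- 1)"]) (use act_inverse in blast)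
  then show ?thesis unfolding C.switch_def using assms finite_turning unfolding aut_action_def by blast
qed

text \<open>Dependence of outputs on inputs along \<open>M\<close>. Its well-foundedness replaces
  induction on the size of terms once the outward cells have been exchanged for an invariant
  set.\<close>

definition parents :: "('q \<times> 'q tm list) set \<Rightarrow> ('q tm \<times> 'q tm) set" where
  "parents M = (\<Union>(q, us)\<in>M. set us \<times> set (gate q us))"

lemma wf_parents_outward: "wf (parents outward)"
proof (rule wf_subset[OF wf_inv_image[OF wf_less_than, of size]], clarify)
  fix u t assume "(u, t) \<in> parents outward"
  then obtain q us where *: "(q, us) \<in> outward" "u \<in> set us" "t \<in> set (gate q us)"
    unfolding parents_def by auto
  then obtain j where "t = Out q j us" using gate_outward in_set_outs by auto
  moreover have "size u \<le> size_list size us" using * by (meson order_refl size_list_estimation')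
  ultimately show "(u, t) \<in> inv_image less_than size" by simp
qed

text \<open>A cycle uses finitely many cells, and a high power carries all of them into
  \<open>outward\<close>, where sizes increase strictly. Acyclicity is enough for well-foundedness
  here, because only finitely many pairs come from cells that are not outward.\<close>

lemma wf_parents_limit:
  assumes a: "aut_action a" and M': "M' \<subseteq> cells" "finite (M' - outward)"
    and lim: "\<And>c. c \<in> M' \<Longrightarrow> \<exists>K. \<forall>k\<ge>K. move (a (l * k)) c \<in> outward"
  shows "wf (parents M')"
proof -
  have step: "\<exists>K. \<forall>k\<ge>K. (a (l * k) u, a (l * k) t) \<in> parents outward" if "(u, t) \<in> parents M'" for u t
  proof -
    obtain q us where *: "(q, us) \<in> M'" "u \<in> set us" "t \<in> set (gate q us)"
      using \<open>(u, t) \<in> parents M'\<close> unfolding parents_def by auto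
    obtain K where K: "\<And>k. k \<ge> K \<Longrightarrow> move (a (l * k)) (q, us) \<in> outward" using lim[OF *(1)] by blast
    have "(a (l * k) u, a (l * k) t) \<in> parents outward" if "k \<ge> K" for k
    proof -
      have "endo (a (l * k))" using a unfolding aut_action_def by blast
      then have "set (gate q (map (a (l * k)) us)) = a (l * k) ` set (gate q us)"
        using endo_gate * M' by (metis list.set_map subset_iff)
      then show ?thesis
        unfolding parents_def using K[OF that] * unfolding move_def by (intro UN_I) auto
    qed
    then show ?thesis by blast
  qed
  have "\<exists>K. \<forall>k\<ge>K. (a (l * k) u, a (l * k) t) \<in> (parents outward)\<^sup>+" if "(u, t) \<in> (parents M')\<^sup>+" for u t
    using that
  proof (induction rule: trancl_induct)
    case (base t)
    then show ?case using step by (meson trancl.r_into_trancl)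
  next
    case (step s t)
    obtain K1 where K1: "\<forall>k\<ge>K1. (a (l * k) u, a (l * k) s) \<in> (parents outward)\<^sup>+" using step by blast
    obtain K2 where K2: "\<forall>k\<ge>K2. (a (l * k) s, a (l * k) t) \<in> parents outward"
      using \<open>\<And>u t. (u, t) \<in> parents M' \<Longrightarrow> _\<close> step(2) by blast
    then have "\<forall>k\<ge>max K1 K2. (a (l * k) u, a (l * k) t) \<in> (parents outward)\<^sup>+"
      using K1 K2 by (meson max.bounded_iff trancl.trancl_into_trancl)
    then show ?case by blast
  qed
  then have acyc: "acyclic (parents M')"
    unfolding acyclic_def using wf_parents_outward by (meson wf_acyclic acyclic_def order_refl)
  have wf_extend: "acyclic (E \<union> r) \<Longrightarrow> wf (E \<union> r)" if "finite E" "wf r" for E r :: "('q tm \<times> 'q tm) set"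
    using that(1)
  proof (induction E)
    case empty
    then show ?case using that by simp
  next
    case (insert e E)
    obtain x y where e: "e = (x, y)" by (cases e)
    have "acyclic (E \<union> r)" using insert.prems by (rule acyclic_subset) auto
    then have "wf (E \<union> r)" using insert.IH by blast
    moreover have "(y, x) \<notin> (E \<union> r)\<^sup>*" using insert.prems unfolding e Un_insert_left acyclic_insert by blast
    ultimately show ?case unfolding e Un_insert_left wf_insert by blast
  qed
  have split: "parents M' = parents (M' - outward) \<union> parents (M' \<inter> outward)"
    unfolding parents_def by auto
  have "finite (parents (M' - outward))" using M' unfolding parents_def by auto
  moreover have "wf (parents (M' \<inter> outward))"
    by (rule wf_subset[OF wf_parents_outward]) (auto simp: parents_def)
  ultimately show ?thesis using wf_extend acyc unfolding split by blast
qed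

lemma finite_permutation_period:
  assumes "int_action B b" "finite B"
  obtains p where "p > 0" "\<And>x. x \<in> B \<Longrightarrow> b p x = x"
proof -
  interpret int_action B b by fact
  have per: "\<exists>k>0. b k x = x" if x: "x \<in> B" for x
  proof -
    have "\<not> inj (\<lambda>k. b k x)"
      using assms(2) x act_closed
      by (metis (mono_tags, lifting) finite_imageD finite_subset image_subsetI infinite_UNIV_int)
    then obtain i j where "i < j" "b i x = b j x" by (metis (mono_tags, lifting) injI linorder_neqE)
    then have "b (- i + j) x = x" using act_add[OF x, of "- i" j] act_inverse[OF x, of i] by simp
    then show ?thesis using \<open>i < j\<close> by (intro exI[of _ "- i + j"]) auto
  qed
  then obtain per where per: "\<And>x. x \<in> B \<Longrightarrow> per x > 0 \<and> b (per x) x = x" by metis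
  show thesis
  proof (rule that[of "\<Prod>x\<in>B. per x"])
    show "0 < (\<Prod>x\<in>B. per x)" by (rule prod_pos) (use per in blast)
    fix x assume x: "x \<in> B"
    obtain j where "(\<Prod>x\<in>B. per x) = per x * j" using dvd_prodI[OF assms(2) x, of per] by (elim dvdE)
    then show "b (\<Prod>x\<in>B. per x) x = x" using act_multiple per x by simp
  qed
qed

text \<open>
  The limit \<open>M'\<close> of the translates of the set of outward cells describes an invariant finite
  generating set: the terms that are not outputs of cells in \<open>M'\<close>.
\<close>

theorem divisible_imp_torsion:
  assumes a: "aut_action a"
    and roots: "\<And>N. \<exists>N'>N. \<exists>b. aut_action b \<and> (\<forall>k. \<forall>t\<in>reduced. b (int N' * k) t = a k t)"
  shows "\<exists>p>0. \<forall>t\<in>reduced. a p t = t"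
proof -
  interpret A: int_action reduced a using a unfolding aut_action_def by blast
  interpret C: int_action cells "\<lambda>k. move (a k)" using cells_action a .
  have fin: "finite (C.switch outward)" using finite_switch a .
  have bal: "\<exists>K. \<forall>k\<ge>K. move (a k) c \<in> outward \<longleftrightarrow> move (a (- k)) c \<in> outward"
    if c: "c \<in> cells" "C.aperiodic c" for c
  proof -
    obtain N b where N: "N > card (C.switch outward)" and b: "aut_action b"
      "\<And>k t. t \<in> reduced \<Longrightarrow> b (int N * k) t = a k t" using roots by blast
    have "move (b (int N * k)) c = move (a k) c" if "c \<in> cells" for c k
      using b(2) that unfolding move_def cells_def tuples_def by (auto simp: subset_iff)
    then show ?thesis
      using C.balanced_if_root[OF fin cells_action[OF b(1)] finite_switch[OF b(1)] _ N c] by blast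
  qed
  obtain l M' where l: "l > 0"
    and lim: "\<And>c. c \<in> cells \<Longrightarrow> \<exists>K. \<forall>k\<ge>K. move (a (l * k)) c \<in> outward \<longleftrightarrow> c \<in> M'"
    and fin': "finite {c \<in> cells. (c \<in> outward) \<noteq> (c \<in> M')}"
    by (rule C.invariant_limit[OF fin bal], assumption, assumption) (rule that)
  define M where "M = M' \<inter> cells"
  have M_inv: "move (a (l * j)) c \<in> M" if "c \<in> M" for c j
  proof -
    have c: "c \<in> cells" "c \<in> M'" using that unfolding M_def by auto
    obtain K1 where K1: "\<And>k. k \<ge> K1 \<Longrightarrow> move (a (l * k)) c \<in> outward" using lim[OF c(1)] c(2) by blast
    let ?c = "move (a (l * j)) c"
    have c': "?c \<in> cells" using C.act_closed c by blast
    obtain K2 where K2: "\<And>k. k \<ge> K2 \<Longrightarrow> move (a (l * k)) ?c \<in> outward \<longleftrightarrow> ?c \<in> M'"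
      using lim[OF c'] by blast
    \<comment> \<open>Late enough for both limits: time \<open>k\<close> for the moved cell is time
      \<open>k + j\<close> for \<open>c\<close>.\<close>
    define k where "k = max K2 (K1 - j)"
    have "move (a (l * k)) ?c = move (a (l * (k + j))) c"
      using C.act_add[OF c(1), of "l * k" "l * j"] by (simp add: algebra_simps)
    then have "?c \<in> M'" using K1[of "k + j"] K2[of k] unfolding k_def by simp
    then show ?thesis using c' unfolding M_def by blast
  qed
  have finM: "finite (M - outward)" "finite (outward - M)"
    using fin' outward_cells unfolding M_def by (auto elim!: finite_subset[rotated])
  have wf: "wf (parents M)"
  proof (rule wf_parents_limit[OF a])
    show "\<exists>K. \<forall>k\<ge>K. move (a (l * k)) c \<in> outward" if "c \<in> M" for c
      using lim[of c] that unfolding M_def by blast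
  qed (use finM M_def in auto)
  define B where "B = {t \<in> reduced. \<forall>(q, us)\<in>M. t \<notin> set (gate q us)}"
  \<comment> \<open>A reduced term that is not a variable is an output of its own outward cell, so
    it belongs to \<open>B\<close> only if that cell is missing from \<open>M\<close>.\<close>
  have "B \<subseteq> Var ` {..<m} \<union> (\<Union>(q, us)\<in>outward - M. set (gate q us))"
  proof
    fix t assume t: "t \<in> B"
    show "t \<in> Var ` {..<m} \<union> (\<Union>(q, us)\<in>outward - M. set (gate q us))"
    proof (cases t)
      case (Var i)
      then have "i < m" using t Var_reduced_iff unfolding B_def by simp
      then show ?thesis using Var by auto
    next
      case (Out q j us)
      then have *: "(q, us) \<in> outward" "j < ar (conv q)" using t Out_reduced_iff unfolding B_def by auto
      then have "t \<in> set (gate q us)" using Out gate_outward in_set_outs by auto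
      moreover from this have "(q, us) \<notin> M" using t unfolding B_def by auto
      ultimately show ?thesis using * by blast
    qed
  qed
  then have finB: "finite B" by (rule finite_subset) (use finM in auto)
  have B_inv: "a (l * k) t \<in> B" if t: "t \<in> B" for k t
  proof -
    have "a (l * k) t \<notin> set (gate q us)" if c: "(q, us) \<in> M" for q us
    proof
      assume "a (l * k) t \<in> set (gate q us)"
      then have "a (l * (- k)) (a (l * k) t) \<in> set (map (a (l * (- k))) (gate q us))" by simp
      moreover have "a (l * (- k)) (a (l * k) t) = t"
        using A.act_inverse[of t "l * k"] t unfolding B_def by simp
      moreover have "map (a (l * (- k))) (gate q us) = gate q (map (a (l * (- k))) us)"
        using endo_gate a c unfolding aut_action_def M_def by blast
      moreover have "(q, map (a (l * (- k))) us) \<in> M" using M_inv[OF c, of "- k"] unfolding move_def by simp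
      ultimately have "t \<in> set (gate q (map (a (l * (- k))) us))" "(q, map (a (l * (- k))) us) \<in> M"
        by metis+
      then show False using t unfolding B_def by blast
    qed
    then show ?thesis using t A.act_closed unfolding B_def by auto
  qed
  have "int_action B (\<lambda>k. a (l * k))"
    by unfold_locales
      (use B_inv A.act_zero A.act_add B_def in \<open>auto simp: distrib_left\<close>)
  then obtain p where p: "p > 0" "\<And>t. t \<in> B \<Longrightarrow> a (l * p) t = t"
    using finite_permutation_period finB by metis
  \<comment> \<open>Outside \<open>B\<close> a term is an output of a cell of \<open>M\<close>, and
    an endomorphism that fixes the inputs of a cell fixes its outputs.\<close>
  have "t \<in> reduced \<longrightarrow> a (l * p) t = t" for t
  proof (induction t rule: wf_induct_rule[OF wf])
    case (1 t)
    show ?case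
    proof
      assume t: "t \<in> reduced"
      show "a (l * p) t = t"
      proof (cases "t \<in> B")
        case False
        then obtain q us where c: "(q, us) \<in> M" "t \<in> set (gate q us)" using t unfolding B_def by auto
        have "a (l * p) u = u" if u: "u \<in> set us" for u
        proof -
          have "(u, t) \<in> parents M" using c u unfolding parents_def by auto
          moreover have "u \<in> reduced" using c u unfolding M_def cells_def tuples_def by auto
          ultimately show ?thesis using 1 by blast
        qed
        then have "map (a (l * p)) us = us" by (auto intro: map_idI)
        then have "map (a (l * p)) (gate q us) = gate q us"
          using endo_gate a c unfolding aut_action_def M_def by (metis IntD2)
        then show ?thesis using c by (metis (full_types) in_set_conv_nth nth_map)
      qed (use p in auto)
    qed
  qed
  then show ?thesis using p l by (intro exI[of _ "l * p"]) auto
qed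

end


section \<open>Diagrams as circuits of reversible gates\<close>

definition attached :: "nat list \<Rightarrow> (nat \<Rightarrow> nat list) \<Rightarrow> nat set \<Rightarrow> nat set \<Rightarrow> bool" where
  "attached b f T W \<longleftrightarrow> distinct b \<and> (\<forall>t\<in>T. distinct (f t) \<and> set (f t) \<inter> set b = {}) \<and>
     (\<forall>t\<in>T. \<forall>t'\<in>T. t \<noteq> t' \<longrightarrow> set (f t) \<inter> set (f t') = {}) \<and>
     set b \<union> (\<Union>t\<in>T. set (f t)) = W"

lemma bij_betw_nth_iff:
  "bij_betw (\<lambda>(s, i). side s ! i) (SIGMA s : I. {..<length (side s)}) W \<longleftrightarrow>
     (\<forall>s\<in>I. distinct (side s)) \<and> (\<forall>s\<in>I. \<forall>s'\<in>I. s \<noteq> s' \<longrightarrow> set (side s) \<inter> set (side s') = {}) \<and>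
     (\<Union>s\<in>I. set (side s)) = W" (is "?L \<longleftrightarrow> ?R")
proof -
  let ?g = "\<lambda>(s, i). side s ! i"
  have im: "?g ` (SIGMA s : I. {..<length (side s)}) = (\<Union>s\<in>I. set (side s))"
    by (force simp: in_set_conv_nth image_iff)
  have "inj_on ?g (SIGMA s : I. {..<length (side s)}) \<longleftrightarrow>
    (\<forall>s\<in>I. distinct (side s)) \<and> (\<forall>s\<in>I. \<forall>s'\<in>I. s \<noteq> s' \<longrightarrow> set (side s) \<inter> set (side s') = {})"
    (is "?inj \<longleftrightarrow> ?A \<and> ?B")
  proof
    assume inj: ?inj
    have ?A
      unfolding distinct_conv_nth
    proof (intro ballI allI impI)
      fix s i j assume "s \<in> I" "i < length (side s)" "j < length (side s)" "i \<noteq> j"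
      then show "side s ! i \<noteq> side s ! j" using inj_onD[OF inj, of "(s, i)" "(s, j)"] by auto
    qed
    moreover have ?B
    proof (intro ballI impI)
      fix s s' assume s: "s \<in> I" "s' \<in> I" "s \<noteq> s'"
      show "set (side s) \<inter> set (side s') = {}"
      proof (rule ccontr)
        assume "set (side s) \<inter> set (side s') \<noteq> {}"
        then obtain i i' where "i < length (side s)" "i' < length (side s')" "side s ! i = side s' ! i'"
          by (metis IntE all_not_in_conv in_set_conv_nth)
        then have "(s, i) = (s', i')" using inj_onD[OF inj, of "(s, i)" "(s', i')"] s by simp
        then show False using s by simp
      qed
    qed
    ultimately show "?A \<and> ?B" ..
  next
    assume AB: "?A \<and> ?B"
    show ?inj
    proof (rule inj_onI, clarify)
      fix s i s' i' assume *: "s \<in> I" "i < length (side s)" "s' \<in> I" "i' < length (side s')"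
        "side s ! i = side s' ! i'"
      then have "side s ! i \<in> set (side s) \<inter> set (side s')" by (metis IntI nth_mem)
      then have "s = s'" using AB * by blast
      then show "s = s' \<and> i = i'" using AB * nth_eq_iff_index_eq by blast
    qed
  qed
  then show ?thesis unfolding bij_betw_def im by blast
qed

lemma bottom_ends_iff:
  "bij_betw (\<lambda>(s, i). bottom_end_side D s ! i) (slots D (bottom_end_side D)) (wires D) \<longleftrightarrow>
    attached (frame_bot D) (upper D) (transistors D) (wires D)"
  unfolding slots_def bij_betw_nth_iff attached_def by auto blast+

lemma top_ends_iff:
  "bij_betw (\<lambda>(s, i). top_end_side D s ! i) (slots D (top_end_side D)) (wires D) \<longleftrightarrow>
    attached (frame_top D) (lower D) (transistors D) (wires D)"
  unfolding slots_def bij_betw_nth_iff attached_def by auto blast+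

lemma attached_cases:
  assumes "attached b f T W" "w \<in> W"
  obtains "w \<in> set b" "\<And>t. t \<in> T \<Longrightarrow> w \<notin> set (f t)"
  | t where "t \<in> T" "w \<in> set (f t)" "w \<notin> set b" "\<And>t'. t' \<in> T \<Longrightarrow> w \<in> set (f t') \<Longrightarrow> t' = t"
proof (cases "\<exists>t\<in>T. w \<in> set (f t)")
  case True
  then obtain t where "t \<in> T" "w \<in> set (f t)" by blast
  moreover have "w \<notin> set b" "\<And>t'. t' \<in> T \<Longrightarrow> w \<in> set (f t') \<Longrightarrow> t' = t"
    using assms calculation unfolding attached_def by blast+
  ultimately show thesis using that(2) by blast
next
  case False
  then have "w \<in> set b" using assms unfolding attached_def by blast
  then show thesis using that(1) False by blast
qed

lemma attached_unique:
  "attached b f T W \<Longrightarrow> t \<in> T \<Longrightarrow> t' \<in> T \<Longrightarrow> w \<in> set (f t) \<Longrightarrow> w \<in> set (f t') \<Longrightarrow> t = t'"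
  unfolding attached_def by blast

lemma attached_frame: "attached b f T W \<Longrightarrow> t \<in> T \<Longrightarrow> w \<in> set (f t) \<Longrightarrow> w \<notin> set b"
  unfolding attached_def by blast

lemma attached_subset: "attached b f T W \<Longrightarrow> set b \<subseteq> W" "attached b f T W \<Longrightarrow> t \<in> T \<Longrightarrow> set (f t) \<subseteq> W"
  unfolding attached_def by auto

text \<open>The relation applied by a transistor when it is read downwards. It serves as the gate
  type: inputs on the upper side, outputs on the lower side.\<close>

definition kind :: "'a diagram \<Rightarrow> nat \<Rightarrow> 'a list \<times> 'a list" where
  "kind D t = (map (label D) (upper D t), map (label D) (lower D t))"

section \<open>Renaming wires\<close>

lemma map_of_zip_nth:
  assumes "length xs = length ys" "x \<in> set xs"
  obtains i where "i < length xs" "xs ! i = x" "map_of (zip xs ys) x = Some (ys ! i)"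
proof -
  obtain y where y: "map_of (zip xs ys) x = Some y" using assms map_of_zip_is_Some by metis
  then have "(x, y) \<in> set (zip xs ys)" by (rule map_of_SomeD)
  then obtain i where "i < length xs" "xs ! i = x" "ys ! i = y" unfolding in_set_zip by auto
  then show thesis using that y by blast
qed

lemma rename_wire_notin: "w \<notin> set xs \<Longrightarrow> rename_wire (zip xs ys) d w = d w"
  unfolding rename_wire_def by (auto split: option.split dest: map_of_SomeD set_zip_leftD)

lemma rename_wire_in:
  assumes "length xs = length ys" "w \<in> set xs"
  obtains i where "i < length xs" "xs ! i = w" "rename_wire (zip xs ys) d w = ys ! i"
proof -
  obtain i where "i < length xs" "xs ! i = w" "map_of (zip xs ys) w = Some (ys ! i)"
    using map_of_zip_nth[OF assms] by blast
  then show thesis using that unfolding rename_wire_def by simp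
qed

lemma rename_wire_nth:
  assumes "length xs = length ys" "distinct xs" "i < length xs"
  shows "rename_wire (zip xs ys) d (xs ! i) = ys ! i"
  using map_of_zip_nth[OF assms(1) nth_mem[OF assms(3)]] assms(2,3)
  unfolding rename_wire_def by (metis nth_eq_iff_index_eq option.simps(5))

lemma rename_wire_image:
  assumes "length xs = length ys" "distinct xs"
  shows "rename_wire (zip xs ys) d ` set xs = set ys"
proof -
  have "map (rename_wire (zip xs ys) d) xs = ys"
    by (rule nth_equalityI) (use assms rename_wire_nth in auto)
  then show ?thesis by (metis list.set_map)
qed

text \<open>Applied to labels and to colours: an assignment that agrees along the glued wires
  survives the renaming.\<close>

lemma rename_wire_respects:
  assumes "length xs = length ys" "map g xs = map h ys" "\<And>w. w \<notin> set xs \<Longrightarrow> h (d w) = g w"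
  shows "h (rename_wire (zip xs ys) d w) = g w"
proof (cases "w \<in> set xs")
  case True
  obtain i where "i < length xs" "xs ! i = w" "rename_wire (zip xs ys) d w = ys ! i"
    by (rule rename_wire_in[OF assms(1) True])
  then show ?thesis using assms(1,2) by (metis nth_map)
next
  case False
  then show ?thesis using assms(3) rename_wire_notin by metis
qed

section \<open>Renaming, deleting and gluing in such partitions\<close>

lemma attached_disjoint:
  "attached b f T W \<Longrightarrow> t \<in> T \<Longrightarrow> t' \<in> T \<Longrightarrow> t \<noteq> t' \<Longrightarrow> set (f t) \<inter> set (f t') = {}"
  unfolding attached_def by blast

lemma attached_image:
  assumes att: "attached b f T W" and inj: "inj_on r W"
  shows "attached (map r b) (\<lambda>t. map r (f t)) T (r ` W)"
proof -
  have sub: "set b \<subseteq> W" "\<And>t. t \<in> T \<Longrightarrow> set (f t) \<subseteq> W" using attached_subset[OF att] by auto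
  have disj: "r ` A \<inter> r ` B = {}" if "A \<subseteq> W" "B \<subseteq> W" "A \<inter> B = {}" for A B
    using inj that by (metis image_empty inj_on_image_Int)
  show ?thesis
    unfolding attached_def
  proof (intro conjI ballI impI)
    show "distinct (map r b)"
      using att sub inj inj_on_subset unfolding attached_def distinct_map by blast
    fix t assume t: "t \<in> T"
    show "distinct (map r (f t))"
      using att sub(2)[OF t] t inj inj_on_subset unfolding attached_def distinct_map by blast
    show "set (map r (f t)) \<inter> set (map r b) = {}"
      using disj[OF sub(2)[OF t] sub(1)] att t unfolding attached_def by simp
    fix t' assume t': "t' \<in> T" "t \<noteq> t'"
    show "set (map r (f t)) \<inter> set (map r (f t')) = {}"
      using disj[OF sub(2)[OF t] sub(2)[OF t'(1)]] att t t' unfolding attached_def by simp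
  next
    have "set b \<union> (\<Union>t\<in>T. set (f t)) = W" using att unfolding attached_def by blast
    then have "r ` W = r ` set b \<union> (\<Union>t\<in>T. r ` set (f t))" by (metis image_UN image_Un)
    then show "set (map r b) \<union> (\<Union>t\<in>T. set (map r (f t))) = r ` W" by simp
  qed
qed

lemma attached_remove:
  assumes "attached b f T W" "U \<subseteq> T"
  shows "attached b f (T - U) (W - (\<Union>t\<in>U. set (f t)))"
proof -
  let ?V = "\<Union>t\<in>U. set (f t)"
  have "set b \<inter> ?V = {}" using attached_frame[OF assms(1)] assms(2) by blast
  moreover have "(\<Union>t\<in>T - U. set (f t)) \<inter> ?V = {}"
  proof (rule ccontr)
    assume "\<not> ?thesis"
    then obtain w s t where "s \<in> T - U" "t \<in> U" "w \<in> set (f s)" "w \<in> set (f t)" by blast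
    moreover from this have "s = t" using attached_unique[OF assms(1), of s t w] assms(2) by blast
    ultimately show False by blast
  qed
  moreover have "(\<Union>t\<in>T. set (f t)) = (\<Union>t\<in>T - U. set (f t)) \<union> ?V" using assms(2) by blast
  moreover have "W = set b \<union> (\<Union>t\<in>T. set (f t))" using assms(1) unfolding attached_def by blast
  ultimately have "set b \<union> (\<Union>t\<in>T - U. set (f t)) = W - ?V" by blast
  then show ?thesis using assms(1) unfolding attached_def by blast
qed

text \<open>The two wire sets meet exactly in the frame side \<open>b'\<close>, which becomes
  interior; hence the transistor sides of the second part avoid \<open>W\<close>. In a concatenation
  this serves the tops of wires and, with the two diagrams exchanged, their bottoms.\<close>

lemma attached_glue:
  assumes att: "attached b f T W" "attached b' f' T' W'" and glue: "set b' = W \<inter> W'"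
    and F: "\<And>t. t \<in> T \<Longrightarrow> F (g t) = f t" "\<And>t. t \<in> T' \<Longrightarrow> F (g' t) = f' t"
  shows "attached b F (g ` T \<union> g' ` T') (W \<union> W')"
proof -
  have sub: "set b \<subseteq> W" "\<And>t. t \<in> T \<Longrightarrow> set (f t) \<subseteq> W"
    using attached_subset[OF att(1)] by auto
  have out: "set (f' t) \<inter> W = {}" if "t \<in> T'" for t
  proof -
    have "set (f' t) \<subseteq> W'" using attached_subset(2)[OF att(2) that] .
    moreover have "set (f' t) \<inter> set b' = {}" using attached_frame[OF att(2) that] by blast
    ultimately show ?thesis unfolding glue by blast
  qed
  have UF: "(\<Union>t\<in>g ` T \<union> g' ` T'. set (F t)) = (\<Union>t\<in>T. set (f t)) \<union> (\<Union>t\<in>T'. set (f' t))"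
    using F by auto
  have W: "set b \<union> (\<Union>t\<in>T. set (f t)) = W" "set b' \<union> (\<Union>t\<in>T'. set (f' t)) = W'"
    using att unfolding attached_def by blast+
  show ?thesis
    unfolding attached_def
  proof (intro conjI)
    show "distinct b" using att(1) unfolding attached_def by blast
    show "\<forall>t\<in>g ` T \<union> g' ` T'. distinct (F t) \<and> set (F t) \<inter> set b = {}"
    proof
      fix t assume "t \<in> g ` T \<union> g' ` T'"
      then consider s where "s \<in> T" "t = g s" | s where "s \<in> T'" "t = g' s" by blast
      then show "distinct (F t) \<and> set (F t) \<inter> set b = {}"
      proof cases
        case 1
        then show ?thesis using att(1) F(1) unfolding attached_def by simp
      next
        case 2
        then have "distinct (F t)" using att(2) F(2) unfolding attached_def by simp
        then show ?thesis using out[OF 2(1)] sub(1) F(2) 2 by auto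
      qed
    qed
    show "\<forall>t\<in>g ` T \<union> g' ` T'. \<forall>t'\<in>g ` T \<union> g' ` T'. t \<noteq> t' \<longrightarrow> set (F t) \<inter> set (F t') = {}"
    proof (intro ballI impI)
      fix t t' assume t: "t \<in> g ` T \<union> g' ` T'" "t' \<in> g ` T \<union> g' ` T'" "t \<noteq> t'"
      consider s s' where "s \<in> T" "t = g s" "s' \<in> T" "t' = g s'"
        | s s' where "s \<in> T" "t = g s" "s' \<in> T'" "t' = g' s'"
        | s s' where "s \<in> T'" "t = g' s" "s' \<in> T" "t' = g s'"
        | s s' where "s \<in> T'" "t = g' s" "s' \<in> T'" "t' = g' s'"
        using t by blast
      then show "set (F t) \<inter> set (F t') = {}"
      proof cases
        case 1
        then show ?thesis using attached_disjoint[OF att(1), of s s'] t(3) F(1) by auto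
      next
        case 2
        then show ?thesis using sub(2)[of s] out[of s'] F by auto
      next
        case 3
        then show ?thesis using sub(2)[of s'] out[of s] F by auto
      next
        case 4
        then show ?thesis using attached_disjoint[OF att(2), of s s'] t(3) F(2) by auto
      qed
    qed
    have "set b' \<subseteq> W" using glue by blast
    then show "set b \<union> (\<Union>t\<in>g ` T \<union> g' ` T'. set (F t)) = W \<union> W'" unfolding UF using W by blast
  qed
qed

section \<open>The gates of a semigroup presentation\<close>

locale presentation =
  fixes S :: "'a set" and R :: "('a list \<times> 'a list) set" and n :: nat
  assumes pres: "semigroup_presentation S R"

text \<open>A relation gives one gate in each direction, and swapping its sides is inversion.
  Non-emptiness of the words in relations is positivity of arities. Later \<open>n\<close> is the
  length of the base word.\<close>

sublocale presentation \<subseteq> gates "R \<union> R\<inverse>" prod.swap "\<lambda>q. length (fst q)" n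
  by unfold_locales (use pres in \<open>auto simp: semigroup_presentation_def\<close>)

context presentation begin

abbreviation diagram :: "'a diagram \<Rightarrow> bool" where
  "diagram \<equiv> braided_diagram S R"

lemma diagram_iff:
  "diagram D \<longleftrightarrow> finite (wires D) \<and> wires D \<noteq> {} \<and> label D ` wires D \<subseteq> S \<and>
     finite (transistors D) \<and>
     attached (frame_bot D) (upper D) (transistors D) (wires D) \<and>
     attached (frame_top D) (lower D) (transistors D) (wires D) \<and>
     (\<forall>t\<in>transistors D. kind D t \<in> R \<union> R\<inverse>) \<and> acyclic (precedes D)"
  unfolding braided_diagram_def bottom_ends_iff top_ends_iff kind_def by auto

lemma kind_nonempty:
  assumes "diagram D" "t \<in> transistors D"
  shows "upper D t \<noteq> []" "lower D t \<noteq> []"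
proof -
  have "kind D t \<in> R \<union> R\<inverse>" using assms unfolding diagram_iff by blast
  then show "upper D t \<noteq> []" "lower D t \<noteq> []"
    using ar_pos[of "kind D t"] ar_pos[of "prod.swap (kind D t)"] conv_closed unfolding kind_def by auto
qed

lemma rank_exists:
  assumes D: "diagram D"
  obtains rk :: "nat \<Rightarrow> nat" where "\<And>t s. (t, s) \<in> precedes D \<Longrightarrow> rk s < rk t"
proof -
  have acyc: "acyclic (precedes D)" and fin: "finite (transistors D)"
    using D unfolding diagram_iff by auto
  \<comment> \<open>\<open>precedes\<close> points upwards, so this counts the transistors above
    \<open>t\<close>.\<close>
  define rk where "rk t = card {s \<in> transistors D. (t, s) \<in> (precedes D)\<^sup>+}" for t
  have "rk s < rk t" if "(t, s) \<in> precedes D" for s t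
    unfolding rk_def
  proof (rule psubset_card_mono)
    show "finite {s \<in> transistors D. (t, s) \<in> (precedes D)\<^sup>+}" using fin by simp
    have "s \<in> transistors D" using that unfolding precedes_def by auto
    moreover have "(s, s) \<notin> (precedes D)\<^sup>+" using acyc unfolding acyclic_def by blast
    ultimately show "{u \<in> transistors D. (s, u) \<in> (precedes D)\<^sup>+} \<subset> {u \<in> transistors D. (t, u) \<in> (precedes D)\<^sup>+}"
      using that by (auto intro: trancl_into_trancl2)
  qed
  then show thesis using that by blast
qed

text \<open>Turns acyclicity of the transistors into an induction on wires. Wires that start at the
  frame have depth 0, others one more than the rank of the transistor from which they start.\<close>

lemma depth_exists:
  assumes D: "diagram D"
  obtains dep :: "nat \<Rightarrow> nat" where
    "\<And>t v w. t \<in> transistors D \<Longrightarrow> v \<in> set (upper D t) \<Longrightarrow> w \<in> set (lower D t) \<Longrightarrow> dep v < dep w"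
proof -
  have top: "attached (frame_top D) (lower D) (transistors D) (wires D)"
    and bot: "attached (frame_bot D) (upper D) (transistors D) (wires D)"
    using D unfolding diagram_iff by auto
  obtain rk :: "nat \<Rightarrow> nat" where rk: "\<And>t s. (t, s) \<in> precedes D \<Longrightarrow> rk s < rk t"
    using rank_exists[OF D] by blast
  define dep where "dep w = (if \<exists>t\<in>transistors D. w \<in> set (lower D t)
    then Suc (rk (THE t. t \<in> transistors D \<and> w \<in> set (lower D t))) else 0)" for w
  have dep: "dep w = Suc (rk t)" if "t \<in> transistors D" "w \<in> set (lower D t)" for t w
  proof -
    have "(THE t. t \<in> transistors D \<and> w \<in> set (lower D t)) = t"
      using that attached_unique[OF top] by blast
    then show ?thesis using that unfolding dep_def by auto
  qed
  have "dep v < dep w" if t: "t \<in> transistors D" "v \<in> set (upper D t)" "w \<in> set (lower D t)" for t v w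
  proof (cases "\<exists>s\<in>transistors D. v \<in> set (lower D s)")
    case True
    then obtain s where s: "s \<in> transistors D" "v \<in> set (lower D s)" by blast
    then have "(t, s) \<in> precedes D"
      using t attached_subset(2)[OF bot] unfolding precedes_def by blast
    then show ?thesis using rk dep s t by simp
  next
    case False
    then have "dep v = 0" unfolding dep_def by simp
    then show ?thesis using dep t by simp
  qed
  then show thesis using that by blast
qed

section \<open>Colouring wires by terms\<close>

definition colouring :: "'a diagram \<Rightarrow> (nat \<Rightarrow> ('a list \<times> 'a list) tm) \<Rightarrow> bool" where
  "colouring D c \<longleftrightarrow> c ` wires D \<subseteq> reduced \<and>
     (\<forall>t\<in>transistors D. map c (lower D t) = gate (kind D t) (map c (upper D t)))"

definition computes :: "'a diagram \<Rightarrow> ('a list \<times> 'a list) tm list \<Rightarrow> ('a list \<times> 'a list) tm list \<Rightarrow> bool" where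
  "computes D xs ys \<longleftrightarrow>
     (\<exists>c. colouring D c \<and> map c (frame_top D) = xs \<and> map c (frame_bot D) = ys)"

lemma cellI:
  assumes "diagram D" "t \<in> transistors D" "c ` set (upper D t) \<subseteq> reduced"
  shows "(kind D t, map c (upper D t)) \<in> cells"
proof -
  have "kind D t \<in> R \<union> R\<inverse>" using assms unfolding diagram_iff by blast
  moreover have "map c (upper D t) \<in> tuples (kind D t)"
    using assms(3) unfolding tuples_def kind_def by simp
  ultimately show ?thesis unfolding cells_def by blast
qed

lemma colouring_cells:
  assumes "diagram D" "colouring D c" "t \<in> transistors D"
  shows "(kind D t, map c (upper D t)) \<in> cells"
proof (rule cellI[OF assms(1,3)])
  have "set (upper D t) \<subseteq> wires D"
    using assms attached_subset(2) unfolding diagram_iff by blast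
  then show "c ` set (upper D t) \<subseteq> reduced" using assms(2) unfolding colouring_def by blast
qed

lemma ex_colouring:
  assumes D: "diagram D" and xs: "length xs = length (frame_top D)" "set xs \<subseteq> reduced"
  shows "\<exists>c. colouring D c \<and> map c (frame_top D) = xs"
proof -
  have top: "attached (frame_top D) (lower D) (transistors D) (wires D)"
    and bot: "attached (frame_bot D) (upper D) (transistors D) (wires D)"
    using D unfolding diagram_iff by auto
  obtain dep :: "nat \<Rightarrow> nat" where
    dep: "\<And>t v w. t \<in> transistors D \<Longrightarrow> v \<in> set (upper D t) \<Longrightarrow> w \<in> set (lower D t) \<Longrightarrow> dep v < dep w"
    using depth_exists[OF D] by blast
  define place where "place us w = (THE i. i < length us \<and> us ! i = w)" for us and w :: nat
  have place: "place us (us ! i) = i" if "distinct us" "i < length us" for us i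
    unfolding place_def using that by (auto simp: nth_eq_iff_index_eq)
  define above where "above w = (THE t. t \<in> transistors D \<and> w \<in> set (lower D t))" for w
  have above: "above w = t" if "t \<in> transistors D" "w \<in> set (lower D t)" for t w
    unfolding above_def using that attached_unique[OF top] by blast
  define H where "H f w = (if w \<in> set (frame_top D) then xs ! place (frame_top D) w
    else gate (kind D (above w)) (map f (upper D (above w))) ! place (lower D (above w)) w)" for f w
  \<comment> \<open>Recursion on depth: the inputs of a transistor are shallower than its outputs,
    so \<open>cut\<close> hides none of the colours that \<open>H\<close> consults for an output
    wire.\<close>
  define c where "c = wfrec (inv_image less_than dep) H"
  have c: "c w = H (cut c (inv_image less_than dep) w) w" for w
    unfolding c_def by (rule wfrec) (simp add: wf_inv_image)
  have c_top: "map c (frame_top D) = xs"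
  proof (rule nth_equalityI)
    fix i assume "i < length (map c (frame_top D))"
    then show "map c (frame_top D) ! i = xs ! i"
      using c place top unfolding H_def attached_def by simp
  qed (use xs in simp)
  have c_low: "c (lower D t ! j) = gate (kind D t) (map c (upper D t)) ! j"
    if t: "t \<in> transistors D" and j: "j < length (lower D t)" for t j
  proof -
    let ?w = "lower D t ! j"
    have w: "?w \<in> set (lower D t)" "?w \<notin> set (frame_top D)"
      using j attached_frame[OF top t] by auto
    have "map (cut c (inv_image less_than dep) ?w) (upper D t) = map c (upper D t)"
      using dep t w by (auto simp: cut_def)
    moreover have "place (lower D t) ?w = j" using place top t j unfolding attached_def by blast
    moreover have "c ?w = gate (kind D t) (map (cut c (inv_image less_than dep) ?w) (upper D t)) ! place (lower D t) ?w"
      using c[of ?w] above[OF t w(1)] w unfolding H_def by simp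
    ultimately show ?thesis by metis
  qed
  have red: "w \<in> wires D \<longrightarrow> c w \<in> reduced" for w
  proof (induction w rule: measure_induct_rule[of dep])
    case (less w)
    show ?case
    proof
      assume "w \<in> wires D"
      with top show "c w \<in> reduced"
      proof (cases rule: attached_cases)
        case 1
        then show ?thesis using c_top xs(2) by (metis image_eqI list.set_map subset_iff)
      next
        case (2 t)
        then obtain j where j: "j < length (lower D t)" "w = lower D t ! j" by (metis in_set_conv_nth)
        have "c v \<in> reduced" if "v \<in> set (upper D t)" for v
          using less dep[OF 2(1) that 2(2)] attached_subset(2)[OF bot 2(1)] that by blast
        then have cell: "(kind D t, map c (upper D t)) \<in> cells"
          using cellI[OF D 2(1)] by blast
        have "j < length (gate (kind D t) (map c (upper D t)))"
          using length_gate[OF cell] j unfolding kind_def by simp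
        then have "c w \<in> set (gate (kind D t) (map c (upper D t)))"
          unfolding j(2) c_low[OF 2(1) j(1)] by (rule nth_mem)
        then show ?thesis using gate_reduced[OF cell] by blast
      qed
    qed
  qed
  have "map c (lower D t) = gate (kind D t) (map c (upper D t))" if t: "t \<in> transistors D" for t
  proof (rule nth_equalityI)
    have "c ` set (upper D t) \<subseteq> reduced"
      using red attached_subset(2)[OF bot] t by blast
    then show "length (map c (lower D t)) = length (gate (kind D t) (map c (upper D t)))"
      using length_gate[OF cellI[OF D t]] unfolding kind_def by simp
  qed (use c_low t in simp)
  moreover have "c ` wires D \<subseteq> reduced" using red by blast
  ultimately show ?thesis using c_top unfolding colouring_def by blast
qed

lemma colouring_unique:
  assumes D: "diagram D" and c: "colouring D c" "colouring D c'" "map c (frame_top D) = map c' (frame_top D)"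
  shows "w \<in> wires D \<Longrightarrow> c w = c' w"
proof -
  have top: "attached (frame_top D) (lower D) (transistors D) (wires D)"
    and bot: "attached (frame_bot D) (upper D) (transistors D) (wires D)"
    using D unfolding diagram_iff by auto
  obtain dep :: "nat \<Rightarrow> nat" where
    dep: "\<And>t v w. t \<in> transistors D \<Longrightarrow> v \<in> set (upper D t) \<Longrightarrow> w \<in> set (lower D t) \<Longrightarrow> dep v < dep w"
    using depth_exists[OF D] by blast
  show "w \<in> wires D \<Longrightarrow> c w = c' w"
  proof (induction w rule: measure_induct_rule[of dep])
    case (less w)
    from top less.prems show ?case
    proof (cases rule: attached_cases)
      case 1
      then show ?thesis using c(3) by simp
    next
      case (2 t)
      have "map c (upper D t) = map c' (upper D t)"
      proof (rule map_cong[OF refl])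
        fix v assume v: "v \<in> set (upper D t)"
        show "c v = c' v"
        proof (rule less.IH)
          show "dep v < dep w" using dep[OF 2(1) v 2(2)] .
          show "v \<in> wires D" using attached_subset(2)[OF bot 2(1)] v by blast
        qed
      qed
      then have "map c (lower D t) = map c' (lower D t)"
        using c(1,2) 2(1) unfolding colouring_def by metis
      then show ?thesis unfolding map_eq_conv using 2(2) by (rule bspec)
    qed
  qed
qed

text \<open>Gates are injective on cells, so colours are also determined upwards from the bottom of
  the frame, by induction on the distance to the maximal depth.\<close>

lemma colouring_unique_bot:
  assumes D: "diagram D" and c: "colouring D c" "colouring D c'" "map c (frame_bot D) = map c' (frame_bot D)"
  shows "w \<in> wires D \<Longrightarrow> c w = c' w"
proof -
  have top: "attached (frame_top D) (lower D) (transistors D) (wires D)"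
    and bot: "attached (frame_bot D) (upper D) (transistors D) (wires D)"
    and fin: "finite (wires D)"
    using D unfolding diagram_iff by auto
  obtain dep :: "nat \<Rightarrow> nat" where
    dep: "\<And>t v w. t \<in> transistors D \<Longrightarrow> v \<in> set (upper D t) \<Longrightarrow> w \<in> set (lower D t) \<Longrightarrow> dep v < dep w"
    using depth_exists[OF D] by blast
  define N where "N = Max (dep ` wires D)"
  have N: "dep w \<le> N" if "w \<in> wires D" for w unfolding N_def using fin that by simp
  show "w \<in> wires D \<Longrightarrow> c w = c' w"
  proof (induction w rule: measure_induct_rule[of "\<lambda>w. N - dep w"])
    case (less w)
    from bot less.prems show ?case
    proof (cases rule: attached_cases)
      case 1
      then show ?thesis using c(3) by simp
    next
      case (2 t)
      have "map c (lower D t) = map c' (lower D t)"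
      proof (rule map_cong[OF refl])
        fix v assume v: "v \<in> set (lower D t)"
        then have "v \<in> wires D" using attached_subset(2)[OF top 2(1)] by blast
        moreover have "dep w < dep v" using dep 2 v by blast
        ultimately show "c v = c' v" using N[of v] by (intro less.IH) simp_all
      qed
      then have "gate (kind D t) (map c (upper D t)) = gate (kind D t) (map c' (upper D t))"
        using c(1,2) 2(1) unfolding colouring_def by metis
      then have "map c (upper D t) = map c' (upper D t)"
        using gate_inj colouring_cells[OF D _ 2(1)] c(1,2) by metis
      then show ?thesis unfolding map_eq_conv using 2(2) by (rule bspec)
    qed
  qed
qed

lemma computes_total:
  "diagram D \<Longrightarrow> length xs = length (frame_top D) \<Longrightarrow> set xs \<subseteq> reduced \<Longrightarrow> \<exists>ys. computes D xs ys"
  using ex_colouring unfolding computes_def by blast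

lemma computes_fun:
  assumes "diagram D" "computes D xs ys" "computes D xs zs"
  shows "ys = zs"
proof -
  obtain c c' where c: "colouring D c" "map c (frame_top D) = xs" "map c (frame_bot D) = ys"
    "colouring D c'" "map c' (frame_top D) = xs" "map c' (frame_bot D) = zs"
    using assms unfolding computes_def by blast
  have "set (frame_bot D) \<subseteq> wires D" using assms attached_subset(1) unfolding diagram_iff by blast
  then have "map c (frame_bot D) = map c' (frame_bot D)"
    using colouring_unique[OF assms(1) c(1,4)] c by (metis (no_types, lifting) map_cong subset_iff)
  then show ?thesis using c by simp
qed

lemma computes_inj:
  assumes "diagram D" "computes D xs zs" "computes D ys zs"
  shows "xs = ys"
proof -
  obtain c c' where c: "colouring D c" "map c (frame_top D) = xs" "map c (frame_bot D) = zs"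
    "colouring D c'" "map c' (frame_top D) = ys" "map c' (frame_bot D) = zs"
    using assms unfolding computes_def by blast
  have "set (frame_top D) \<subseteq> wires D" using assms attached_subset(1) unfolding diagram_iff by blast
  then have "map c (frame_top D) = map c' (frame_top D)"
    using colouring_unique_bot[OF assms(1) c(1,4)] c by (metis (no_types, lifting) map_cong subset_iff)
  then show ?thesis using c by simp
qed

lemma computes_reduced:
  assumes "diagram D" "computes D xs ys"
  shows "length ys = length (frame_bot D)" "set ys \<subseteq> reduced"
proof -
  obtain c where c: "colouring D c" "map c (frame_bot D) = ys"
    using assms unfolding computes_def by blast
  have "set (frame_bot D) \<subseteq> wires D" using assms attached_subset(1) unfolding diagram_iff by blast
  then have "c ` set (frame_bot D) \<subseteq> reduced" using c(1) unfolding colouring_def by blast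
  then show "length ys = length (frame_bot D)" "set ys \<subseteq> reduced"
    using c(2) by auto
qed

text \<open>A colouring followed by an endomorphism is again a colouring. Hence the outputs for the
  variables determine the outputs for everything substituted into them.\<close>

lemma computes_endo:
  assumes "diagram D" "computes D xs ys" "endo \<sigma>"
  shows "computes D (map \<sigma> xs) (map \<sigma> ys)"
proof -
  obtain c where c: "colouring D c" "map c (frame_top D) = xs" "map c (frame_bot D) = ys"
    using assms unfolding computes_def by blast
  have "colouring D (\<sigma> \<circ> c)"
    unfolding colouring_def
  proof (intro conjI ballI)
    show "(\<sigma> \<circ> c) ` wires D \<subseteq> reduced"
      using c(1) assms(3) unfolding colouring_def endo_def by (auto simp: image_subset_iff)
    fix t assume t: "t \<in> transistors D"
    have "map \<sigma> (map c (lower D t)) = gate (kind D t) (map \<sigma> (map c (upper D t)))"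
      using endo_gate[OF assms(3) colouring_cells[OF assms(1) c(1) t]] c(1) t
      unfolding colouring_def by simp
    then show "map (\<sigma> \<circ> c) (lower D t) = gate (kind D t) (map (\<sigma> \<circ> c) (upper D t))" by simp
  qed
  then show ?thesis using c unfolding computes_def by (metis map_map)
qed

section \<open>Dipole reduction\<close>

lemma dipoleD:
  assumes "diagram D" "dipole D t1 t2"
  shows "t1 \<in> transistors D" "t2 \<in> transistors D" "t1 \<noteq> t2" "(t1, t2) \<in> precedes D"
    "upper D t1 = lower D t2" "kind D t2 = prod.swap (kind D t1)"
    "length (lower D t1) = length (upper D t2)"
    "set (lower D t1) \<inter> set (upper D t2) = {}"
proof -
  have D: "acyclic (precedes D)"
    "attached (frame_bot D) (upper D) (transistors D) (wires D)"
    "attached (frame_top D) (lower D) (transistors D) (wires D)"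
    using assms(1) unfolding diagram_iff by auto
  show p: "(t1, t2) \<in> precedes D" and u: "upper D t1 = lower D t2"
    using assms unfolding dipole_def by auto
  show t: "t1 \<in> transistors D" "t2 \<in> transistors D" using p unfolding precedes_def by auto
  show "t1 \<noteq> t2" using p D(1) unfolding acyclic_def by blast
  have "map (label D) (upper D t2) = map (label D) (lower D t1)"
    using assms unfolding dipole_def by auto
  then show "kind D t2 = prod.swap (kind D t1)" "length (lower D t1) = length (upper D t2)"
    using u unfolding kind_def by (auto dest: map_eq_imp_length_eq)
  show "set (lower D t1) \<inter> set (upper D t2) = {}"
  proof (rule ccontr)
    assume "\<not> ?thesis"
    then obtain w where "w \<in> set (upper D t2)" "w \<in> set (lower D t1)" by blast
    then have "(t2, t1) \<in> precedes D"
      using t attached_subset(2)[OF D(2)] unfolding precedes_def by blast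
    then show False using p D(1) unfolding acyclic_def by (meson trancl.simps)
  qed
qed

text \<open>In a dipole the lower transistor \<open>t1\<close> undoes the upper one
  \<open>t2\<close>. The wires to be joined thus have equal colours, and the old colouring serves
  the reduced diagram.\<close>

lemma computes_reduce:
  assumes D: "diagram D" and dip: "dipole D t1 t2" and comp: "computes D xs ys"
  shows "computes (reduce_dipole D t1 t2) xs ys"
proof -
  note d = dipoleD[OF D dip]
  obtain c where c: "colouring D c" "map c (frame_top D) = xs" "map c (frame_bot D) = ys"
    using comp unfolding computes_def by blast
  define r where "r = rename_wire (zip (lower D t1) (upper D t2)) (\<lambda>w. w)"
  have "map c (upper D t1) = gate (kind D t2) (map c (upper D t2))"
    using c(1) d(2,5) unfolding colouring_def by metis
  then have "map c (lower D t1) = gate (prod.swap (kind D t2)) (gate (kind D t2) (map c (upper D t2)))"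
    using c(1) d(1,6) unfolding colouring_def by simp
  then have "map c (lower D t1) = map c (upper D t2)"
    using gate_gate[OF colouring_cells[OF D c(1) d(2)]] by metis
  then have cr: "c (r w) = c w" for w
    unfolding r_def by (rule rename_wire_respects[OF d(7)]) simp
  have "map (label D) (lower D t1) = map (label D) (upper D t2)" using dip unfolding dipole_def by simp
  then have lr: "label D (r w) = label D w" for w
    unfolding r_def by (rule rename_wire_respects[OF d(7)]) simp
  let ?E = "reduce_dipole D t1 t2"
  have E: "wires ?E \<subseteq> wires D" "transistors ?E \<subseteq> transistors D" "label ?E = label D"
    "upper ?E = (\<lambda>t. map r (upper D t))" "lower ?E = lower D" "frame_top ?E = frame_top D"
    "frame_bot ?E = map r (frame_bot D)"
    unfolding reduce_dipole_def r_def Let_def by auto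
  have k: "kind ?E t = kind D t" for t unfolding kind_def E using lr by simp
  have u: "map c (upper ?E t) = map c (upper D t)" for t unfolding E using cr by simp
  have "colouring ?E c"
    unfolding colouring_def k u
  proof (intro conjI ballI)
    show "c ` wires ?E \<subseteq> reduced" using c(1) E(1) unfolding colouring_def by blast
    fix t assume "t \<in> transistors ?E"
    then show "map c (lower ?E t) = gate (kind D t) (map c (upper D t))"
      using c(1) E(2) unfolding E(5) colouring_def by blast
  qed
  moreover have "map c (frame_bot ?E) = ys" unfolding E using cr c(3) by (simp add: comp_def)
  ultimately show ?thesis using c(2) E(6) unfolding computes_def by metis
qed

lemma diagram_reduce:
  assumes D: "diagram D" and dip: "dipole D t1 t2" and ne: "frame_top D \<noteq> []"
  shows "diagram (reduce_dipole D t1 t2)"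
proof -
  note d = dipoleD[OF D dip]
  have bot: "attached (frame_bot D) (upper D) (transistors D) (wires D)"
    and top: "attached (frame_top D) (lower D) (transistors D) (wires D)"
    using D unfolding diagram_iff by auto
  define r where "r = rename_wire (zip (lower D t1) (upper D t2)) (\<lambda>w. w)"
  let ?E = "reduce_dipole D t1 t2"
  let ?T = "transistors D - {t1, t2}" and ?W = "wires D - set (upper D t1) - set (lower D t1)"
  have E: "wires ?E = ?W" "transistors ?E = ?T" "label ?E = label D"
    "upper ?E = (\<lambda>t. map r (upper D t))" "lower ?E = lower D" "frame_top ?E = frame_top D"
    "frame_bot ?E = map r (frame_bot D)"
    unfolding reduce_dipole_def r_def Let_def by auto
  have "map (label D) (lower D t1) = map (label D) (upper D t2)" using dip unfolding dipole_def by simp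
  then have lr: "label D (r w) = label D w" for w
    unfolding r_def by (rule rename_wire_respects[OF d(7)]) simp
  have k: "kind ?E t = kind D t" for t unfolding kind_def E using lr by simp
  have dist: "distinct (lower D t1)" "distinct (upper D t2)"
    using top bot d unfolding attached_def by auto
  have r_low: "r ` set (lower D t1) = set (upper D t2)"
    unfolding r_def using rename_wire_image d(7) dist by blast
  have r_id: "r w = w" if "w \<notin> set (lower D t1)" for w
    unfolding r_def using rename_wire_notin that .
  have low: "set (lower D t1) \<subseteq> wires D" "set (upper D t2) \<subseteq> wires D" "set (upper D t1) \<subseteq> wires D"
    using attached_subset(2)[OF top] attached_subset(2)[OF bot] d by auto
  have disj: "set (lower D t1) \<inter> set (upper D t1) = {}" "set (upper D t2) \<inter> set (upper D t1) = {}"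
    using attached_disjoint[OF top d(1,2,3)] attached_disjoint[OF bot d(1,2,3)] d(5) by auto
  \<comment> \<open>The wires whose bottoms survive the deletion of both transistors. A joined wire
    takes its bottom from below \<open>t1\<close> and its name from above \<open>t2\<close>, so
    \<open>r\<close> has to map \<open>?V\<close> bijectively onto the remaining names
    \<open>?W\<close>.\<close>
  let ?V = "wires D - set (upper D t1) - set (upper D t2)"
  have att_bot: "attached (frame_bot D) (upper D) ?T ?V"
  proof -
    have "wires D - (\<Union>t\<in>{t1, t2}. set (upper D t)) = ?V" by auto
    then show ?thesis using attached_remove[OF bot, of "{t1, t2}"] d(1,2) by simp
  qed
  have inj: "inj_on r ?V"
  proof -
    have "inj_on r (set (lower D t1))"
      using r_low dist d(7) by (metis distinct_card eq_card_imp_inj_on List.finite_set)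
    moreover have "inj_on r (?V - set (lower D t1))" using r_id by (simp add: inj_on_def)
    moreover have "r ` (set (lower D t1)) \<inter> r ` (?V - set (lower D t1)) = {}"
      unfolding r_low using r_id by auto
    ultimately have "inj_on r (set (lower D t1) \<union> (?V - set (lower D t1)))"
      by (intro inj_on_Un[THEN iffD2]) auto
    then show ?thesis by (rule inj_on_subset) auto
  qed
  have "?V = set (lower D t1) \<union> (?V - set (lower D t1))" using low disj d(8) by blast
  then have "r ` ?V = set (upper D t2) \<union> r ` (?V - set (lower D t1))" using r_low by (metis image_Un)
  also have "r ` (?V - set (lower D t1)) = ?V - set (lower D t1)" using r_id by simp
  finally have "r ` ?V = ?W" using low disj d(8) by blast
  then have att1: "attached (frame_bot ?E) (upper ?E) (transistors ?E) (wires ?E)"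
    using attached_image[OF att_bot inj] unfolding E by simp
  have "wires D - (\<Union>t\<in>{t1, t2}. set (lower D t)) = ?W" using d(5) by auto
  then have att2: "attached (frame_top ?E) (lower ?E) (transistors ?E) (wires ?E)"
    using attached_remove[OF top, of "{t1, t2}"] d(1,2) unfolding E by simp
  \<comment> \<open>An adjacency created by a joined wire expands to a chain through
    \<open>t1\<close> and \<open>t2\<close>.\<close>
  have "precedes ?E \<subseteq> (precedes D)\<^sup>+"
  proof clarify
    fix s s' assume "(s, s') \<in> precedes ?E"
    then obtain w where s: "s \<in> ?T" "s' \<in> ?T" and w: "w \<in> r ` set (upper D s)" "w \<in> set (lower D s')"
      unfolding precedes_def E by auto
    then obtain b where b: "b \<in> set (upper D s)" "w = r b" by blast
    have bW: "b \<in> wires D" using b attached_subset(2)[OF bot] s by blast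
    show "(s, s') \<in> (precedes D)\<^sup>+"
    proof (cases "b \<in> set (lower D t1)")
      case False
      then have "(s, s') \<in> precedes D" using b w s r_id bW unfolding precedes_def by auto
      then show ?thesis by blast
    next
      case True
      then have "(s, t1) \<in> precedes D" using b s d bW unfolding precedes_def by auto
      moreover have "w \<in> set (upper D t2)" using True b r_low by blast
      then have "(t2, s') \<in> precedes D" using s d w low unfolding precedes_def by auto
      ultimately show ?thesis using d(4) by (meson trancl.simps)
    qed
  qed
  then have "(precedes ?E)\<^sup>+ \<subseteq> (precedes D)\<^sup>+"
    by (metis trancl_id trancl_mono_subset trans_trancl)
  then have acyc: "acyclic (precedes ?E)" using D unfolding diagram_iff acyclic_def by blast
  \<comment> \<open>A diagram must keep at least one wire; those on the top side of the frame are
    never deleted.\<close>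
  have "set (frame_top D) \<subseteq> wires ?E" using attached_subset(1)[OF att2] unfolding E(6) .
  then have "wires ?E \<noteq> {}" using ne by auto
  moreover have "finite (wires ?E)" "finite (transistors ?E)" "label ?E ` wires ?E \<subseteq> S"
    "\<forall>t\<in>transistors ?E. kind ?E t \<in> R \<union> R\<inverse>"
    using D unfolding diagram_iff k unfolding E by auto
  ultimately show ?thesis using att1 att2 acyc unfolding diagram_iff by blast
qed

lemma computes_iso:
  assumes D: "diagram D" and iso: "diagram_iso D E" and comp: "computes E xs ys"
  shows "computes D xs ys"
proof -
  obtain f g where f: "bij_betw f (wires D) (wires E)" and g: "bij_betw g (transistors D) (transistors E)"
    and lab: "\<And>w. w \<in> wires D \<Longrightarrow> label E (f w) = label D w"
    and sides: "\<And>t. t \<in> transistors D \<Longrightarrow> upper E (g t) = map f (upper D t)"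
      "\<And>t. t \<in> transistors D \<Longrightarrow> lower E (g t) = map f (lower D t)"
      "frame_top E = map f (frame_top D)" "frame_bot E = map f (frame_bot D)"
    using iso unfolding diagram_iso_def by blast
  obtain c where c: "colouring E c" "map c (frame_top E) = xs" "map c (frame_bot E) = ys"
    using comp unfolding computes_def by blast
  have "colouring D (c \<circ> f)"
    unfolding colouring_def
  proof (intro conjI ballI)
    show "(c \<circ> f) ` wires D \<subseteq> reduced"
      using c(1) f unfolding colouring_def bij_betw_def by (auto simp: image_subset_iff)
    fix t assume t: "t \<in> transistors D"
    have "set (upper D t) \<subseteq> wires D" "set (lower D t) \<subseteq> wires D"
      using D t attached_subset(2) unfolding diagram_iff by blast+
    then have "kind E (g t) = kind D t"
      unfolding kind_def sides(1,2)[OF t] using lab by (auto simp: subset_iff)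
    moreover have "g t \<in> transistors E" using g t unfolding bij_betw_def by blast
    ultimately show "map (c \<circ> f) (lower D t) = gate (kind D t) (map (c \<circ> f) (upper D t))"
      using c(1) sides(1,2)[OF t] unfolding colouring_def by (metis map_map)
  qed
  then show ?thesis using c sides(3,4) unfolding computes_def by auto
qed

lemma reductions:
  assumes "dipole_reduction\<^sup>*\<^sup>* D E" "diagram D" "frame_top D \<noteq> []"
  shows "diagram E \<and> top_word E = top_word D \<and> bot_word E = bot_word D \<and> frame_top E = frame_top D \<and>
    (\<forall>xs ys. computes D xs ys \<longrightarrow> computes E xs ys)"
  using assms(1)
proof (induction rule: rtranclp_induct)
  case (step E F)
  then obtain t1 t2 where t: "dipole E t1 t2" "F = reduce_dipole E t1 t2"
    unfolding dipole_reduction_def by blast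
  define r where "r = rename_wire (zip (lower E t1) (upper E t2)) (\<lambda>w. w)"
  have E: "diagram E" using step by blast
  have "map (label E) (lower E t1) = map (label E) (upper E t2)" using t unfolding dipole_def by simp
  then have "label E (r w) = label E w" for w
    unfolding r_def by (rule rename_wire_respects[OF dipoleD(7)[OF E t(1)]]) simp
  then have "top_word F = top_word E" "bot_word F = bot_word E" "frame_top F = frame_top E"
    unfolding t(2) reduce_dipole_def top_word_def bot_word_def r_def Let_def by auto
  then show ?case using step diagram_reduce[OF E t(1)] computes_reduce[OF E t(1)] assms(3) t(2) by auto
qed (use assms in auto)

lemma dipole_free_exists:
  assumes "diagram D" "frame_top D \<noteq> []"
  shows "\<exists>E. dipole_reduction\<^sup>*\<^sup>* D E \<and> dipole_free E"
  using assms
proof (induction "card (transistors D)" arbitrary: D rule: less_induct)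
  case less
  show ?case
  proof (cases "dipole_free D")
    case False
    then obtain t1 t2 where t: "dipole D t1 t2" unfolding dipole_free_def by blast
    let ?E = "reduce_dipole D t1 t2"
    have step: "dipole_reduction D ?E" using t unfolding dipole_reduction_def by blast
    have "diagram ?E" using diagram_reduce less t by blast
    moreover have "transistors ?E = transistors D - {t1, t2}" "frame_top ?E = frame_top D"
      unfolding reduce_dipole_def Let_def by auto
    moreover have "card (transistors D - {t1, t2}) < card (transistors D)"
      using less.prems dipoleD(1)[OF less.prems(1) t] unfolding diagram_iff
      by (intro psubset_card_mono) auto
    ultimately show ?thesis using less step by (metis converse_rtranclp_into_rtranclp)
  qed blast
qed

section \<open>Concatenation\<close>

lemma concatenation_aux:
  assumes D: "diagram D" and E: "diagram E" and glue: "bot_word D = top_word E"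
  defines "r \<equiv> rename_wire (zip (frame_top E) (map (\<lambda>w. 2 * w) (frame_bot D))) (\<lambda>w. 2 * w + 1)"
  defines "C \<equiv> concatenation D E"
  shows "wires C = (\<lambda>w. 2 * w) ` wires D \<union> r ` wires E"
    "transistors C = (\<lambda>t. 2 * t) ` transistors D \<union> (\<lambda>t. 2 * t + 1) ` transistors E"
    "frame_top C = map (\<lambda>w. 2 * w) (frame_top D)" "frame_bot C = map r (frame_bot E)"
    "\<And>t. upper C (2 * t) = map (\<lambda>w. 2 * w) (upper D t)" "\<And>t. upper C (2 * t + 1) = map r (upper E t)"
    "\<And>t. lower C (2 * t) = map (\<lambda>w. 2 * w) (lower D t)" "\<And>t. lower C (2 * t + 1) = map r (lower E t)"
    "\<And>w. label C (2 * w) = label D w" "\<And>w. label C (r w) = label E w"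
    "length (frame_top E) = length (frame_bot D)"
    "r ` set (frame_top E) = (\<lambda>w. 2 * w) ` set (frame_bot D)"
    "inj_on r (wires E)"
    "\<And>w. even (r w) \<longleftrightarrow> w \<in> set (frame_top E)"
proof -
  show C: "wires C = (\<lambda>w. 2 * w) ` wires D \<union> r ` wires E"
    "transistors C = (\<lambda>t. 2 * t) ` transistors D \<union> (\<lambda>t. 2 * t + 1) ` transistors E"
    "frame_top C = map (\<lambda>w. 2 * w) (frame_top D)" "frame_bot C = map r (frame_bot E)"
    "\<And>t. upper C (2 * t) = map (\<lambda>w. 2 * w) (upper D t)" "\<And>t. upper C (2 * t + 1) = map r (upper E t)"
    "\<And>t. lower C (2 * t) = map (\<lambda>w. 2 * w) (lower D t)" "\<And>t. lower C (2 * t + 1) = map r (lower E t)"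
    and l: "\<And>w. label C (2 * w) = label D w"
    unfolding C_def concatenation_def Let_def r_def by simp_all
  have lab: "map (label D) (frame_bot D) = map (label E) (frame_top E)"
    using glue unfolding bot_word_def top_word_def .
  then show len: "length (frame_top E) = length (frame_bot D)" by (metis length_map)
  then have len': "length (frame_top E) = length (map (\<lambda>w. 2 * w) (frame_bot D))" by simp
  have lab_odd: "label C (2 * w + 1) = label E w" for w
    unfolding C_def concatenation_def Let_def by simp
  have lab': "map (label E) (frame_top E) = map (label C) (map (\<lambda>w. 2 * w) (frame_bot D))"
    using lab l by (simp add: comp_def)
  show "label C (r w) = label E w" for w
    unfolding r_def by (rule rename_wire_respects[OF len' lab']) (rule lab_odd)
  have distE: "distinct (frame_top E)" and distD: "distinct (frame_bot D)"
    using D E unfolding diagram_iff attached_def by auto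
  show im: "r ` set (frame_top E) = (\<lambda>w. 2 * w) ` set (frame_bot D)"
    unfolding r_def using rename_wire_image[OF len' distE] by simp
  have odd: "r w = 2 * w + 1" if "w \<notin> set (frame_top E)" for w
    unfolding r_def using rename_wire_notin[OF that] .
  show even: "even (r w) \<longleftrightarrow> w \<in> set (frame_top E)" for w
  proof
    assume "w \<in> set (frame_top E)"
    then have "r w \<in> (\<lambda>w. 2 * w) ` set (frame_bot D)" using im by blast
    then show "even (r w)" by auto
  qed (use odd in fastforce)
  have "card (r ` set (frame_top E)) = card (set (frame_top E))"
    unfolding im using distD distE len by (simp add: card_image inj_on_def distinct_card)
  then have inj: "inj_on r (set (frame_top E))" by (intro eq_card_imp_inj_on) auto
  show "inj_on r (wires E)"
  proof (rule inj_onI)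
    fix v w assume "r v = r w"
    then show "v = w" using inj_onD[OF inj] even odd by (metis add_right_imp_eq nat_mult_eq_cancel_disj zero_neq_numeral)
  qed
qed

lemma diagram_concatenation:
  assumes D: "diagram D" and E: "diagram E" and glue: "bot_word D = top_word E"
  shows "diagram (concatenation D E)"
proof -
  define r where "r = rename_wire (zip (frame_top E) (map (\<lambda>w. 2 * w) (frame_bot D))) (\<lambda>w. 2 * w + 1)"
  define C where "C = concatenation D E"
  note C = concatenation_aux[OF D E glue, folded r_def C_def]
  let ?l = "\<lambda>w::nat. 2 * w"
  have botD: "attached (frame_bot D) (upper D) (transistors D) (wires D)"
    and topD: "attached (frame_top D) (lower D) (transistors D) (wires D)"
    using D unfolding diagram_iff by auto
  have botE: "attached (frame_bot E) (upper E) (transistors E) (wires E)"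
    and topE: "attached (frame_top E) (lower E) (transistors E) (wires E)"
    using E unfolding diagram_iff by auto
  have injl: "inj_on ?l (wires D)" by (simp add: inj_on_def)
  have subs: "set (frame_top E) \<subseteq> wires E" "set (frame_bot D) \<subseteq> wires D"
    using attached_subset(1) topE botD by blast+
  have meet: "?l ` wires D \<inter> r ` wires E = ?l ` set (frame_bot D)"
  proof
    show "?l ` wires D \<inter> r ` wires E \<subseteq> ?l ` set (frame_bot D)"
    proof
      fix x assume "x \<in> ?l ` wires D \<inter> r ` wires E"
      then obtain v w where "x = r w" "x = 2 * v" by blast
      then have "x = r w" "even (r w)" by (metis dvd_triv_left)+
      then show "x \<in> ?l ` set (frame_bot D)" using C(14) C(12) by blast
    qed
    show "?l ` set (frame_bot D) \<subseteq> ?l ` wires D \<inter> r ` wires E"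
      unfolding C(12)[symmetric] using subs C(12) by blast
  qed
  have "attached (frame_top C) (lower C) (transistors C) (wires C)"
    unfolding C(1,2,3)
    by (rule attached_glue[OF attached_image[OF topD injl] attached_image[OF topE C(13)]])
      (simp_all only: set_map C(7,8,12) meet)
  moreover have "attached (frame_bot C) (upper C) (transistors C) (wires C)"
    unfolding C(1,2,4) Un_commute[of "?l ` wires D"] Un_commute[of "?l ` transistors D"]
    by (rule attached_glue[OF attached_image[OF botE C(13)] attached_image[OF botD injl]])
      (simp_all only: set_map C(5,6) meet Int_commute[of "r ` wires E"])
  moreover have "acyclic (precedes C)"
  proof -
    obtain rkD :: "nat \<Rightarrow> nat" where rkD: "\<And>t s. (t, s) \<in> precedes D \<Longrightarrow> rkD s < rkD t"
      using rank_exists[OF D] by blast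
    obtain rkE :: "nat \<Rightarrow> nat" where rkE: "\<And>t s. (t, s) \<in> precedes E \<Longrightarrow> rkE s < rkE t"
      using rank_exists[OF E] by blast
    \<comment> \<open>A rank decreasing upwards: first compare the two diagrams, \<open>D\<close>
      being on top, then use the rank inside each of them.\<close>
    define rk where "rk t = (if even t then (0::nat, rkD (t div 2)) else (1, rkE (t div 2)))" for t
    have "(rk s, rk t) \<in> less_than <*lex*> less_than" if ts: "(t, s) \<in> precedes C" for s t
    proof -
      obtain w where w: "t \<in> transistors C" "s \<in> transistors C" "w \<in> set (upper C t)" "w \<in> set (lower C s)"
        using ts unfolding precedes_def by blast
      consider a b where "t = 2 * a" "s = 2 * b" "a \<in> transistors D" "b \<in> transistors D"
        | a b where "t = 2 * a" "s = 2 * b + 1" "b \<in> transistors E"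
        | a b where "t = 2 * a + 1" "s = 2 * b"
        | a b where "t = 2 * a + 1" "s = 2 * b + 1" "a \<in> transistors E" "b \<in> transistors E"
        using w(1,2) unfolding C(2) by blast
      then show ?thesis
      proof cases
        case 1
        obtain v where v: "v \<in> set (upper D a)" "v \<in> set (lower D b)"
          using w(3,4) unfolding 1(1,2) C(5,7) by auto
        then have "(a, b) \<in> precedes D"
          using 1 attached_subset(2)[OF botD 1(3)] unfolding precedes_def by blast
        then show ?thesis using rkD 1 unfolding rk_def by simp
      next
        case 2
        \<comment> \<open>This case is impossible: an even name would put a wire that starts at a
          transistor of \<open>E\<close> on the top side of the frame of \<open>E\<close>.\<close>
        obtain v where v: "v \<in> set (lower E b)" "w = r v" using w(4) unfolding 2(2) C(8) by auto
        moreover have "even w" using w(3) unfolding 2(1) C(5) by auto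
        ultimately have "v \<in> set (frame_top E)" using C(14) by blast
        then show ?thesis using attached_frame[OF topE 2(3) v(1)] by blast
      next
        case 3
        then show ?thesis unfolding rk_def by simp
      next
        case 4
        obtain v v' where v: "v \<in> set (upper E a)" "v' \<in> set (lower E b)" "r v = r v'"
          using w(3,4) unfolding 4(1,2) C(6,8) by auto
        moreover have "v \<in> wires E" "v' \<in> wires E"
          using v attached_subset(2)[OF botE 4(3)] attached_subset(2)[OF topE 4(4)] by auto
        ultimately have "v = v'" using C(13) unfolding inj_on_def by blast
        then have "(a, b) \<in> precedes E"
          using 4 v attached_subset(2)[OF botE 4(3)] unfolding precedes_def by blast
        then show ?thesis using rkE 4 unfolding rk_def by simp
      qed
    qed
    then have "(precedes C)\<inverse> \<subseteq> inv_image (less_than <*lex*> less_than) rk"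
      unfolding inv_image_def by blast
    moreover have "wf (inv_image (less_than <*lex*> less_than) rk)" by (intro wf_inv_image) auto
    ultimately have "acyclic ((precedes C)\<inverse>)" by (metis wf_acyclic wf_subset)
    then show ?thesis by simp
  qed
  moreover have "finite (wires C)" "wires C \<noteq> {}" "finite (transistors C)"
    using D E unfolding diagram_iff C(1,2) by auto
  moreover have "label C ` wires C \<subseteq> S"
    using D E unfolding diagram_iff C(1) by (auto simp: C(9,10))
  moreover have "kind C t \<in> R \<union> R\<inverse>" if t: "t \<in> transistors C" for t
  proof -
    have k: "kind C (2 * a) = kind D a" "kind C (2 * a + 1) = kind E a" for a
      unfolding kind_def C(5-8) by (simp_all add: comp_def C(9,10))
    consider a where "t = 2 * a" "a \<in> transistors D" | a where "t = 2 * a + 1" "a \<in> transistors E"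
      using t unfolding C(2) by blast
    then show ?thesis
    proof cases
      case 1
      then show ?thesis using D k(1) unfolding diagram_iff by simp
    next
      case 2
      then show ?thesis using E k(2)[of a] unfolding diagram_iff 2(1) by simp
    qed
  qed
  ultimately have "diagram C" unfolding diagram_iff by blast
  then show ?thesis unfolding C_def .
qed

lemma computes_concatenation:
  assumes D: "diagram D" and E: "diagram E" and glue: "bot_word D = top_word E"
    and comp: "computes D xs ys" "computes E ys zs"
  shows "computes (concatenation D E) xs zs"
proof -
  define r where "r = rename_wire (zip (frame_top E) (map (\<lambda>w. 2 * w) (frame_bot D))) (\<lambda>w. 2 * w + 1)"
  define C where "C = concatenation D E"
  note C = concatenation_aux[OF D E glue, folded r_def C_def]
  obtain c where c: "colouring D c" "map c (frame_top D) = xs" "map c (frame_bot D) = ys"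
    using comp unfolding computes_def by blast
  obtain d where d: "colouring E d" "map d (frame_top E) = ys" "map d (frame_bot E) = zs"
    using comp unfolding computes_def by blast
  define e where "e w = (if even w then c (w div 2) else d (w div 2))" for w
  have el: "e (2 * w) = c w" for w unfolding e_def by simp
  have er: "e (r w) = d w" for w
    unfolding r_def
  proof (rule rename_wire_respects)
    show "length (frame_top E) = length (map (\<lambda>w. 2 * w) (frame_bot D))" using C(11) by simp
    show "map d (frame_top E) = map e (map (\<lambda>w. 2 * w) (frame_bot D))"
      using c d by (simp add: comp_def el)
  qed (simp add: e_def)
  have kind: "kind C (2 * a) = kind D a" "kind C (2 * a + 1) = kind E a" for a
    unfolding kind_def C(5-8) by (simp_all add: comp_def C(9,10))
  have map_el: "map e (map (\<lambda>w. 2 * w) vs) = map c vs" for vs by (simp add: el)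
  have map_er: "map e (map r vs) = map d vs" for vs by (simp add: er)
  have "colouring C e"
    unfolding colouring_def
  proof (intro conjI ballI)
    have "e ` wires C = c ` wires D \<union> d ` wires E" unfolding C(1) image_Un image_image el er ..
    then show "e ` wires C \<subseteq> reduced" using c(1) d(1) unfolding colouring_def by simp
    fix t assume "t \<in> transistors C"
    then consider a where "t = 2 * a" "a \<in> transistors D" | a where "t = 2 * a + 1" "a \<in> transistors E"
      unfolding C(2) by blast
    then show "map e (lower C t) = gate (kind C t) (map e (upper C t))"
    proof cases
      case 1
      then show ?thesis using c(1) unfolding 1(1) kind C(5,7) map_el colouring_def by blast
    next
      case 2
      then show ?thesis using d(1) unfolding 2(1) kind C(6,8) map_er colouring_def by blast
    qed
  qed
  moreover have "map e (frame_top C) = xs" "map e (frame_bot C) = zs"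
    unfolding C(3,4) map_el map_er using c d by auto
  ultimately show ?thesis unfolding computes_def C_def by blast
qed

lemma word_concatenation:
  assumes "diagram D" "diagram E" "bot_word D = top_word E"
  shows "top_word (concatenation D E) = top_word D" "bot_word (concatenation D E) = bot_word E"
proof -
  define r where "r = rename_wire (zip (frame_top E) (map (\<lambda>w. 2 * w) (frame_bot D))) (\<lambda>w. 2 * w + 1)"
  define C where "C = concatenation D E"
  note C = concatenation_aux[OF assms, folded r_def C_def]
  show "top_word (concatenation D E) = top_word D" "bot_word (concatenation D E) = bot_word E"
    unfolding C_def[symmetric] top_word_def bot_word_def C(3,4) by (simp_all add: comp_def C(9,10))
qed

subsection \<open>Faithfulness\<close>

definition vars :: "('a list \<times> 'a list) tm list" where
  "vars = map Var [0..<n]"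

lemma vars_simps [simp]: "length vars = n" "i < n \<Longrightarrow> vars ! i = Var i" "distinct vars"
  unfolding vars_def by (auto simp: distinct_map inj_on_def)

lemma set_vars: "set vars = Var ` {..<n}"
  unfolding vars_def by auto

lemma vars_reduced: "set vars \<subseteq> reduced"
  unfolding set_vars using Var_reduced_iff by auto

text \<open>
  If a gate of a dipole-free diagram were to cancel, then all its inputs would be outputs of
  transistors of the inverse kind with equal input colours; by injectivity of the colouring
  these are the same transistor, which forms a dipole with the gate.
\<close>

lemma dipole_free_colouring:
  assumes D: "diagram D" and free: "dipole_free D"
    and c: "colouring D c" and c_top: "map c (frame_top D) = vars"
  shows "inj_on c (wires D)" "\<And>t. t \<in> transistors D \<Longrightarrow> (kind D t, map c (upper D t)) \<in> outward"
proof -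
  have bot: "attached (frame_bot D) (upper D) (transistors D) (wires D)"
    and top: "attached (frame_top D) (lower D) (transistors D) (wires D)"
    using D unfolding diagram_iff by auto
  obtain dep :: "nat \<Rightarrow> nat" where
    dep: "\<And>t v w. t \<in> transistors D \<Longrightarrow> v \<in> set (upper D t) \<Longrightarrow> w \<in> set (lower D t) \<Longrightarrow> dep v < dep w"
    using depth_exists[OF D] by blast
  define out where "out t \<longleftrightarrow> (kind D t, map c (upper D t)) \<in> outward" for t
  have lenlow: "length (fst (prod.swap (kind D t))) = length (lower D t)" for t unfolding kind_def by simp
  have out_colour: "c (lower D t ! j) = Out (kind D t) j (map c (upper D t))"
    if "t \<in> transistors D" "out t" "j < length (lower D t)" for t j
  proof -
    have "map c (lower D t) = outs (kind D t) (map c (upper D t))"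
      using c that gate_outward unfolding colouring_def out_def by metis
    then have "c (lower D t ! j) = outs (kind D t) (map c (upper D t)) ! j" using that(3) by (metis nth_map)
    then show ?thesis using that(3) lenlow by simp
  qed
  have top_colour: "\<exists>i<n. c w = Var i" if "w \<in> set (frame_top D)" for w
  proof -
    have "c w \<in> set vars" using that c_top by (metis image_eqI list.set_map)
    then show ?thesis unfolding set_vars by auto
  qed
  have inj_top: "inj_on c (set (frame_top D))"
    using c_top vars_simps(3) by (metis distinct_map)
  \<comment> \<open>Both claims go together by induction on depth: injectivity at smaller depth
    excludes cancellation at the next level, and outward gates in turn make colours at that level
    reveal the output from which a wire starts.\<close>
  have main: "inj_on c {w \<in> wires D. dep w < k} \<and>
    (\<forall>t\<in>transistors D. (\<exists>w\<in>set (lower D t). dep w < k) \<longrightarrow> out t)" for k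
  proof (induction k)
    case (Suc k)
    then have inj: "inj_on c {w \<in> wires D. dep w < k}"
      and outk: "\<And>t w. t \<in> transistors D \<Longrightarrow> w \<in> set (lower D t) \<Longrightarrow> dep w < k \<Longrightarrow> out t" by auto
    have up: "set (upper D t) \<subseteq> {w \<in> wires D. dep w < k}"
      if "t \<in> transistors D" "w \<in> set (lower D t)" "dep w < Suc k" for t w
      using that dep[OF that(1) _ that(2)] attached_subset(2)[OF bot that(1)] by force
    \<comment> \<open>Equal input colours mean equal input wires, and a non-empty upper side
      identifies its transistor.\<close>
    have same: "t = t'" if t: "t \<in> transistors D" "t' \<in> transistors D"
      "set (upper D t) \<subseteq> {w \<in> wires D. dep w < k}" "set (upper D t') \<subseteq> {w \<in> wires D. dep w < k}"
      "map c (upper D t) = map c (upper D t')" for t t'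
    proof -
      have "inj_on c (set (upper D t) \<union> set (upper D t'))"
        using t(3,4) by (intro inj_on_subset[OF inj]) blast
      then have "upper D t = upper D t'" using t(5) inj_on_map_eq_map by blast
      then show ?thesis
        using attached_unique[OF bot t(1,2)] kind_nonempty(1)[OF D t(1)] by (metis list.set_sel(1))
    qed
    have outk': "out t" if t: "t \<in> transistors D" and w: "w \<in> set (lower D t)" "dep w < Suc k" for t w
    proof (rule ccontr)
      assume "\<not> out t"
      let ?q = "kind D t"
      define us where "us = gate ?q (map c (upper D t))"
      have cell: "(?q, map c (upper D t)) \<in> cells" using colouring_cells[OF D c t] .
      have us: "map c (upper D t) = outs (prod.swap ?q) us"
        using inwardE[OF cell] \<open>\<not> out t\<close> unfolding out_def us_def by metis
      \<comment> \<open>The colour of entry \<open>j\<close> forces it to be output \<open>j\<close>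
        of a transistor of the inverse kind. The matching index is what later lines up the two sides
        in the same order.\<close>
      have source: "\<exists>s\<in>transistors D. out s \<and> kind D s = prod.swap ?q \<and> us = map c (upper D s) \<and>
          upper D t ! j = lower D s ! j \<and> j < length (lower D s) \<and>
          set (upper D s) \<subseteq> {w \<in> wires D. dep w < k}"
        if j: "j < length (upper D t)" for j
      proof -
        let ?v = "upper D t ! j"
        have v: "?v \<in> wires D" "dep ?v < k" using up[OF t w] j nth_mem by blast+
        have "map c (upper D t) ! j = Out (prod.swap ?q) j us"
          unfolding us using j by (intro nth_outs) (simp add: kind_def)
        then have cv: "c ?v = Out (prod.swap ?q) j us" using j by simp
        from top v(1) show ?thesis
        proof (cases rule: attached_cases)
          case 1
          then show ?thesis using top_colour cv by force
        next
          case (2 s)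
          then obtain i where i: "i < length (lower D s)" "lower D s ! i = ?v" by (metis in_set_conv_nth)
          have s: "out s" using outk[OF 2(1,2) v(2)] .
          have "Out (kind D s) i (map c (upper D s)) = Out (prod.swap ?q) j us"
            using out_colour[OF 2(1) s i(1)] i(2) cv by simp
          moreover have "set (upper D s) \<subseteq> {w \<in> wires D. dep w < k}"
            using up[OF 2(1,2)] v(2) by simp
          ultimately show ?thesis using 2(1) s i by (intro bexI[of _ s]) auto
        qed
      qed
      have pos: "0 < length (upper D t)" using kind_nonempty(1)[OF D t] by simp
      obtain s where s: "s \<in> transistors D" "kind D s = prod.swap ?q" "us = map c (upper D s)"
        "upper D t ! 0 = lower D s ! 0" "0 < length (lower D s)"
        "set (upper D s) \<subseteq> {w \<in> wires D. dep w < k}"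
        using source[OF pos] by blast
      have "length (lower D s) = length (upper D t)"
        using s(2) unfolding kind_def by (auto dest: map_eq_imp_length_eq)
      moreover have "upper D t ! j = lower D s ! j" if j: "j < length (upper D t)" for j
      proof -
        obtain s' where s': "s' \<in> transistors D" "us = map c (upper D s')"
          "upper D t ! j = lower D s' ! j" "set (upper D s') \<subseteq> {w \<in> wires D. dep w < k}"
          using source[OF j] by blast
        have "s' = s" using same[OF s'(1) s(1) s'(4) s(6)] s'(2) s(3) by simp
        then show ?thesis using s' by simp
      qed
      ultimately have eq: "upper D t = lower D s" by (intro nth_equalityI) auto
      have "(t, s) \<in> precedes D"
        unfolding precedes_def using t s(1,4,5) pos attached_subset(2)[OF bot t] eq
        by (auto intro!: bexI[of _ "upper D t ! 0"])
      moreover have "map (label D) (upper D s) = map (label D) (lower D t)"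
        using s(2) unfolding kind_def by simp
      ultimately have "dipole D t s" using eq unfolding dipole_def by blast
      then show False using free unfolding dipole_free_def by blast
    qed
    have "inj_on c {w \<in> wires D. dep w < Suc k}"
    proof (rule inj_onI)
      fix v w assume v: "v \<in> {w \<in> wires D. dep w < Suc k}" and w: "w \<in> {w \<in> wires D. dep w < Suc k}"
        and eq: "c v = c w"
      \<comment> \<open>The outermost constructor of a colour tells whether the wire starts at the
        frame, and otherwise gives the kind of the transistor, the position on it and its input
        colours.\<close>
      have origin: "x \<in> set (frame_top D) \<or> (\<exists>t j. t \<in> transistors D \<and> j < length (lower D t) \<and>
          x = lower D t ! j \<and> c x = Out (kind D t) j (map c (upper D t)) \<and>
          set (upper D t) \<subseteq> {w \<in> wires D. dep w < k})" if x: "x \<in> {w \<in> wires D. dep w < Suc k}" for x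
      proof -
        have "x \<in> wires D" "dep x < Suc k" using x by auto
        from top this(1) show ?thesis
        proof (cases rule: attached_cases)
          case (2 t)
          then obtain j where "j < length (lower D t)" "x = lower D t ! j" by (metis in_set_conv_nth)
          then show ?thesis
            using out_colour[OF 2(1) outk'[OF 2(1,2)]] up[OF 2(1,2)] 2(1) \<open>dep x < Suc k\<close> by blast
        qed blast
      qed
      show "v = w"
      proof (cases "v \<in> set (frame_top D)")
        case True
        then obtain i where "c v = Var i" using top_colour by blast
        then have "w \<in> set (frame_top D)" using origin[OF w] eq by auto
        then show ?thesis using inj_onD[OF inj_top eq True] by blast
      next
        case False
        then obtain t j where t: "t \<in> transistors D" "v = lower D t ! j"
          "c v = Out (kind D t) j (map c (upper D t))" "set (upper D t) \<subseteq> {w \<in> wires D. dep w < k}"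
          using origin[OF v] by blast
        then have "w \<notin> set (frame_top D)" using top_colour eq by force
        then obtain s i where s: "s \<in> transistors D" "w = lower D s ! i"
          "c w = Out (kind D s) i (map c (upper D s))" "set (upper D s) \<subseteq> {w \<in> wires D. dep w < k}"
          using origin[OF w] by blast
        have "map c (upper D t) = map c (upper D s)" "j = i" using t(3) s(3) eq by auto
        then show ?thesis using same[OF t(1) s(1) t(4) s(4)] t(2) s(2) by simp
      qed
    qed
    then show ?case using outk' by blast
  qed simp
  show "inj_on c (wires D)"
  proof (rule inj_onI)
    fix v w assume "v \<in> wires D" "w \<in> wires D" "c v = c w"
    then show "v = w"
      using main[of "Suc (max (dep v) (dep w))"] by (auto dest!: inj_onD simp: less_Suc_eq_le)
  qed
  fix t assume t: "t \<in> transistors D"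
  have "hd (lower D t) \<in> set (lower D t)" using kind_nonempty(2)[OF D t] by simp
  then show "(kind D t, map c (upper D t)) \<in> outward"
    using main[of "Suc (dep (hd (lower D t)))"] t unfolding out_def by blast
qed

text \<open>The outputs of a bottommost transistor, one of maximal rank, end at the bottom of the
  frame, where all colours are variables; but an outward gate colours its outputs by
  \<open>Out\<close> terms.\<close>

lemma no_transistors:
  assumes D: "diagram D" and free: "dipole_free D"
    and c: "colouring D c" "map c (frame_top D) = vars" "map c (frame_bot D) = vars"
  shows "transistors D = {}"
proof (rule ccontr)
  assume ne: "transistors D \<noteq> {}"
  have bot: "attached (frame_bot D) (upper D) (transistors D) (wires D)"
    and top: "attached (frame_top D) (lower D) (transistors D) (wires D)"
    and fin: "finite (transistors D)"
    using D unfolding diagram_iff by auto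
  obtain rk :: "nat \<Rightarrow> nat" where rk: "\<And>t s. (t, s) \<in> precedes D \<Longrightarrow> rk s < rk t"
    using rank_exists[OF D] by blast
  define t where "t = arg_max_on rk (transistors D)"
  have t: "t \<in> transistors D" "\<And>s. s \<in> transistors D \<Longrightarrow> rk s \<le> rk t"
  proof -
    have "finite (rk ` transistors D)" using fin by simp
    then obtain s where s: "s \<in> transistors D" "rk s = Max (rk ` transistors D)"
      using Max_in ne by (metis (no_types, lifting) empty_is_image imageE)
    then have "is_arg_max rk (\<lambda>x. x \<in> transistors D) s"
      using fin by (simp add: is_arg_max_linorder)
    then have "is_arg_max rk (\<lambda>x. x \<in> transistors D) t"
      unfolding t_def arg_max_on_def arg_max_def by (rule someI)
    then show "t \<in> transistors D" "\<And>s. s \<in> transistors D \<Longrightarrow> rk s \<le> rk t"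
      by (auto simp: is_arg_max_linorder)
  qed
  define v where "v = lower D t ! 0"
  have pos: "0 < length (lower D t)" using kind_nonempty(2)[OF D t(1)] by simp
  then have v: "v \<in> set (lower D t)" unfolding v_def by simp
  then have "v \<in> wires D" using attached_subset(2)[OF top t(1)] by blast
  with bot have "v \<in> set (frame_bot D)"
  proof (cases rule: attached_cases)
    case (2 s)
    then have "(s, t) \<in> precedes D" using t v \<open>v \<in> wires D\<close> unfolding precedes_def by blast
    then show ?thesis using rk t(2)[OF 2(1)] by fastforce
  qed
  then have "c v \<in> set vars" using c(3) by (metis image_eqI list.set_map)
  moreover have "(kind D t, map c (upper D t)) \<in> outward"
    using dipole_free_colouring(2)[OF D free c(1,2) t(1)] .
  then have "map c (lower D t) = outs (kind D t) (map c (upper D t))"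
    using gate_outward c(1) t(1) unfolding colouring_def by metis
  then have "c v = Out (kind D t) 0 (map c (upper D t))"
    using pos unfolding v_def by (metis in_set_outs length_map nth_map nth_outs length_outs)
  ultimately show False unfolding set_vars by auto
qed

text \<open>Without transistors every wire runs from the top to the bottom of the frame, and the
  colours are distinct variables. Matching wires by colour therefore respects both sides of the
  frame at once, and the common top word gives the labels.\<close>

lemma trivial_iso:
  assumes D: "diagram D" "dipole_free D" "computes D vars vars"
    and E: "diagram E" "dipole_free E" "computes E vars vars"
    and word: "top_word D = top_word E"
  shows "diagram_iso D E"
proof -
  obtain c where c: "colouring D c" "map c (frame_top D) = vars" "map c (frame_bot D) = vars"
    using D unfolding computes_def by blast
  obtain d where d: "colouring E d" "map d (frame_top E) = vars" "map d (frame_bot E) = vars"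
    using E unfolding computes_def by blast
  have T: "transistors D = {}" "transistors E = {}"
    using no_transistors D(1,2) E(1,2) c d by blast+
  have W: "set (frame_top D) = wires D" "set (frame_bot D) = wires D"
    "set (frame_top E) = wires E" "set (frame_bot E) = wires E"
    using D(1) E(1) T unfolding diagram_iff attached_def by auto
  have inj: "inj_on c (wires D)" "inj_on d (wires E)"
    using dipole_free_colouring(1) D(1,2) E(1,2) c d by blast+
  have im: "c ` wires D = set vars" "d ` wires E = set vars"
    using c(2) d(2) W by (metis list.set_map)+
  define f where "f w = inv_into (wires E) d (c w)" for w
  have df: "d (f w) = c w" "f w \<in> wires E" if "w \<in> wires D" for w
    using that im unfolding f_def by (metis f_inv_into_f imageI inv_into_into)+
  have lists: "ys = map f xs" if "map c xs = map d ys" "set xs \<subseteq> wires D" "set ys \<subseteq> wires E" for xs ys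
  proof -
    have "map d ys = map d (map f xs)" unfolding that(1)[symmetric] using df that(2) by auto
    moreover have "set ys \<union> set (map f xs) \<subseteq> wires E" using df that by auto
    then have "inj_on d (set ys \<union> set (map f xs))" using inj(2) by (rule inj_on_subset[rotated])
    ultimately show ?thesis using inj_on_map_eq_map by blast
  qed
  have tops: "frame_top E = map f (frame_top D)" "frame_bot E = map f (frame_bot D)"
    using lists c d W by auto
  have "inj_on f (wires D)"
    using inj(1) df by (metis (no_types, lifting) inj_on_def)
  moreover have "f ` wires D = wires E" using tops(1) W by (metis list.set_map)
  ultimately have f: "bij_betw f (wires D) (wires E)" unfolding bij_betw_def by blast
  have "map (label E) (map f (frame_top D)) = map (label D) (frame_top D)"
    using word unfolding top_word_def tops(1) by simp
  then have "label E (f w) = label D w" if "w \<in> wires D" for w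
    using that W(1) by auto
  then show ?thesis
    unfolding diagram_iso_def using f T tops by (intro exI[of _ f] exI[of _ id]) auto
qed

section \<open>From classes of diagrams to endomorphisms\<close>

lemma equal_mod_dipoles_computes:
  assumes D: "diagram D" "frame_top D \<noteq> []" and E: "diagram E" "frame_top E \<noteq> []"
    and eq: "equal_mod_dipoles D E"
    and comp: "computes D xs ys"
  shows "computes E xs ys"
proof -
  obtain D' E' where r: "dipole_reduction\<^sup>*\<^sup>* D D'" "dipole_reduction\<^sup>*\<^sup>* E E'" "diagram_iso D' E'"
    using eq unfolding equal_mod_dipoles_def by blast
  have D': "diagram D'" "frame_top D' = frame_top D" "computes D' xs ys"
    using reductions[OF r(1) D] comp by auto
  have E': "diagram E'" "frame_top E' = frame_top E" "\<And>zs. computes E xs zs \<Longrightarrow> computes E' xs zs"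
    using reductions[OF r(2) E] by auto
  have "length (frame_top E') = length (frame_top D')"
    using r(3) unfolding diagram_iso_def by auto
  moreover have "length xs = length (frame_top D)" "set xs \<subseteq> reduced"
  proof -
    obtain c where c: "colouring D c" "map c (frame_top D) = xs" using comp unfolding computes_def by blast
    moreover have "set (frame_top D) \<subseteq> wires D"
      using D(1) attached_subset(1) unfolding diagram_iff by blast
    ultimately have "c ` set (frame_top D) \<subseteq> reduced" unfolding colouring_def by blast
    then show "length xs = length (frame_top D)" "set xs \<subseteq> reduced" using c(2) by auto
  qed
  \<comment> \<open>\<open>reductions\<close> transports computations only forwards. So some output
    \<open>zs\<close> of \<open>E\<close> is taken from totality, carried to \<open>D'\<close>
    through \<open>E'\<close>, and identified there with \<open>ys\<close>.\<close>
  ultimately obtain zs where zs: "computes E xs zs"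
    using computes_total[OF E(1)] E'(2) D'(2) by metis
  then have "computes D' xs zs" using computes_iso[OF D'(1) r(3)] E'(3) by blast
  then show ?thesis using computes_fun[OF D'(1) D'(3)] zs by blast
qed

lemma equal_mod_dipoles_refl:
  assumes "diagram D" "frame_top D \<noteq> []"
  shows "equal_mod_dipoles D D"
proof -
  obtain E where "dipole_reduction\<^sup>*\<^sup>* D E" "dipole_free E" using dipole_free_exists assms by blast
  moreover have "diagram_iso E E" unfolding diagram_iso_def by (intro exI[of _ id]) simp
  ultimately show ?thesis unfolding equal_mod_dipoles_def by blast
qed

lemma equal_mod_dipoles_identity:
  assumes D: "diagram D" "frame_top D \<noteq> []" "computes D vars vars"
    and E: "diagram E" "frame_top E \<noteq> []" "computes E vars vars"
    and word: "top_word D = top_word E"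
  shows "equal_mod_dipoles D E"
proof -
  obtain D' where D': "dipole_reduction\<^sup>*\<^sup>* D D'" "dipole_free D'" using dipole_free_exists D by blast
  obtain E' where E': "dipole_reduction\<^sup>*\<^sup>* E E'" "dipole_free E'" using dipole_free_exists E by blast
  have "diagram_iso D' E'"
    using reductions[OF D'(1) D(1,2)] reductions[OF E'(1) E(1,2)] D' E' D(3) E(3) word
    by (intro trivial_iso) auto
  then show ?thesis using D' E' unfolding equal_mod_dipoles_def by blast
qed

text \<open>\<open>x\<close> acts by substituting for variable \<open>i\<close> the output
  \<open>i\<close> of a diagram representing \<open>\<phi> x\<close>. When \<open>E\<close> is
  stacked above \<open>F\<close>, the outputs of \<open>E\<close> are fed into \<open>F\<close>, so
  the substitution of \<open>E\<close> is applied last and products keep their order. Only the unit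
  acts trivially, since the diagrams computing the identity form a single class.\<close>

lemma representation:
  assumes G: "group G" and \<phi>: "\<phi> \<in> mon G (braided_diagram_group S R w)"
    and w: "w \<noteq> []" "length w = n"
  obtains A where "\<And>x. x \<in> carrier G \<Longrightarrow> endo (A x)"
    "\<And>x y t. x \<in> carrier G \<Longrightarrow> y \<in> carrier G \<Longrightarrow> t \<in> reduced \<Longrightarrow> A (x \<otimes>\<^bsub>G\<^esub> y) t = A x (A y t)"
    "\<And>t. t \<in> reduced \<Longrightarrow> A \<one>\<^bsub>G\<^esub> t = t"
    "\<And>x. x \<in> carrier G \<Longrightarrow> (\<And>t. t \<in> reduced \<Longrightarrow> A x t = t) \<Longrightarrow> x = \<one>\<^bsub>G\<^esub>"
proof -
  interpret G: group G by fact
  let ?B = "braided_diagram_group S R w"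
  let ?L = "diagrams_from_to S R w w"
  have L: "diagram D" "frame_top D \<noteq> []" "length (frame_top D) = n" "length (frame_bot D) = n"
    "top_word D = w" "bot_word D = w" if "D \<in> ?L" for D
    using that w unfolding diagrams_from_to_def top_word_def bot_word_def by (auto dest: map_eq_imp_length_eq)
  have hom: "\<phi> x \<in> carrier ?B" "\<phi> (x \<otimes>\<^bsub>G\<^esub> y) = \<phi> x \<otimes>\<^bsub>?B\<^esub> \<phi> y"
    if "x \<in> carrier G" "y \<in> carrier G" for x y
    using \<phi> that unfolding mon_def hom_def by auto
  have "\<exists>D\<in>?L. \<phi> x = dipole_class S R w D" if "x \<in> carrier G" for x
    using hom(1)[OF that that] unfolding braided_diagram_group_def by auto
  then obtain D where D: "\<And>x. x \<in> carrier G \<Longrightarrow> D x \<in> ?L"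
    "\<And>x. x \<in> carrier G \<Longrightarrow> \<phi> x = dipole_class S R w (D x)" by metis
  have "\<exists>ys. computes (D x) vars ys" if "x \<in> carrier G" for x
    using computes_total[OF L(1)[OF D(1)[OF that]] _ vars_reduced] L(3)[OF D(1)[OF that]] by simp
  then obtain Y where Y: "\<And>x. x \<in> carrier G \<Longrightarrow> computes (D x) vars (Y x)" by metis
  have member: "E \<in> ?L \<and> equal_mod_dipoles (D x) E" if "x \<in> carrier G" "E \<in> \<phi> x" for x E
    using that D(2) unfolding dipole_class_def by auto
  have compE: "computes E vars (Y x)" if "x \<in> carrier G" "E \<in> \<phi> x" for x E
    using equal_mod_dipoles_computes[OF L(1,2)[OF D(1)] L(1,2)] member that Y by blast
  have own: "D x \<in> \<phi> x" if "x \<in> carrier G" for x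
    using D that equal_mod_dipoles_refl L(1,2) unfolding dipole_class_def by auto
  have Yred: "length (Y x) = n" "set (Y x) \<subseteq> reduced" if "x \<in> carrier G" for x
    using computes_reduced[OF L(1)[OF D(1)] Y] that L(4)[OF D(1)] by auto
  define A where "A x = subst (\<lambda>i. Y x ! i)" for x
  have A_var: "A x (Var i) = Y x ! i" for x i unfolding A_def by simp
  have endoA: "endo (A x)" if "x \<in> carrier G" for x
    unfolding A_def using Yred[OF that] by (intro endo_subst) (metis nth_mem subset_iff)
  have A_vars: "map (A x) vars = Y x" if "x \<in> carrier G" for x
    using Yred(1)[OF that] A_var by (intro nth_equalityI) auto
  have A_mult: "A (x \<otimes>\<^bsub>G\<^esub> y) t = A x (A y t)" if x: "x \<in> carrier G" "y \<in> carrier G" and t: "t \<in> reduced" for x y t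
  proof -
    have xy: "x \<otimes>\<^bsub>G\<^esub> y \<in> carrier G" using x by simp
    have "D (x \<otimes>\<^bsub>G\<^esub> y) \<in> \<phi> x \<otimes>\<^bsub>?B\<^esub> \<phi> y" using own[OF xy] hom(2)[OF x] by simp
    then obtain E F where EF: "E \<in> \<phi> x" "F \<in> \<phi> y"
      "equal_mod_dipoles (concatenation E F) (D (x \<otimes>\<^bsub>G\<^esub> y))"
      unfolding braided_diagram_group_def dipole_class_def by auto
    have EL: "E \<in> ?L" "F \<in> ?L" using member EF x by blast+
    have glue: "bot_word E = top_word F" using L(5,6) EL by simp
    have "computes F (map (A x) vars) (map (A x) (Y y))"
      using computes_endo[OF L(1)[OF EL(2)] compE[OF x(2) EF(2)] endoA[OF x(1)]] .
    then have cat: "computes (concatenation E F) vars (map (A x) (Y y))"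
      using computes_concatenation[OF L(1)[OF EL(1)] L(1)[OF EL(2)] glue compE[OF x(1) EF(1)]]
      by (simp add: A_vars[OF x(1)])
    have "top_word (concatenation E F) = w"
      using word_concatenation[OF L(1)[OF EL(1)] L(1)[OF EL(2)] glue] L(5)[OF EL(1)] by simp
    then have "frame_top (concatenation E F) \<noteq> []" using w unfolding top_word_def by auto
    then have "computes (D (x \<otimes>\<^bsub>G\<^esub> y)) vars (map (A x) (Y y))"
      using equal_mod_dipoles_computes[OF diagram_concatenation[OF L(1)[OF EL(1)] L(1)[OF EL(2)] glue] _
        L(1,2)[OF D(1)[OF xy]] EF(3) cat] by blast
    then have "Y (x \<otimes>\<^bsub>G\<^esub> y) = map (A x) (Y y)"
      using computes_fun[OF L(1)[OF D(1)[OF xy]] Y[OF xy]] by blast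
    then have "A (x \<otimes>\<^bsub>G\<^esub> y) (Var i) = (A x \<circ> A y) (Var i)" if "i < n" for i
      using that Yred(1)[OF x(2)] A_var by simp
    then have "A (x \<otimes>\<^bsub>G\<^esub> y) t = (A x \<circ> A y) t"
      using endo_eqI[OF endoA[OF xy] endo_comp[OF endoA[OF x(1)] endoA[OF x(2)]]] t by blast
    then show ?thesis by simp
  qed
  \<comment> \<open>The endomorphism of the unit is idempotent, so the diagram chosen for the unit
    sends both \<open>vars\<close> and its own output tuple to that tuple;
    \<open>computes_inj\<close> makes the two inputs equal.\<close>
  have one: "Y \<one>\<^bsub>G\<^esub> = vars"
  proof -
    have "map (A \<one>\<^bsub>G\<^esub>) (Y \<one>\<^bsub>G\<^esub>) = map (\<lambda>t. A \<one>\<^bsub>G\<^esub> (A \<one>\<^bsub>G\<^esub> t)) vars"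
      unfolding A_vars[OF G.one_closed, symmetric] by simp
    also have "\<dots> = map (A \<one>\<^bsub>G\<^esub>) vars"
      using A_mult[OF G.one_closed G.one_closed] vars_reduced by auto
    finally have "map (A \<one>\<^bsub>G\<^esub>) (Y \<one>\<^bsub>G\<^esub>) = Y \<one>\<^bsub>G\<^esub>" using A_vars by simp
    then have "computes (D \<one>\<^bsub>G\<^esub>) (Y \<one>\<^bsub>G\<^esub>) (Y \<one>\<^bsub>G\<^esub>)"
      using computes_endo[OF L(1)[OF D(1)] Y endoA, OF G.one_closed G.one_closed G.one_closed] A_vars by simp
    then show ?thesis using computes_inj[OF L(1)[OF D(1)] _ Y] by blast
  qed
  have A_id: "A x t = t" if "Y x = vars" "x \<in> carrier G" "t \<in> reduced" for x t
    using endo_eqI[OF endoA[OF that(2)] endo_id _ that(3)] that(1) A_var by simp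
  have faithful: "x = \<one>\<^bsub>G\<^esub>" if x: "x \<in> carrier G" and id: "\<And>t. t \<in> reduced \<Longrightarrow> A x t = t" for x
  proof -
    have "map (A x) vars = vars" by (rule map_idI) (use id vars_reduced in blast)
    then have "Y x = vars" using A_vars[OF x] by simp
    \<comment> \<open>The right-hand side does not mention \<open>y\<close>, so \<open>x\<close> and
      the unit have the same image and injectivity of \<open>\<phi>\<close> applies.\<close>
    have "\<phi> y = {E \<in> ?L. computes E vars vars}" if "y \<in> carrier G" "Y y = vars" for y
    proof (intro equalityI subsetI)
      fix E assume "E \<in> \<phi> y"
      then show "E \<in> {E \<in> ?L. computes E vars vars}" using member compE that by force
    next
      fix E assume E: "E \<in> {E \<in> ?L. computes E vars vars}"
      then have EL: "E \<in> ?L" "computes E vars vars" by auto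
      have DL: "D y \<in> ?L" using D(1) that by blast
      have "computes (D y) vars vars" using Y[OF that(1)] that(2) by simp
      then have "equal_mod_dipoles (D y) E"
        using equal_mod_dipoles_identity[OF L(1,2)[OF DL] _ L(1,2)[OF EL(1)] EL(2)] L(5)[OF DL] L(5)[OF EL(1)]
        by simp
      then show "E \<in> \<phi> y" using D(2)[OF that(1)] EL(1) unfolding dipole_class_def by simp
    qed
    from this[OF x \<open>Y x = vars\<close>] this[OF G.one_closed one] have "\<phi> x = \<phi> \<one>\<^bsub>G\<^esub>" by simp
    then show ?thesis using \<phi> x G.one_closed unfolding mon_def by (auto dest: inj_onD)
  qed
  show thesis
    by (rule that[of A]) (use endoA A_mult A_id[OF one] faithful in auto)
qed

theorem divisible_imp_torsion_group:
  assumes G: "group G" and \<phi>: "\<phi> \<in> mon G (braided_diagram_group S R w)"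
    and w: "w \<noteq> []" "length w = n"
    and z: "z \<in> carrier G"
    and roots: "\<And>N. \<exists>N'>N. \<exists>h\<in>carrier G. h [^]\<^bsub>G\<^esub> (N'::nat) = z"
  shows "\<exists>p>0. z [^]\<^bsub>G\<^esub> (p::nat) = \<one>\<^bsub>G\<^esub>"
proof -
  interpret G: group G by fact
  obtain A where A: "\<And>x. x \<in> carrier G \<Longrightarrow> endo (A x)"
    "\<And>x y t. x \<in> carrier G \<Longrightarrow> y \<in> carrier G \<Longrightarrow> t \<in> reduced \<Longrightarrow> A (x \<otimes>\<^bsub>G\<^esub> y) t = A x (A y t)"
    "\<And>t. t \<in> reduced \<Longrightarrow> A \<one>\<^bsub>G\<^esub> t = t"
    "\<And>x. x \<in> carrier G \<Longrightarrow> (\<And>t. t \<in> reduced \<Longrightarrow> A x t = t) \<Longrightarrow> x = \<one>\<^bsub>G\<^esub>"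
    using representation[OF G \<phi> w] by blast
  have action: "aut_action (\<lambda>k::int. A (x [^]\<^bsub>G\<^esub> k))" if x: "x \<in> carrier G" for x
    unfolding aut_action_def
  proof (intro conjI allI)
    show "endo (A (x [^]\<^bsub>G\<^esub> k))" for k :: int using A(1) x by simp
    show "int_action reduced (\<lambda>k::int. A (x [^]\<^bsub>G\<^esub> k))"
    proof
      fix t j and k :: int assume t: "t \<in> reduced"
      show "A (x [^]\<^bsub>G\<^esub> k) t \<in> reduced" using A(1) x t unfolding endo_def by blast
      show "A (x [^]\<^bsub>G\<^esub> (0::int)) t = t" using A(3) t by simp
      show "A (x [^]\<^bsub>G\<^esub> (j + k)) t = A (x [^]\<^bsub>G\<^esub> j) (A (x [^]\<^bsub>G\<^esub> k) t)"
        using A(2) x t by (simp add: G.int_pow_mult)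
    qed
  qed
  have "\<exists>p>0. \<forall>t\<in>reduced. A (z [^]\<^bsub>G\<^esub> (p::int)) t = t"
  proof (rule divisible_imp_torsion[OF action[OF z]])
    fix N :: nat
    obtain N' h where h: "N' > N" "h \<in> carrier G" "h [^]\<^bsub>G\<^esub> N' = z" using roots by blast
    have "h [^]\<^bsub>G\<^esub> (int N' * k) = z [^]\<^bsub>G\<^esub> k" for k
      using G.int_pow_pow[OF h(2), of "int N'" k] h(3) by (simp add: int_pow_int)
    then show "\<exists>N'>N. \<exists>b. aut_action b \<and> (\<forall>k. \<forall>t\<in>reduced. b (int N' * k) t = A (z [^]\<^bsub>G\<^esub> k) t)"
      using action[OF h(2)] h(1) by (intro exI[of _ N'] conjI exI[of _ "\<lambda>k::int. A (h [^]\<^bsub>G\<^esub> k)"]) auto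
  qed
  then obtain p :: int where p: "p > 0" "\<And>t. t \<in> reduced \<Longrightarrow> A (z [^]\<^bsub>G\<^esub> p) t = t" by blast
  then have "z [^]\<^bsub>G\<^esub> p = \<one>\<^bsub>G\<^esub>" using A(4) z by simp
  moreover obtain q where "p = int q" "q > 0" using p(1) by (metis pos_int_cases)
  ultimately show ?thesis by (metis int_pow_int)
qed

end


section \<open>Divisible elements of the Brin--Thompson groups\<close>

lemma cantor_power_space: "topspace (cantor_power n) = extensional {..<n}"
  unfolding cantor_power_def cantor_topology_def by (simp add: PiE_def)

abbreviation points :: "nat \<Rightarrow> (nat \<Rightarrow> nat \<Rightarrow> bool) set" where
  "points n \<equiv> extensional {..<n}"

lemma prepend_append: "prepend (u @ v) x = prepend u (prepend v x)"
  unfolding prepend_def by (auto simp: nth_append fun_eq_iff)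

lemma brick_map_points: "brick_map n u x \<in> points n"
  unfolding brick_map_def by simp

lemma brick_map_append: "brick_map n (\<lambda>i. u i @ v i) x = brick_map n u (brick_map n v x)"
  unfolding brick_map_def by (auto simp: prepend_append)

lemma brick_map_cong: "(\<And>i. i < n \<Longrightarrow> u i = v i) \<Longrightarrow> brick_map n u x = brick_map n v x"
  unfolding brick_map_def by auto

text \<open>A form of the defining condition of \<open>nV\<close> in which a single depth replaces
  the partitions, so that composing two maps amounts to adding their depths.\<close>

definition prefix_local :: "nat \<Rightarrow> ((nat \<Rightarrow> nat \<Rightarrow> bool) \<Rightarrow> (nat \<Rightarrow> nat \<Rightarrow> bool)) \<Rightarrow> bool" where
  "prefix_local n f \<longleftrightarrow> (\<exists>d. \<forall>u. (\<forall>i<n. d \<le> length (u i)) \<longrightarrow>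
     (\<exists>v. \<forall>x\<in>points n. f (brick_map n u x) = brick_map n v x))"

lemma prefix_local_cong:
  "(\<And>x. x \<in> points n \<Longrightarrow> f x = g x) \<Longrightarrow> prefix_local n f \<longleftrightarrow> prefix_local n g"
  unfolding prefix_local_def using brick_map_points by simp

lemma prefix_local_id: "prefix_local n (\<lambda>x. x)"
  unfolding prefix_local_def by auto

lemma prefix_local_comp:
  assumes "prefix_local n f" "prefix_local n g"
  shows "prefix_local n (\<lambda>x. g (f x))"
proof -
  obtain d where d: "\<And>u. (\<forall>i<n. d \<le> length (u i)) \<Longrightarrow>
     \<exists>v. \<forall>x\<in>points n. f (brick_map n u x) = brick_map n v x"
    using assms(1) unfolding prefix_local_def by blast
  obtain e where e: "\<And>u. (\<forall>i<n. e \<le> length (u i)) \<Longrightarrow>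
     \<exists>v. \<forall>x\<in>points n. g (brick_map n u x) = brick_map n v x"
    using assms(2) unfolding prefix_local_def by blast
  have "\<exists>v. \<forall>x\<in>points n. g (f (brick_map n u x)) = brick_map n v x"
    if u: "\<forall>i<n. d + e \<le> length (u i)" for u
  proof -
    \<comment> \<open>\<open>f\<close> replaces only the first \<open>d\<close> letters of each
      word; the at least \<open>e\<close> remaining letters keep the new words long enough for
      \<open>g\<close>.\<close>
    have "\<forall>i<n. d \<le> length (take d (u i))" using u by auto
    from d[OF this] obtain v
      where v: "\<forall>x\<in>points n. f (brick_map n (\<lambda>i. take d (u i)) x) = brick_map n v x" by blast
    have f: "f (brick_map n u x) = brick_map n (\<lambda>i. v i @ drop d (u i)) x" for x
    proof -
      have "brick_map n u x = brick_map n (\<lambda>i. take d (u i)) (brick_map n (\<lambda>i. drop d (u i)) x)"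
        using brick_map_append[of n "\<lambda>i. take d (u i)" "\<lambda>i. drop d (u i)" x] by simp
      then have "f (brick_map n u x) = brick_map n v (brick_map n (\<lambda>i. drop d (u i)) x)"
        using v brick_map_points by metis
      then show ?thesis by (simp only: brick_map_append)
    qed
    have "\<forall>i<n. e \<le> length (v i @ drop d (u i))" using u by auto
    from e[OF this] show ?thesis unfolding f .
  qed
  then show ?thesis unfolding prefix_local_def by blast
qed

definition pre :: "nat \<Rightarrow> nat \<Rightarrow> (nat \<Rightarrow> nat \<Rightarrow> bool) \<Rightarrow> nat \<Rightarrow> bool list" where
  "pre n d x = (\<lambda>i\<in>{..<n}. map (x i) [0..<d])"

definition suf :: "nat \<Rightarrow> nat \<Rightarrow> (nat \<Rightarrow> nat \<Rightarrow> bool) \<Rightarrow> nat \<Rightarrow> nat \<Rightarrow> bool" where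
  "suf n d x = (\<lambda>i\<in>{..<n}. \<lambda>k. x i (d + k))"

lemma suf_points: "suf n d x \<in> points n"
  unfolding suf_def by simp

lemma brick_map_pre_suf:
  assumes "x \<in> points n"
  shows "brick_map n (pre n d x) (suf n d x) = x"
proof (rule extensionalityI[OF brick_map_points assms])
  fix i assume "i \<in> {..<n}"
  then show "brick_map n (pre n d x) (suf n d x) i = x i"
    unfolding brick_map_def pre_def suf_def prepend_def by (auto simp: fun_eq_iff)
qed

lemma pre_brick_map:
  assumes "\<forall>i<n. length (u i) = d" "u \<in> extensional {..<n}"
  shows "pre n d (brick_map n u x) = u"
proof (rule extensionalityI[OF _ assms(2)])
  fix i assume "i \<in> {..<n}"
  then show "pre n d (brick_map n u x) i = u i"
    using assms(1) unfolding pre_def brick_map_def prepend_def by (auto intro!: nth_equalityI)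
qed (simp add: pre_def)

lemma dyadic_brick_image: "dyadic_brick n u = brick_map n u ` points n"
proof
  show "dyadic_brick n u \<subseteq> brick_map n u ` points n"
  proof
    fix x assume x: "x \<in> dyadic_brick n u"
    then have "\<forall>i. \<exists>y. i < n \<longrightarrow> x i = prepend (u i) y" unfolding dyadic_brick_def by (auto simp: PiE_iff)
    then obtain y where y: "\<And>i. i < n \<Longrightarrow> x i = prepend (u i) (y i)" by metis
    have "x = brick_map n u (restrict y {..<n})"
    proof (rule extensionalityI[OF _ brick_map_points])
      show "x \<in> extensional {..<n}" using x unfolding dyadic_brick_def by (simp add: PiE_iff)
      fix i assume "i \<in> {..<n}"
      then show "x i = brick_map n u (restrict y {..<n}) i" using y unfolding brick_map_def by simp
    qed
    then show "x \<in> brick_map n u ` points n" by (metis imageI restrict_extensional)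
  qed
  show "brick_map n u ` points n \<subseteq> dyadic_brick n u"
    unfolding dyadic_brick_def brick_map_def by auto
qed

lemma openin_agree:
  fixes x :: "nat \<Rightarrow> nat \<Rightarrow> bool"
  shows "openin (cantor_power n) {y \<in> points n. \<forall>i<n. \<forall>k<l. y i k = x i k}"
proof -
  let ?X = "cantor_power n"
  have coord: "openin ?X {y \<in> points n. y i k = b}" if "i < n" for i k b
  proof -
    have "continuous_map ?X cantor_topology (\<lambda>y. y i)"
      unfolding cantor_power_def using that by (intro continuous_map_product_projection) simp
    moreover have "continuous_map cantor_topology (discrete_topology UNIV) (\<lambda>z. z k)"
      unfolding cantor_topology_def by (intro continuous_map_product_projection) simp
    ultimately have "continuous_map ?X (discrete_topology UNIV) (\<lambda>y. y i k)"
      using continuous_map_compose[of ?X cantor_topology "\<lambda>y. y i" "discrete_topology UNIV" "\<lambda>z. z k"]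
      by (simp add: comp_def)
    then have "openin ?X {y \<in> topspace ?X. y i k \<in> {b}}"
      by (rule openin_continuous_map_preimage) simp
    then show ?thesis by (simp add: cantor_power_space)
  qed
  have "openin ?X {y \<in> points n. \<forall>p\<in>F. y (fst p) (snd p) = x (fst p) (snd p)}"
    if "finite F" "F \<subseteq> {..<n} \<times> {..<l}" for F
    using that
  proof (induction F)
    case empty
    then show ?case using openin_topspace[of ?X] by (simp add: cantor_power_space)
  next
    case (insert p F)
    have "{y \<in> points n. \<forall>p\<in>insert p F. y (fst p) (snd p) = x (fst p) (snd p)} =
      {y \<in> points n. y (fst p) (snd p) = x (fst p) (snd p)} \<inter>
      {y \<in> points n. \<forall>p\<in>F. y (fst p) (snd p) = x (fst p) (snd p)}" by auto
    then show ?case using insert coord[of "fst p"] by auto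
  qed
  from this[of "{..<n} \<times> {..<l}"]
  have "openin ?X {y \<in> points n. \<forall>p\<in>{..<n} \<times> {..<l}. y (fst p) (snd p) = x (fst p) (snd p)}" by simp
  moreover have "{y \<in> points n. \<forall>p\<in>{..<n} \<times> {..<l}. y (fst p) (snd p) = x (fst p) (snd p)} =
    {y \<in> points n. \<forall>i<n. \<forall>k<l. y i k = x i k}" by auto
  ultimately show ?thesis by simp
qed

lemma prefix_local_continuous:
  assumes loc: "prefix_local n f" and f: "f \<in> points n \<rightarrow> points n"
  shows "continuous_map (cantor_power n) (cantor_power n) f"
proof -
  let ?X = "cantor_power n"
  obtain d where d: "\<And>u. (\<forall>i<n. d \<le> length (u i)) \<Longrightarrow>
     \<exists>v. \<forall>x\<in>points n. f (brick_map n u x) = brick_map n v x"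
    using loc unfolding prefix_local_def by blast
  \<comment> \<open>Letter \<open>j\<close> of an output coordinate either belongs to the new
    prefix, which the first \<open>d\<close> letters of the inputs determine, or is an input letter
    at a position of at most \<open>d + j\<close>.\<close>
  have agree: "f x i j = f y i j"
    if "x \<in> points n" "y \<in> points n" "i < n" and eq: "\<forall>i<n. \<forall>k<d + j + 1. y i k = x i k" for x y i j
  proof -
    have "pre n d y = pre n d x" using eq unfolding pre_def by (auto simp: fun_eq_iff)
    moreover obtain v where v: "\<forall>x'\<in>points n. f (brick_map n (pre n d x) x') = brick_map n v x'"
      using d[of "pre n d x"] unfolding pre_def by auto
    ultimately have "f x = brick_map n v (suf n d x)" "f y = brick_map n v (suf n d y)"
      using brick_map_pre_suf[OF that(1), of d] brick_map_pre_suf[OF that(2), of d] suf_points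
      by metis+
    then show ?thesis using eq \<open>i < n\<close> unfolding brick_map_def suf_def prepend_def by simp
  qed
  have "continuous_map ?X (discrete_topology UNIV) (\<lambda>x. f x i j)" if i: "i < n" for i j
    unfolding continuous_map_def
  proof (intro conjI allI impI)
    fix U :: "bool set"
    show "openin ?X {x \<in> topspace ?X. f x i j \<in> U}"
    proof (subst openin_subopen, intro ballI)
      fix x assume x: "x \<in> {x \<in> topspace ?X. f x i j \<in> U}"
      let ?N = "{y \<in> points n. \<forall>i<n. \<forall>k<d + j + 1. y i k = x i k}"
      have "x \<in> points n" "f x i j \<in> U" using x by (auto simp: cantor_power_space)
      then have "f y i j \<in> U" if "y \<in> ?N" for y
        using agree[of x y i j] i that by auto
      then have "?N \<subseteq> {x \<in> topspace ?X. f x i j \<in> U}"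
        unfolding cantor_power_space by blast
      then show "\<exists>T. openin ?X T \<and> x \<in> T \<and> T \<subseteq> {x \<in> topspace ?X. f x i j \<in> U}"
        using openin_agree[of n "d + j + 1" x] x by (intro exI[of _ ?N]) (simp add: cantor_power_space)
    qed
  qed simp
  then have "continuous_map ?X cantor_topology (\<lambda>x. f x i)" if "i < n" for i
    unfolding cantor_topology_def using that by (simp add: continuous_map_componentwise_UNIV)
  moreover have "f ` topspace ?X \<subseteq> extensional {..<n}" using f by (auto simp: cantor_power_space)
  ultimately show ?thesis
    unfolding cantor_power_def[of n] continuous_map_componentwise
    unfolding cantor_power_def[symmetric] by auto
qed

section \<open>A group of prefix-local bijections inside \<open>nV\<close>\<close>

definition prefix_group :: "nat \<Rightarrow> ((nat \<Rightarrow> nat \<Rightarrow> bool) \<Rightarrow> (nat \<Rightarrow> nat \<Rightarrow> bool)) set" where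
  "prefix_group n = {f \<in> extensional (points n). f \<in> points n \<rightarrow> points n \<and> prefix_local n f \<and>
     (\<exists>g. g \<in> points n \<rightarrow> points n \<and> prefix_local n g \<and>
       (\<forall>x\<in>points n. g (f x) = x \<and> f (g x) = x))}"

lemma prefix_groupI:
  assumes "f \<in> extensional (points n)" "f \<in> points n \<rightarrow> points n" "prefix_local n f"
    "g \<in> points n \<rightarrow> points n" "prefix_local n g"
    "\<And>x. x \<in> points n \<Longrightarrow> g (f x) = x" "\<And>x. x \<in> points n \<Longrightarrow> f (g x) = x"
  shows "f \<in> prefix_group n"
  using assms unfolding prefix_group_def by blast

lemma prefix_groupE:
  assumes "f \<in> prefix_group n"
  obtains g where "f \<in> extensional (points n)" "f \<in> points n \<rightarrow> points n" "prefix_local n f"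
    "g \<in> points n \<rightarrow> points n" "prefix_local n g"
    "\<And>x. x \<in> points n \<Longrightarrow> g (f x) = x" "\<And>x. x \<in> points n \<Longrightarrow> f (g x) = x"
  using assms unfolding prefix_group_def by blast

lemma prefix_group_Bij: "f \<in> prefix_group n \<Longrightarrow> f \<in> Bij (points n)"
proof (elim prefix_groupE)
  fix g assume *: "f \<in> extensional (points n)" "f \<in> points n \<rightarrow> points n" "g \<in> points n \<rightarrow> points n"
    "\<And>x. x \<in> points n \<Longrightarrow> g (f x) = x" "\<And>x. x \<in> points n \<Longrightarrow> f (g x) = x"
  then have "bij_betw f (points n) (points n)" by (intro bij_betw_byWitness[of _ g]) auto
  then show "f \<in> Bij (points n)" using * unfolding Bij_def by simp
qed

lemma prefix_group_subgroup: "subgroup (prefix_group n) (BijGroup (points n))"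
proof (rule group.subgroupI[OF group_BijGroup])
  let ?G = "BijGroup (points n)"
  show "prefix_group n \<subseteq> carrier ?G" using prefix_group_Bij unfolding BijGroup_def by auto
  have "(\<lambda>x\<in>points n. x) \<in> prefix_group n"
    using prefix_local_id prefix_local_cong[of n "\<lambda>x\<in>points n. x" "\<lambda>x. x"]
    by (intro prefix_groupI[of _ _ "\<lambda>x. x"]) auto
  then show "prefix_group n \<noteq> {}" by blast
  fix f assume f: "f \<in> prefix_group n"
  obtain f' where f': "f \<in> extensional (points n)" "f \<in> points n \<rightarrow> points n" "prefix_local n f"
    "f' \<in> points n \<rightarrow> points n" "prefix_local n f'"
    "\<And>x. x \<in> points n \<Longrightarrow> f' (f x) = x" "\<And>x. x \<in> points n \<Longrightarrow> f (f' x) = x"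
    by (rule prefix_groupE[OF f]) (rule that)
  have "inj_on f (points n)" using prefix_group_Bij[OF f] unfolding Bij_def bij_betw_def by auto
  then have inv: "inv_into (points n) f x = f' x" if "x \<in> points n" for x
    using f' that by (metis PiE inv_into_f_f)
  have "inv\<^bsub>?G\<^esub> f = (\<lambda>x\<in>points n. f' x)"
    using inv by (simp add: inv_BijGroup[OF prefix_group_Bij[OF f]] cong: restrict_cong)
  moreover have "(\<lambda>x\<in>points n. f' x) \<in> prefix_group n"
    using f' prefix_local_cong[of n "\<lambda>x\<in>points n. f' x" f']
    by (intro prefix_groupI[of _ _ f]) (auto simp: Pi_iff)
  ultimately show "inv\<^bsub>?G\<^esub> f \<in> prefix_group n" by simp
  fix g assume g: "g \<in> prefix_group n"
  obtain g' where g': "g \<in> extensional (points n)" "g \<in> points n \<rightarrow> points n" "prefix_local n g"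
    "g' \<in> points n \<rightarrow> points n" "prefix_local n g'"
    "\<And>x. x \<in> points n \<Longrightarrow> g' (g x) = x" "\<And>x. x \<in> points n \<Longrightarrow> g (g' x) = x"
    by (rule prefix_groupE[OF g]) (rule that)
  have "f \<otimes>\<^bsub>?G\<^esub> g = compose (points n) f g"
    using prefix_group_Bij f g unfolding BijGroup_def by simp
  moreover have "compose (points n) f g \<in> prefix_group n"
  proof (rule prefix_groupI[of _ _ "\<lambda>x. g' (f' x)"])
    show "prefix_local n (compose (points n) f g)"
      using prefix_local_comp[OF g'(3) f'(3)] prefix_local_cong[of n "compose (points n) f g" "\<lambda>x. f (g x)"]
      by (simp add: compose_def)
    show "prefix_local n (\<lambda>x. g' (f' x))" using prefix_local_comp[OF f'(5) g'(5)] .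
  qed (use f' g' in \<open>auto simp: compose_def Pi_iff\<close>)
  ultimately show "f \<otimes>\<^bsub>?G\<^esub> g \<in> prefix_group n" by simp
qed

text \<open>At the depth \<open>d\<close> of \<open>f\<close>, the bricks whose words all have
  length exactly \<open>d\<close> partition the space. Each is carried onto a brick by prefix
  replacement, and bijectivity makes the images a partition with equally many members.\<close>

lemma prefix_group_brin_thompson: "prefix_group n \<subseteq> carrier (brin_thompson n)"
proof
  fix f assume f: "f \<in> prefix_group n"
  obtain f' where f': "f \<in> extensional (points n)" "f \<in> points n \<rightarrow> points n" "prefix_local n f"
    "f' \<in> points n \<rightarrow> points n" "prefix_local n f'"
    "\<And>x. x \<in> points n \<Longrightarrow> f' (f x) = x" "\<And>x. x \<in> points n \<Longrightarrow> f (f' x) = x"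
    by (rule prefix_groupE[OF f]) (rule that)
  have bij: "bij_betw f (points n) (points n)" using prefix_group_Bij[OF f] unfolding Bij_def by simp
  have "homeomorphic_maps (cantor_power n) (cantor_power n) f f'"
    unfolding homeomorphic_maps_def cantor_power_space
    using prefix_local_continuous f' by auto
  then have homeo: "homeomorphic_map (cantor_power n) (cantor_power n) f"
    using homeomorphic_map_maps by blast
  obtain d where d: "\<And>u. (\<forall>i<n. d \<le> length (u i)) \<Longrightarrow>
     \<exists>v. \<forall>x\<in>points n. f (brick_map n u x) = brick_map n v x"
    using f'(3) unfolding prefix_local_def by blast
  define W where "W = (\<Pi>\<^sub>E i\<in>{..<n}. {w :: bool list. length w = d})"
  have W: "u \<in> extensional {..<n}" "\<forall>i<n. length (u i) = d" if "u \<in> W" for u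
    using that unfolding W_def by (auto simp: PiE_iff)
  have pre: "pre n d x \<in> W" for x unfolding W_def pre_def by auto
  have pre_eq: "pre n d x = u" if "u \<in> W" "x \<in> dyadic_brick n u" for u x
    using that pre_brick_map[OF W(2,1)[OF that(1)]] unfolding dyadic_brick_image by auto
  define P where "P = dyadic_brick n ` W"
  define Q where "Q = (`) f ` P"
  have "finite {w :: bool list. length w = d}"
    using finite_lists_length_eq[of "UNIV :: bool set" d] by simp
  then have finP: "finite P" unfolding P_def W_def by (intro finite_imageI finite_PiE) auto
  have brick: "\<exists>v. f ` dyadic_brick n u = dyadic_brick n v \<and> (\<forall>x\<in>points n. f (brick_map n u x) = brick_map n v x)"
    if u: "u \<in> W" for u
  proof -
    obtain v where v: "\<forall>x\<in>points n. f (brick_map n u x) = brick_map n v x"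
      using d[of u] W(2)[OF u] by auto
    then have "f ` dyadic_brick n u = dyadic_brick n v"
      unfolding dyadic_brick_image image_image by (intro image_cong) auto
    then show ?thesis using v by blast
  qed
  have P: "partition_on (points n) P"
    unfolding partition_on_def
  proof (intro conjI)
    show "\<Union> P = points n"
    proof
      show "\<Union> P \<subseteq> points n" unfolding P_def dyadic_brick_image using brick_map_points by auto
      show "points n \<subseteq> \<Union> P"
      proof
        fix x assume "x \<in> points n"
        then have "x \<in> dyadic_brick n (pre n d x)"
          unfolding dyadic_brick_image using brick_map_pre_suf suf_points by (metis imageI)
        then show "x \<in> \<Union> P" unfolding P_def using pre by blast
      qed
    qed
    show "disjoint P"
    proof (rule disjointI, rule ccontr)
      fix B C assume BC: "B \<in> P" "C \<in> P" "B \<noteq> C" "B \<inter> C \<noteq> {}"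
      then obtain u v x where u: "u \<in> W" "B = dyadic_brick n u" and v: "v \<in> W" "C = dyadic_brick n v"
        and x: "x \<in> dyadic_brick n u" "x \<in> dyadic_brick n v" unfolding P_def by blast
      then show False using BC u v pre_eq by metis
    qed
    have "dyadic_brick n u \<noteq> {}" for u
    proof -
      have "restrict f {..<n} \<in> points n" for f :: "nat \<Rightarrow> nat \<Rightarrow> bool" by simp
      then show ?thesis unfolding dyadic_brick_image by blast
    qed
    then show "{} \<notin> P" unfolding P_def by auto
  qed
  then have sub: "B \<subseteq> points n" if "B \<in> P" for B using that unfolding partition_on_def by blast
  have inj: "inj_on f (points n)" and surj: "f ` points n = points n" using bij unfolding bij_betw_def by auto
  have Q: "partition_on (points n) Q"
    unfolding partition_on_def
  proof (intro conjI)
    show "\<Union> Q = points n" unfolding Q_def using P surj unfolding partition_on_def by (metis image_Union)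
    show "disjoint Q"
    proof (rule disjointI)
      fix B C assume BC: "B \<in> Q" "C \<in> Q" "B \<noteq> C"
      then obtain B' C' where *: "B' \<in> P" "B = f ` B'" "C' \<in> P" "C = f ` C'" unfolding Q_def by blast
      then have "B' \<inter> C' = {}" using P BC unfolding partition_on_def disjoint_def by blast
      then show "B \<inter> C = {}"
        using inj_on_image_Int[OF inj sub[OF *(1)] sub[OF *(3)]] * by simp
    qed
    show "{} \<notin> Q" unfolding Q_def using P unfolding partition_on_def by auto
  qed
  have "inj_on ((`) f) P" using inj sub by (intro inj_onI) (metis inj_on_image_eq_iff)
  then have card: "card P = card Q" unfolding Q_def by (simp add: card_image)
  have "Q \<subseteq> range (dyadic_brick n)" unfolding Q_def P_def using brick by blast
  then have parts: "brick_partition n P" "brick_partition n Q"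
    using P Q finP unfolding brick_partition_def cantor_power_space Q_def by (auto simp: P_def)
  have "\<forall>B\<in>P. \<exists>u v. B = dyadic_brick n u \<and> dyadic_brick n v \<in> Q \<and>
    (\<forall>x\<in>topspace (cantor_power n). f (brick_map n u x) = brick_map n v x)"
  proof
    fix B assume "B \<in> P"
    then obtain u where u: "u \<in> W" "B = dyadic_brick n u" unfolding P_def by blast
    obtain v where v: "f ` dyadic_brick n u = dyadic_brick n v"
      "\<forall>x\<in>points n. f (brick_map n u x) = brick_map n v x" using brick[OF u(1)] by blast
    then have "dyadic_brick n v \<in> Q" using \<open>B \<in> P\<close> u unfolding Q_def by (metis imageI)
    then show "\<exists>u v. B = dyadic_brick n u \<and> dyadic_brick n v \<in> Q \<and>
      (\<forall>x\<in>topspace (cantor_power n). f (brick_map n u x) = brick_map n v x)"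
      using u v unfolding cantor_power_space by blast
  qed
  then show "f \<in> carrier (brin_thompson n)"
    unfolding brin_thompson_def
    using prefix_group_Bij[OF f] homeo parts card by (auto simp: cantor_power_space)
qed

section \<open>An element of infinite order\<close>

definition shift :: "nat \<Rightarrow> (nat \<Rightarrow> bool) \<Rightarrow> nat \<Rightarrow> bool" where
  "shift k x = (\<lambda>j. x (k + j))"

lemma shift_prepend [simp]:
  "shift (Suc k) (prepend (a # w) x) = shift k (prepend w x)" "shift 0 x = x"
  "prepend [] x = x" "prepend (a # w) x 0 = a" "prepend (a # w) x (Suc k) = prepend w x k"
  unfolding shift_def prepend_def by (auto simp: fun_eq_iff)

lemma prepend_Cons: "prepend (a # w) x = prepend [a] (prepend w x)"
  using prepend_append[of "[a]" w x] by simp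

lemma prepend_shift: "prepend [x 0] (shift 1 x) = x" "prepend [x 0, x 1] (shift 2 x) = x"
proof -
  show "prepend [x 0] (shift 1 x) = x"
  proof
    show "prepend [x 0] (shift 1 x) j = x j" for j by (cases j) (auto simp: shift_def)
  qed
  show "prepend [x 0, x 1] (shift 2 x) = x"
  proof
    show "prepend [x 0, x 1] (shift 2 x) j = x j" for j
      by (cases j; cases "j - 1") (auto simp: shift_def)
  qed
qed

definition at_coord :: "nat \<Rightarrow> ((nat \<Rightarrow> bool) \<Rightarrow> nat \<Rightarrow> bool) \<Rightarrow>
    (nat \<Rightarrow> nat \<Rightarrow> bool) \<Rightarrow> nat \<Rightarrow> nat \<Rightarrow> bool" where
  "at_coord k g p = p(k := g (p k))"

text \<open>A standard generator of Thompson's group \<open>F\<close>, up to inversion: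
  \<open>1x\<close> goes to \<open>11x\<close>, \<open>01x\<close> to \<open>10x\<close> and
  \<open>00x\<close> to \<open>0x\<close>.\<close>

definition roll :: "(nat \<Rightarrow> bool) \<Rightarrow> nat \<Rightarrow> bool" where
  "roll x = (if x 0 then prepend [True, True] (shift 1 x)
     else if x 1 then prepend [True, False] (shift 2 x) else prepend [False] (shift 2 x))"

definition unroll :: "(nat \<Rightarrow> bool) \<Rightarrow> nat \<Rightarrow> bool" where
  "unroll x = (if x 0 then if x 1 then prepend [True] (shift 2 x) else prepend [False, True] (shift 2 x)
     else prepend [False, False] (shift 1 x))"

lemma two_letters: "\<exists>a b y. x = prepend [a, b] y"
  using prepend_shift(2) by metis

lemma roll_prepend: "roll (prepend (a # b # w) x) =
    prepend (if a then True # True # b # w else if b then True # False # w else False # w) x"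
  unfolding roll_def by (auto simp: numeral_2_eq_2 prepend_Cons[of _ "_ # _"] prepend_Cons[of _ w])

lemma unroll_prepend: "unroll (prepend (a # b # w) x) =
    prepend (if a then if b then True # w else False # True # w else False # False # b # w) x"
  unfolding unroll_def by (auto simp: numeral_2_eq_2 prepend_Cons[of _ "_ # _"] prepend_Cons[of _ w])

lemma unroll_roll: "unroll (roll x) = x"
proof -
  obtain a b y where x: "x = prepend [a, b] y" using two_letters by blast
  \<comment> \<open>\<open>roll\<close> shortens the prefix \<open>00\<close> to \<open>0\<close>,
    whereas \<open>unroll_prepend\<close> reads two letters; hence a third letter is
    exposed.\<close>
  obtain c z where y: "y = prepend [c] z" using prepend_shift(1) by metis
  have "x = prepend [a, b, c] z" unfolding x y using prepend_append[of "[a, b]" "[c]" z] by simp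
  then show ?thesis by (cases a; cases b) (simp_all add: roll_prepend unroll_prepend)
qed

lemma roll_unroll: "roll (unroll x) = x"
proof -
  obtain a b y where x: "x = prepend [a, b] y" using two_letters by blast
  obtain c z where y: "y = prepend [c] z" using prepend_shift(1) by metis
  have "x = prepend [a, b, c] z" unfolding x y using prepend_append[of "[a, b]" "[c]" z] by simp
  then show ?thesis by (cases a; cases b) (simp_all add: roll_prepend unroll_prepend)
qed

text \<open>The sequences with a single \<open>False\<close> lie on an infinite orbit, which
  witnesses infinite order.\<close>

lemma roll_point: "roll (\<lambda>j. j \<noteq> k) = (\<lambda>j. j \<noteq> Suc k)"
  unfolding roll_def shift_def prepend_def
  by (cases k) (auto simp: fun_eq_iff less_Suc_eq nth_Cons split: nat.split)

lemma prefix_local_at_coord: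
  assumes "k < n" and g: "\<And>w. length w \<ge> 2 \<Longrightarrow> \<exists>w'. \<forall>x. g (prepend w x) = prepend w' x"
  shows "prefix_local n (at_coord k g)"
  unfolding prefix_local_def
proof (intro exI[of _ 2] allI impI)
  fix u :: "nat \<Rightarrow> bool list" assume "\<forall>i<n. 2 \<le> length (u i)"
  then obtain w' where "\<And>x. g (prepend (u k) x) = prepend w' x" using g assms(1) by blast
  then show "\<exists>v. \<forall>x\<in>points n. at_coord k g (brick_map n u x) = brick_map n v x"
    using assms(1) unfolding at_coord_def brick_map_def
    by (intro exI[of _ "u(k := w')"]) (auto simp: fun_eq_iff)
qed

section \<open>Square roots up to a shift by one letter\<close>

definition head :: "(nat \<Rightarrow> nat \<Rightarrow> bool) \<Rightarrow> bool" where
  "head p = p 0 0"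

definition push :: "bool \<Rightarrow> (nat \<Rightarrow> nat \<Rightarrow> bool) \<Rightarrow> nat \<Rightarrow> nat \<Rightarrow> bool" where
  "push b p = p(0 := prepend [b] (p 0))"

definition pop :: "(nat \<Rightarrow> nat \<Rightarrow> bool) \<Rightarrow> nat \<Rightarrow> nat \<Rightarrow> bool" where
  "pop p = p(0 := shift 1 (p 0))"

lemma head_push [simp]: "head (push b p) = b" and pop_push [simp]: "pop (push b p) = p"
  and push_pop: "push (head p) (pop p) = p"
  unfolding head_def push_def pop_def using prepend_shift(1) by auto

lemma push_pop_points: "0 < n \<Longrightarrow> p \<in> points n \<Longrightarrow> push b p \<in> points n"
  "0 < n \<Longrightarrow> p \<in> points n \<Longrightarrow> pop p \<in> points n"
  unfolding push_def pop_def extensional_def by auto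

lemma push_brick_map: "0 < n \<Longrightarrow> push b (brick_map n v x) = brick_map n (v(0 := b # v 0)) x"
  unfolding push_def brick_map_def by (auto simp: fun_eq_iff prepend_Cons[of b "v 0"])

lemma brick_map_push: "0 < n \<Longrightarrow> u 0 = b # w \<Longrightarrow> brick_map n u x = push b (brick_map n (u(0 := w)) x)"
  by (subst push_brick_map) (auto intro: brick_map_cong)

text \<open>Exchanges the two halves of the space and applies \<open>f\<close> in one direction
  only, so that a round trip from either half applies \<open>f\<close> exactly once.\<close>

definition half_root :: "nat \<Rightarrow> ((nat \<Rightarrow> nat \<Rightarrow> bool) \<Rightarrow> nat \<Rightarrow> nat \<Rightarrow> bool) \<Rightarrow> (nat \<Rightarrow> nat \<Rightarrow> bool) \<Rightarrow> nat \<Rightarrow> nat \<Rightarrow> bool" where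
  "half_root n f = (\<lambda>p\<in>points n. if head p then push False (f (pop p)) else push True (pop p))"

text \<open>The diagonal copy of \<open>f\<close> acting on both halves of the space, obtained as
  the square of \<open>half_root n f\<close>.\<close>

definition behind :: "nat \<Rightarrow> ((nat \<Rightarrow> nat \<Rightarrow> bool) \<Rightarrow> nat \<Rightarrow> nat \<Rightarrow> bool) \<Rightarrow> (nat \<Rightarrow> nat \<Rightarrow> bool) \<Rightarrow> nat \<Rightarrow> nat \<Rightarrow> bool" where
  "behind n f = (\<lambda>p\<in>points n. push (head p) (f (pop p)))"

lemma prefix_local_branch:
  assumes "prefix_local n f" "prefix_local n g" "0 < n"
  shows "prefix_local n (\<lambda>p. if head p then push a (f (pop p)) else push b (g (pop p)))"
proof -
  obtain d where d: "\<And>u. (\<forall>i<n. d \<le> length (u i)) \<Longrightarrow>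
     \<exists>v. \<forall>x\<in>points n. f (brick_map n u x) = brick_map n v x"
    using assms(1) unfolding prefix_local_def by blast
  obtain e where e: "\<And>u. (\<forall>i<n. e \<le> length (u i)) \<Longrightarrow>
     \<exists>v. \<forall>x\<in>points n. g (brick_map n u x) = brick_map n v x"
    using assms(2) unfolding prefix_local_def by blast
  have "\<exists>v. \<forall>x\<in>points n. (if head (brick_map n u x) then push a (f (pop (brick_map n u x)))
      else push b (g (pop (brick_map n u x)))) = brick_map n v x"
    if u: "\<forall>i<n. d + e + 1 \<le> length (u i)" for u
  proof -
    \<comment> \<open>The extra letter of depth decides the branch; without it the words are still
      long enough for \<open>f\<close> and for \<open>g\<close>.\<close>
    have "u 0 \<noteq> []" using u assms(3) by auto
    then obtain c w where w: "u 0 = c # w" by (meson list.exhaust)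
    have len: "\<forall>i<n. d + e \<le> length ((u(0 := w)) i)" using u w by auto
    obtain v where v: "\<forall>x\<in>points n. f (brick_map n (u(0 := w)) x) = brick_map n v x"
      using d[of "u(0 := w)"] len by (meson add_leD1)
    obtain v' where v': "\<forall>x\<in>points n. g (brick_map n (u(0 := w)) x) = brick_map n v' x"
      using e[of "u(0 := w)"] len by (meson add_leD2)
    have "brick_map n u x = push c (brick_map n (u(0 := w)) x)" for x
      by (rule brick_map_push[OF assms(3)]) (rule w)
    then have "head (brick_map n u x) = c" "pop (brick_map n u x) = brick_map n (u(0 := w)) x" for x
      by simp_all
    then show ?thesis
      by (intro exI[of _ "if c then v(0 := a # v 0) else v'(0 := b # v' 0)"])
        (use v v' push_brick_map[OF assms(3)] in simp)
  qed
  then show ?thesis unfolding prefix_local_def by blast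
qed

lemma half_root_prefix_group:
  assumes f: "f \<in> prefix_group n" and n: "0 < n"
  shows "half_root n f \<in> prefix_group n"
proof -
  obtain f' where f': "f \<in> extensional (points n)" "f \<in> points n \<rightarrow> points n" "prefix_local n f"
    "f' \<in> points n \<rightarrow> points n" "prefix_local n f'"
    "\<And>x. x \<in> points n \<Longrightarrow> f' (f x) = x" "\<And>x. x \<in> points n \<Longrightarrow> f (f' x) = x"
    by (rule prefix_groupE[OF f]) (rule that)
  let ?r = "\<lambda>p. if head p then push False (f (pop p)) else push True (pop p)"
  let ?s = "\<lambda>p. if head p then push False (pop p) else push True (f' (pop p))"
  have in_r: "?r p \<in> points n" "?s p \<in> points n" if "p \<in> points n" for p
    using that f' push_pop_points[OF n] by (auto simp: Pi_iff)
  show ?thesis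
  proof (rule prefix_groupI[of _ _ ?s])
    show "half_root n f \<in> extensional (points n)" unfolding half_root_def by simp
    show "half_root n f \<in> points n \<rightarrow> points n" "?s \<in> points n \<rightarrow> points n"
      unfolding half_root_def using in_r by auto
    show "prefix_local n (half_root n f)"
      using prefix_local_branch[OF f'(3) prefix_local_id n] prefix_local_cong[of n "half_root n f" ?r]
      unfolding half_root_def by simp
    show "prefix_local n ?s" using prefix_local_branch[OF prefix_local_id f'(5) n] .
    fix p assume p: "p \<in> points n"
    have pop: "pop p \<in> points n" using push_pop_points[OF n p] by simp
    show "?s (half_root n f p) = p"
      using p pop f' push_pop[of p] unfolding half_root_def by (cases "head p") auto
    show "half_root n f (?s p) = p"
      using p pop f' push_pop[of p] in_r(2)[OF p] unfolding half_root_def by (cases "head p") (auto simp: Pi_iff)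
  qed
qed

text \<open>Placed on coordinate 1 so that it commutes with \<open>push\<close>, which changes only
  coordinate 0.\<close>

definition roll_at :: "nat \<Rightarrow> (nat \<Rightarrow> nat \<Rightarrow> bool) \<Rightarrow> nat \<Rightarrow> nat \<Rightarrow> bool" where
  "roll_at n = (\<lambda>p\<in>points n. at_coord 1 roll p)"

lemma roll_at_prefix_group:
  assumes "2 \<le> n"
  shows "roll_at n \<in> prefix_group n"
proof (rule prefix_groupI[of _ _ "at_coord 1 unroll"])
  have words: "\<exists>a b w'. w = a # b # w'" if "2 \<le> length w" for w :: "bool list"
    using that by (metis One_nat_def Suc_1 Suc_le_length_iff)
  have "prefix_local n (at_coord 1 roll)"
  proof (rule prefix_local_at_coord)
    fix w :: "bool list" assume "2 \<le> length w"
    then show "\<exists>w'. \<forall>x. roll (prepend w x) = prepend w' x" using words roll_prepend by metis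
  qed (use assms in simp)
  then show "prefix_local n (roll_at n)"
    using prefix_local_cong[of n "roll_at n" "at_coord 1 roll"] unfolding roll_at_def by simp
  show "prefix_local n (at_coord 1 unroll)"
  proof (rule prefix_local_at_coord)
    fix w :: "bool list" assume "2 \<le> length w"
    then show "\<exists>w'. \<forall>x. unroll (prepend w x) = prepend w' x" using words unroll_prepend by metis
  qed (use assms in simp)
  have in_points: "at_coord 1 g p \<in> points n" if "p \<in> points n" for g p
    using that assms unfolding at_coord_def extensional_def by auto
  then show "roll_at n \<in> extensional (points n)" "roll_at n \<in> points n \<rightarrow> points n"
    "at_coord 1 unroll \<in> points n \<rightarrow> points n"
    unfolding roll_at_def by auto
  fix p assume p: "p \<in> points n"
  show "at_coord 1 unroll (roll_at n p) = p"
    using p unroll_roll unfolding roll_at_def at_coord_def by simp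
  show "roll_at n (at_coord 1 unroll p) = p"
    using in_points[OF p, of unroll] roll_unroll unfolding roll_at_def at_coord_def by simp
qed

section \<open>Roots of order \<open>2 ^ k\<close> for every \<open>k\<close>\<close>

definition prefix_monoid :: "nat \<Rightarrow> ((nat \<Rightarrow> nat \<Rightarrow> bool) \<Rightarrow> (nat \<Rightarrow> nat \<Rightarrow> bool)) monoid" where
  "prefix_monoid n = BijGroup (points n)\<lparr>carrier := prefix_group n\<rparr>"

lemma carrier_prefix_monoid [simp]: "carrier (prefix_monoid n) = prefix_group n"
  unfolding prefix_monoid_def by simp

lemma group_prefix_monoid: "group (prefix_monoid n)"
  unfolding prefix_monoid_def
  using subgroup.subgroup_is_group[OF prefix_group_subgroup group_BijGroup] .

lemma prefix_monoid_mult: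
  "f \<in> prefix_group n \<Longrightarrow> g \<in> prefix_group n \<Longrightarrow> f \<otimes>\<^bsub>prefix_monoid n\<^esub> g = compose (points n) f g"
  unfolding prefix_monoid_def using prefix_group_Bij unfolding BijGroup_def by simp

lemma prefix_monoid_one: "\<one>\<^bsub>prefix_monoid n\<^esub> = (\<lambda>x\<in>points n. x)"
  unfolding prefix_monoid_def BijGroup_def by simp

lemma mon_prefix_monoid:
  assumes "\<phi> \<in> mon (brin_thompson n) H"
  shows "\<phi> \<in> mon (prefix_monoid n) H"
proof -
  let ?C = "carrier (brin_thompson n)"
  have sub: "prefix_group n \<subseteq> ?C" by (rule prefix_group_brin_thompson)
  have mult: "f \<otimes>\<^bsub>prefix_monoid n\<^esub> g = f \<otimes>\<^bsub>brin_thompson n\<^esub> g" for f g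
    unfolding prefix_monoid_def brin_thompson_def cantor_power_space by simp
  have "\<phi> \<in> ?C \<rightarrow> carrier H" "inj_on \<phi> ?C"
    and hom: "\<And>f g. f \<in> ?C \<Longrightarrow> g \<in> ?C \<Longrightarrow> \<phi> (f \<otimes>\<^bsub>brin_thompson n\<^esub> g) = \<phi> f \<otimes>\<^bsub>H\<^esub> \<phi> g"
    using assms unfolding mon_def hom_def by auto
  then have "\<phi> \<in> prefix_group n \<rightarrow> carrier H" "inj_on \<phi> (prefix_group n)"
    using sub inj_on_subset by blast+
  then show ?thesis using hom sub mult unfolding mon_def hom_def by auto
qed

lemma prefix_group_closed: "f \<in> prefix_group n \<Longrightarrow> x \<in> points n \<Longrightarrow> f x \<in> points n"
  unfolding prefix_group_def by auto

lemma half_root_square: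
  assumes f: "f \<in> prefix_group n" and n: "0 < n"
  shows "half_root n f \<otimes>\<^bsub>prefix_monoid n\<^esub> half_root n f = behind n f"
proof -
  have r: "half_root n f \<in> prefix_group n" using half_root_prefix_group[OF assms] .
  have "half_root n f (half_root n f p) = behind n f p" if p: "p \<in> points n" for p
  proof -
    have pop: "pop p \<in> points n" using push_pop_points[OF n p] by simp
    then show ?thesis
      using p prefix_group_closed[OF f pop] push_pop_points[OF n] unfolding half_root_def behind_def by simp
  qed
  then show ?thesis
    unfolding prefix_monoid_mult[OF r r] by (intro ext) (auto simp: compose_def behind_def)
qed

lemma behind_mult:
  assumes f: "f \<in> prefix_group n" and g: "g \<in> prefix_group n" and n: "0 < n"
  shows "behind n (f \<otimes>\<^bsub>prefix_monoid n\<^esub> g) = behind n f \<otimes>\<^bsub>prefix_monoid n\<^esub> behind n g"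
proof -
  interpret group "prefix_monoid n" by (rule group_prefix_monoid)
  have b: "behind n h \<in> prefix_group n" if "h \<in> prefix_group n" for h
    using half_root_square[OF that n] half_root_prefix_group[OF that n] m_closed by fastforce
  show ?thesis
    unfolding prefix_monoid_mult[OF f g] prefix_monoid_mult[OF b[OF f] b[OF g]]
    using prefix_group_closed[OF g] push_pop_points[OF n]
    by (intro ext) (auto simp: compose_def behind_def)
qed

lemma behind_pow:
  assumes f: "f \<in> prefix_group n" and n: "0 < n"
  shows "behind n (f [^]\<^bsub>prefix_monoid n\<^esub> (k::nat)) = behind n f [^]\<^bsub>prefix_monoid n\<^esub> k"
proof (induction k)
  case 0
  interpret group "prefix_monoid n" by (rule group_prefix_monoid)
  have "behind n (\<lambda>x\<in>points n. x) = (\<lambda>x\<in>points n. x)"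
    using push_pop push_pop_points[OF n] unfolding behind_def by (auto simp: fun_eq_iff)
  then show ?case using prefix_monoid_one by (simp only: nat_pow_0)
next
  case (Suc k)
  interpret group "prefix_monoid n" by (rule group_prefix_monoid)
  have "f [^]\<^bsub>prefix_monoid n\<^esub> k \<in> prefix_group n" using nat_pow_closed[of f k] f by simp
  then show ?case using behind_mult[OF _ f n] Suc by (simp only: nat_pow_Suc)
qed

text \<open>This fixed point closes the iteration: passing to the diagonal copy returns the same
  element.\<close>

lemma behind_roll_at:
  assumes "2 \<le> n"
  shows "behind n (roll_at n) = roll_at n"
proof
  fix p
  show "behind n (roll_at n) p = roll_at n p"
  proof (cases "p \<in> points n")
    case True
    have comm: "push b (at_coord 1 roll q) = at_coord 1 roll (push b q)" for b q
      unfolding push_def at_coord_def by (simp add: fun_upd_twist)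
    have "pop p \<in> points n" using push_pop_points assms True by simp
    moreover have "push (head p) (at_coord 1 roll (pop p)) = at_coord 1 roll p"
      unfolding comm push_pop ..
    ultimately show ?thesis using True unfolding behind_def roll_at_def by simp
  next
    case False
    then show ?thesis unfolding behind_def roll_at_def by simp
  qed
qed

text \<open>If \<open>h\<close> is a root of order \<open>2 ^ k\<close>, then
  \<open>half_root n h\<close> has square \<open>behind n h\<close>, whose power
  \<open>2 ^ k\<close> is the diagonal copy of \<open>roll_at n\<close>, that is,
  \<open>roll_at n\<close> itself.\<close>

lemma roll_at_roots:
  assumes n: "2 \<le> n"
  shows "\<exists>h\<in>prefix_group n. h [^]\<^bsub>prefix_monoid n\<^esub> (2 ^ k :: nat) = roll_at n"
proof (induction k)
  case 0
  interpret group "prefix_monoid n" by (rule group_prefix_monoid)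
  show ?case using roll_at_prefix_group[OF n] by (intro bexI[of _ "roll_at n"]) simp_all
next
  case (Suc k)
  interpret group "prefix_monoid n" by (rule group_prefix_monoid)
  obtain h where h: "h \<in> prefix_group n" "h [^]\<^bsub>prefix_monoid n\<^esub> (2 ^ k :: nat) = roll_at n"
    using Suc by blast
  have n0: "0 < n" using n by simp
  have r: "half_root n h \<in> carrier (prefix_monoid n)" using half_root_prefix_group[OF h(1) n0] by simp
  have "half_root n h [^]\<^bsub>prefix_monoid n\<^esub> (2 * 2 ^ k :: nat)
      = (half_root n h [^]\<^bsub>prefix_monoid n\<^esub> (2::nat)) [^]\<^bsub>prefix_monoid n\<^esub> (2 ^ k :: nat)"
    using nat_pow_pow[OF r] by simp
  also have "half_root n h [^]\<^bsub>prefix_monoid n\<^esub> (2::nat) = behind n h"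
    using half_root_square[OF h(1) n0] r by (simp add: numeral_2_eq_2)
  also have "behind n h [^]\<^bsub>prefix_monoid n\<^esub> (2 ^ k :: nat) = roll_at n"
    using behind_pow[OF h(1) n0, of "2 ^ k"] h(2) behind_roll_at[OF n] by simp
  finally show ?case using r by (intro bexI[of _ "half_root n h"]) simp_all
qed

lemma roll_at_infinite_order:
  assumes n: "2 \<le> n" and p: "roll_at n [^]\<^bsub>prefix_monoid n\<^esub> (p::nat) = \<one>\<^bsub>prefix_monoid n\<^esub>"
  shows "p = 0"
proof -
  interpret group "prefix_monoid n" by (rule group_prefix_monoid)
  define pt where "pt k = (\<lambda>i\<in>{..<n}. \<lambda>j. if i = 1 then j \<noteq> k else True)" for k :: nat
  have pt: "pt k \<in> points n" for k unfolding pt_def by simp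
  have step: "roll_at n (pt k) = pt (Suc k)" for k
    using pt[of k] n roll_point[of k] unfolding roll_at_def at_coord_def
    by (simp add: pt_def) (auto simp: fun_eq_iff)
  have r: "roll_at n \<in> prefix_group n" using roll_at_prefix_group[OF n] .
  have "(roll_at n [^]\<^bsub>prefix_monoid n\<^esub> k) (pt j) = pt (j + k)" for j k :: nat
  proof (induction k arbitrary: j)
    case 0
    then show ?case using pt prefix_monoid_one[of n] by (simp only: nat_pow_0) simp
  next
    case (Suc k)
    have "roll_at n [^]\<^bsub>prefix_monoid n\<^esub> k \<in> prefix_group n"
      using nat_pow_closed[of "roll_at n" k] r by simp
    then show ?case
      using Suc pt step prefix_monoid_mult[OF _ r] by (simp only: nat_pow_Suc) (simp add: compose_def)
  qed
  from this[of p 0] have "pt p = pt 0"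
    using pt prefix_monoid_one[of n] unfolding p by simp
  then have "pt p 1 p = pt 0 1 p" by simp
  then show "p = 0" using n unfolding pt_def by simp
qed

theorem corollary1p4:
  fixes n :: nat
  assumes "n \<ge> 2"
  shows "\<not> (\<exists>(S :: 'a set) R w \<phi>. semigroup_presentation S R \<and> w \<in> lists S \<and> w \<noteq> [] \<and>
           \<phi> \<in> mon (brin_thompson n) (braided_diagram_group S R w))"
proof
  assume "\<exists>(S :: 'a set) R w \<phi>. semigroup_presentation S R \<and> w \<in> lists S \<and> w \<noteq> [] \<and>
    \<phi> \<in> mon (brin_thompson n) (braided_diagram_group S R w)"
  then obtain S :: "'a set" and R w \<phi> where pres: "semigroup_presentation S R" and w: "w \<noteq> []"
    and \<phi>: "\<phi> \<in> mon (brin_thompson n) (braided_diagram_group S R w)" by blast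
  interpret presentation S R "length w" by unfold_locales (rule pres)
  have "\<exists>N'>N. \<exists>h\<in>carrier (prefix_monoid n). h [^]\<^bsub>prefix_monoid n\<^esub> (N'::nat) = roll_at n" for N
    using roll_at_roots[OF assms, of N] by (intro exI[of _ "2 ^ N"]) (simp add: less_exp)
  then obtain p :: nat where "p > 0" "roll_at n [^]\<^bsub>prefix_monoid n\<^esub> p = \<one>\<^bsub>prefix_monoid n\<^esub>"
    using divisible_imp_torsion_group[OF group_prefix_monoid mon_prefix_monoid[OF \<phi>] w refl]
      roll_at_prefix_group[OF assms] by auto
  then show False using roll_at_infinite_order[OF assms] by blast
qed

end
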